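(* Let $s\in\mathbb{C}$ and let $h$ be a solution of $\{h,\tau\}=sE_4(\tau)$ on $\mathfrak{H}$ having a simple zero at $\infty$. If $\Gamma=\{\gamma\in\mathrm{SL}_2(\mathbb{Z}):h(\gamma\tau)=h(\tau)\ \forall\tau\}$ has finite index in $\mathrm{SL}_2(\mathbb{Z})$, then $\Gamma$ has genus zero.
   Context: $\{h,\tau\}=\frac{h'''}{h'}-\frac32(\frac{h''}{h'})^2$, $E_4(\tau)=1+240\sum_{k\ge1}\sigma_3(k)e^{2\pi ik\tau}$. $\Gamma$ is normal in $\mathrm{SL}_2(\mathbb{Z})$; its level $m$ is the smallest positive integer with $\begin{pmatrix}1&m\\0&1\end{pmatrix}\in\Gamma$, and $q_m=e^{2\pi i\tau/m}$ is the local parameter at $\infty$; "$h$ has a simple zero at $\infty$" means that $h$, as a function of $q_m$, has a simple zero at $q_m=0$. The genus of $\Gamma$ is the genus of the compact Riemann surface $X(\Gamma)=\Gamma\backslash(\mathfrak{H}\cup\mathbb{Q}\cup\{\infty\})$. *)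

theory Defs
  imports "HOL-Complex_Analysis.Complex_Analysis" "HOL-Homology.Homology"
begin

abbreviation upper_half_plane :: "complex set" where
  "upper_half_plane \<equiv> {\<tau>. Im \<tau> > 0}"


definition sigma3 :: "nat \<Rightarrow> nat" where
  "sigma3 k = (\<Sum>d | d dvd k. d ^ 3)"

definition E4 :: "complex \<Rightarrow> complex" where
  "E4 \<tau> = 1 + 240 * suminf (\<lambda>k. of_nat (sigma3 (Suc k)) * exp (2 * of_real pi * \<i> * of_nat (Suc k) * \<tau>))"

definition schwarzian :: "(complex \<Rightarrow> complex) \<Rightarrow> complex \<Rightarrow> complex" where
  "schwarzian h \<tau> =
     (deriv ^^ 3) h \<tau> / deriv h \<tau> - 3 / 2 * ((deriv ^^ 2) h \<tau> / deriv h \<tau>)\<^sup>2"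

text \<open>
  Solutions are meromorphic functions, and the equation is an identity between meromorphic
  functions, i.e. it holds off a set without limit points in the upper half-plane (the poles of
  \<open>h\<close> have to be left out because \<open>deriv\<close> is meaningless there). The condition on \<open>deriv h\<close> says
  that \<open>h\<close> is not constant, so that the Schwarzian derivative is defined. The word "nicely" only
  removes arbitrary values: \<open>h\<close> is continuous where it has no pole, and takes the dummy value 0 at
  its poles.
\<close>

definition solves_schwarzian_E4 :: "complex \<Rightarrow> (complex \<Rightarrow> complex) \<Rightarrow> bool" where
  "solves_schwarzian_E4 s h \<longleftrightarrow>
     h nicely_meromorphic_on upper_half_plane \<and>
     (\<forall>\<^sub>\<approx>\<tau>\<in>upper_half_plane. deriv h \<tau> \<noteq> 0 \<and> schwarzian h \<tau> = s * E4 \<tau>)"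


definition SL2Z :: "(int^2^2) monoid" where
  "SL2Z = \<lparr>carrier = {A. det A = 1}, monoid.mult = (**), one = mat 1\<rparr>"

lemma group_SL2Z: "group SL2Z"
proof (rule groupI)
  fix A assume "A \<in> carrier SL2Z"
  then have A: "A $ 1 $ 1 * A $ 2 $ 2 - A $ 1 $ 2 * A $ 2 $ 1 = 1"
    by (simp add: SL2Z_def det_2)
  let ?B = "vector [vector [A $ 2 $ 2, - A $ 1 $ 2], vector [- A $ 2 $ 1, A $ 1 $ 1]] :: int^2^2"
  have "?B ** A = mat 1"
    using A by (simp add: vec_eq_iff matrix_matrix_mult_def mat_def forall_2 sum_2 algebra_simps)
  moreover have "det ?B = 1"
    using A by (simp add: det_2 algebra_simps)
  ultimately show "\<exists>B\<in>carrier SL2Z. B \<otimes>\<^bsub>SL2Z\<^esub> A = \<one>\<^bsub>SL2Z\<^esub>"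
    by (auto simp: SL2Z_def intro!: exI[of _ ?B])
qed (auto simp: SL2Z_def det_mul matrix_mul_assoc)

definition moebius :: "int^2^2 \<Rightarrow> complex \<Rightarrow> complex" where
  "moebius A \<tau> =
     (of_int (A $ 1 $ 1) * \<tau> + of_int (A $ 1 $ 2)) / (of_int (A $ 2 $ 1) * \<tau> + of_int (A $ 2 $ 2))"

text \<open>
  The equation \<open>h (\<gamma> \<tau>) = h \<tau>\<close> is meant in the Riemann sphere: the clause on poles
  distinguishes the value \<open>\<infinity>\<close> from the dummy value 0.
\<close>

definition invariance_group :: "(complex \<Rightarrow> complex) \<Rightarrow> (int^2^2) set" where
  "invariance_group h =
     {\<gamma> \<in> carrier SL2Z. \<forall>\<tau>\<in>upper_half_plane.
        (is_pole h (moebius \<gamma> \<tau>) \<longleftrightarrow> is_pole h \<tau>) \<and> h (moebius \<gamma> \<tau>) = h \<tau>}"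

definition level :: "(int^2^2) set \<Rightarrow> nat" where
  "level \<Gamma> = (LEAST m. m > 0 \<and> vector [vector [1, int m], vector [0, 1]] \<in> \<Gamma>)"

definition simple_zero_at_infinity :: "nat \<Rightarrow> (complex \<Rightarrow> complex) \<Rightarrow> bool" where
  "simple_zero_at_infinity m h \<longleftrightarrow>
     (\<exists>F M. F analytic_on {0} \<and> F 0 = 0 \<and> deriv F 0 \<noteq> 0 \<and>
        (\<forall>\<tau>\<in>upper_half_plane. Im \<tau> > M \<longrightarrow> h \<tau> = F (exp (2 * of_real pi * \<i> * \<tau> / of_nat m))))"


text \<open>
  The points of the extended upper half-plane are taken from the Riemann sphere, encoded as
  \<open>complex option\<close> with \<open>None\<close> for \<open>\<infinity>\<close>.
\<close>

fun moebius_ext :: "int^2^2 \<Rightarrow> complex option \<Rightarrow> complex option" where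
  "moebius_ext A None =
     (if A $ 2 $ 1 = 0 then None else Some (of_int (A $ 1 $ 1) / of_int (A $ 2 $ 1)))"
| "moebius_ext A (Some z) =
     (if of_int (A $ 2 $ 1) * z + of_int (A $ 2 $ 2) = 0 then None else Some (moebius A z))"

definition extended_half_plane_points :: "complex option set" where
  "extended_half_plane_points = Some ` (upper_half_plane \<union> \<rat>) \<union> {None}"

text \<open>
  The usual horoball topology: neighbourhoods of \<open>\<infinity>\<close> contain a half-plane \<open>Im z > M\<close>, and
  neighbourhoods of a rational \<open>x\<close> contain an open disc in the upper half-plane tangent to the real
  axis at \<open>x\<close>.
\<close>

definition extended_half_plane_open :: "complex option set \<Rightarrow> bool" where
  "extended_half_plane_open U \<longleftrightarrow>
     U \<subseteq> extended_half_plane_points \<and>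
     open {z \<in> upper_half_plane. Some z \<in> U} \<and>
     (None \<in> U \<longrightarrow> (\<exists>M>0. \<forall>z. Im z > M \<longrightarrow> Some z \<in> U)) \<and>
     (\<forall>x\<in>\<rat>. Some x \<in> U \<longrightarrow> (\<exists>r>0. \<forall>z\<in>ball (x + of_real r * \<i>) r. Some z \<in> U))"

definition extended_half_plane :: "complex option topology" where
  "extended_half_plane = topology extended_half_plane_open"

lemma horoball_mono:
  assumes "r \<le> r'"
  shows "ball (x + of_real r * \<i>) r \<subseteq> ball (x + of_real r' * \<i>) r'"
proof
  fix z assume "z \<in> ball (x + of_real r * \<i>) r"
  moreover have "dist (x + of_real r' * \<i>) (x + of_real r * \<i>) = r' - r"
    using assms by (simp add: dist_norm norm_mult flip: left_diff_distrib of_real_diff)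
  ultimately show "z \<in> ball (x + of_real r' * \<i>) r'"
    using dist_triangle[of "x + of_real r' * \<i>" z "x + of_real r * \<i>"] by simp
qed

lemma istopology_extended_half_plane_open: "istopology extended_half_plane_open"
  unfolding istopology_def
proof (intro conjI allI impI)
  fix S T assume S: "extended_half_plane_open S" and T: "extended_half_plane_open T"
  have "{z \<in> upper_half_plane. Some z \<in> S \<inter> T} =
        {z \<in> upper_half_plane. Some z \<in> S} \<inter> {z \<in> upper_half_plane. Some z \<in> T}"
    by auto
  moreover have "open {z \<in> upper_half_plane. Some z \<in> S}" "open {z \<in> upper_half_plane. Some z \<in> T}"
    using S T by (simp_all only: extended_half_plane_open_def)
  ultimately have "open {z \<in> upper_half_plane. Some z \<in> S \<inter> T}"
    by (simp only: open_Int)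
  moreover have "\<exists>M>0. \<forall>z. Im z > M \<longrightarrow> Some z \<in> S \<inter> T" if "None \<in> S \<inter> T"
  proof -
    from that S T obtain M N where "M > 0" "\<forall>z. Im z > M \<longrightarrow> Some z \<in> S"
        and "N > 0" "\<forall>z. Im z > N \<longrightarrow> Some z \<in> T"
      unfolding extended_half_plane_open_def by blast
    then show ?thesis by (intro exI[of _ "max M N"]) auto
  qed
  moreover have "\<exists>r>0. \<forall>z\<in>ball (x + of_real r * \<i>) r. Some z \<in> S \<inter> T"
    if "x \<in> \<rat>" "Some x \<in> S \<inter> T" for x
  proof -
    from that S T obtain r r' where "r > 0" "\<forall>z\<in>ball (x + of_real r * \<i>) r. Some z \<in> S"
        and "r' > 0" "\<forall>z\<in>ball (x + of_real r' * \<i>) r'. Some z \<in> T"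
      unfolding extended_half_plane_open_def by (metis IntE)
    moreover have "ball (x + of_real (min r r') * \<i>) (min r r') \<subseteq> ball (x + of_real r * \<i>) r"
      "ball (x + of_real (min r r') * \<i>) (min r r') \<subseteq> ball (x + of_real r' * \<i>) r'"
      by (simp_all only: horoball_mono min.cobounded1 min.cobounded2)
    moreover have "min r r' > 0" using \<open>r > 0\<close> \<open>r' > 0\<close> by simp
    ultimately show ?thesis by (intro exI[of _ "min r r'"]) blast
  qed
  ultimately show "extended_half_plane_open (S \<inter> T)"
    using S unfolding extended_half_plane_open_def by blast
next
  fix K assume K: "\<forall>U\<in>K. extended_half_plane_open U"
  have "{z \<in> upper_half_plane. Some z \<in> \<Union>K} = (\<Union>U\<in>K. {z \<in> upper_half_plane. Some z \<in> U})"
    by auto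
  moreover have "open (\<Union>U\<in>K. {z \<in> upper_half_plane. Some z \<in> U})"
    using K by (intro open_UN) (auto simp: extended_half_plane_open_def)
  ultimately have "open {z \<in> upper_half_plane. Some z \<in> \<Union>K}" by simp
  moreover have "\<Union>K \<subseteq> extended_half_plane_points"
    using K by (auto simp: extended_half_plane_open_def)
  moreover have "\<exists>M>0. \<forall>z. Im z > M \<longrightarrow> Some z \<in> \<Union>K" if "None \<in> \<Union>K"
    using that K unfolding extended_half_plane_open_def by (meson UnionE UnionI)
  moreover have "\<exists>r>0. \<forall>z\<in>ball (x + of_real r * \<i>) r. Some z \<in> \<Union>K"
    if "x \<in> \<rat>" "Some x \<in> \<Union>K" for x
  proof -
    from that(2) obtain U where U: "U \<in> K" "Some x \<in> U" by blast
    with K that(1) obtain r where "r > 0" "\<forall>z\<in>ball (x + of_real r * \<i>) r. Some z \<in> U"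
      unfolding extended_half_plane_open_def by metis
    with U show ?thesis by (intro exI[of _ r]) blast
  qed
  ultimately show "extended_half_plane_open (\<Union>K)"
    unfolding extended_half_plane_open_def by blast
qed

lemma openin_extended_half_plane:
  "openin extended_half_plane = extended_half_plane_open"
  by (simp add: extended_half_plane_def istopology_extended_half_plane_open)

lemma topspace_extended_half_plane: "topspace extended_half_plane = extended_half_plane_points"
proof
  show "topspace extended_half_plane \<subseteq> extended_half_plane_points"
    using openin_topspace[of extended_half_plane]
    by (simp only: openin_extended_half_plane extended_half_plane_open_def)
  have "{z \<in> upper_half_plane. Some z \<in> extended_half_plane_points} = upper_half_plane"
    by (auto simp: extended_half_plane_points_def)
  moreover have "Im z > 0" if "z \<in> ball (x + \<i>) 1" "x \<in> \<rat>" for x z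
  proof -
    from \<open>x \<in> \<rat>\<close> have "Im x = 0" by (auto elim!: Rats_cases' simp: complex_is_Real_iff)
    moreover have "\<bar>Im (x + \<i> - z)\<bar> < 1"
      using that(1) abs_Im_le_cmod[of "x + \<i> - z"] by (simp add: dist_norm)
    ultimately show ?thesis by simp
  qed
  ultimately have "extended_half_plane_open extended_half_plane_points"
    unfolding extended_half_plane_open_def
    by (auto simp: open_halfspace_Im_gt extended_half_plane_points_def
             intro!: exI[of _ "1::real"])
  then show "extended_half_plane_points \<subseteq> topspace extended_half_plane"
    by (simp add: openin_subset openin_extended_half_plane)
qed

definition modular_orbit :: "(int^2^2) set \<Rightarrow> complex option \<Rightarrow> complex option set" where
  "modular_orbit \<Gamma> x = (\<lambda>\<gamma>. moebius_ext \<gamma> x) ` \<Gamma>"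

text \<open>The compactified curve \<open>X(\<Gamma>)\<close>: the set of orbits with the quotient topology.\<close>

definition modular_curve :: "(int^2^2) set \<Rightarrow> complex option set topology" where
  "modular_curve \<Gamma> = topology (\<lambda>V.
     V \<subseteq> modular_orbit \<Gamma> ` topspace extended_half_plane \<and>
     openin extended_half_plane {x \<in> topspace extended_half_plane. modular_orbit \<Gamma> x \<in> V})"

lemma quotient_map_modular_orbit:
  "quotient_map extended_half_plane (modular_curve \<Gamma>) (modular_orbit \<Gamma>)"
proof -
  let ?X = "extended_half_plane" and ?p = "modular_orbit \<Gamma>"
  let ?L = "\<lambda>V. V \<subseteq> ?p ` topspace ?X \<and> openin ?X {x \<in> topspace ?X. ?p x \<in> V}"
  have "istopology ?L"
    unfolding istopology_def
  proof (intro conjI allI impI)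
    fix S T assume L: "?L S" "?L T"
    have "{x \<in> topspace ?X. ?p x \<in> S \<inter> T} =
        {x \<in> topspace ?X. ?p x \<in> S} \<inter> {x \<in> topspace ?X. ?p x \<in> T}" by auto
    then show "openin ?X {x \<in> topspace ?X. ?p x \<in> S \<inter> T}"
      using L by (simp only: openin_Int)
  next
    fix K assume "\<forall>V\<in>K. ?L V"
    moreover have "{x \<in> topspace ?X. ?p x \<in> \<Union>K} = (\<Union>V\<in>K. {x \<in> topspace ?X. ?p x \<in> V})"
      by auto
    ultimately show "openin ?X {x \<in> topspace ?X. ?p x \<in> \<Union>K}"
      by auto
  qed blast+
  then have op: "openin (modular_curve \<Gamma>) = ?L"
    by (simp add: modular_curve_def)
  have "{x \<in> topspace ?X. ?p x \<in> ?p ` topspace ?X} = topspace ?X" by auto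
  then have "?L (?p ` topspace ?X)" by simp
  then have "openin (modular_curve \<Gamma>) (?p ` topspace ?X)" by (simp only: op)
  moreover have "topspace (modular_curve \<Gamma>) \<subseteq> ?p ` topspace ?X"
    using openin_topspace[of "modular_curve \<Gamma>"] by (simp only: op)
  ultimately have "topspace (modular_curve \<Gamma>) = ?p ` topspace ?X"
    by (simp add: openin_subset subset_antisym)
  then show ?thesis
    by (auto simp only: quotient_map_def op)
qed

text \<open>
  The genus of a compact Riemann surface is the \<open>g\<close> for which its first integral singular homology
  group is free abelian of rank \<open>2 g\<close>.
\<close>

definition has_genus :: "'a topology \<Rightarrow> nat \<Rightarrow> bool" where
  "has_genus X g \<longleftrightarrow> homology_group 1 X \<cong> free_Abelian_group {..<2 * g}"

end

theory Submission
  imports Defs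
begin

text \<open>
  Since \<open>E4\<close> has weight 4, \<open>h \<circ> \<gamma>\<close> solves the same Schwarzian equation as \<open>h\<close> for every
  \<open>\<gamma>\<close> in \<open>SL2Z\<close>, so \<open>h \<circ> \<gamma>\<close> is a Moebius transform of \<open>h\<close>. Hence \<open>h\<close> behaves at every cusp
  as it does at \<open>\<infinity>\<close>, where it is locally injective in the parameter \<open>q\<^sub>m\<close>. In the upper
  half-plane \<open>h\<close> is locally injective as well, because \<open>s E4\<close> has no poles. So \<open>h\<close> induces a local
  homeomorphism from the compact connected Hausdorff space \<open>X(\<Gamma>)\<close> to the Riemann sphere. Such a map
  has unique path lifting; the sphere being simply connected, it is a homeomorphism.
\<close>

section \<open>Lifting along unramified maps\<close>

text \<open>Genus is defined here through singular homology, so the curve has to be compared with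
  the sphere as a topological space. Complex analysis therefore enters only through open, locally
  injective charts, and the final argument is pure topology. Three difficulties shape the rest. The
  weight of \<open>E4\<close> is invisible in its q-series; it is obtained by rewriting the series
  as an absolutely convergent sum of (m \<tau> + n)^(-4), where a change of lattice basis is a mere
  reindexing, and this needs the cotangent series and the value of zeta(4). Next, cusps of a
  subgroup can have different widths; the Moebius map \<mu> with h o \<gamma> = \<mu> o h also shows
  that \<Gamma> is normal, so that one parameter serves all of them. Finally, \<open>h\<close>
  carries a dummy value at its poles, so its values are moved to the Riemann sphere, realised as the
  unit sphere of complex x real. Moebius maps act there in homogeneous coordinates, which removes
  the case distinction at infinity.\<close>

lemma connected_lift_unique:
  fixes A :: "'c::topological_space set"
  assumes haus: "Hausdorff_space X"
    and linj: "\<And>x. x \<in> topspace X \<Longrightarrow> \<exists>U. openin X U \<and> x \<in> U \<and> inj_on F U"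
    and A: "connected A"
    and f: "continuous_map (top_of_set A) X f" and g: "continuous_map (top_of_set A) X g"
    and Ff: "\<And>a. a \<in> A \<Longrightarrow> F (f a) = F (g a)"
    and a: "a \<in> A" "f a = g a" and b: "b \<in> A"
  shows "f b = g b"
proof -
  \<comment> \<open>Agreement is a closed condition because \<open>X\<close> is Hausdorff, and an
    open one because near a common value both lifts stay in a set on which \<open>F\<close> is
    injective.\<close>
  let ?E = "{z \<in> A. f z = g z}"
  have "closedin (top_of_set A) ?E"
    using closedin_continuous_maps_eq[OF haus f g] by simp
  moreover have "openin (top_of_set A) ?E"
  proof (subst openin_subopen, intro ballI)
    fix z assume z: "z \<in> ?E"
    then have "f z \<in> topspace X" using f continuous_map_image_subset_topspace by fastforce
    then obtain U where U: "openin X U" "f z \<in> U" "inj_on F U" using linj by blast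
    let ?T = "{w \<in> A. f w \<in> U} \<inter> {w \<in> A. g w \<in> U}"
    have "openin (top_of_set A) ?T"
      using openin_continuous_map_preimage[OF f U(1)] openin_continuous_map_preimage[OF g U(1)]
      by (intro openin_Int) auto
    moreover have "z \<in> ?T" "?T \<subseteq> ?E" using z U Ff by (auto dest: inj_onD)
    ultimately show "\<exists>T. openin (top_of_set A) T \<and> z \<in> T \<and> T \<subseteq> ?E" by blast
  qed
  ultimately have "?E = {} \<or> ?E = A" using A unfolding connected_clopen by blast
  then show ?thesis using a b by blast
qed

text \<open>A substitute for covering maps: compactness and openness produce the neighbourhoods over
  which maps lift, and the remaining condition is local, so it can be checked chart by
  chart.\<close>

locale unramified_map =
  fixes X :: "'b topology" and S :: "'a::real_normed_vector set" and F :: "'b \<Rightarrow> 'a"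
  assumes comp: "compact_space X" and haus: "Hausdorff_space X"
    and cont: "continuous_map X (top_of_set S) F"
    and opn: "open_map X (top_of_set S) F"
    and linj: "\<And>x. x \<in> topspace X \<Longrightarrow> \<exists>U. openin X U \<and> x \<in> U \<and> inj_on F U"
begin

text \<open>A lift may be started over any point of \<open>A\<close> and anywhere in the fibre. With
  this freedom liftability passes to subsets and to unions with connected overlap; over points
  outside the image of \<open>F\<close> the condition is vacuous.\<close>

definition lifts_on :: "('c::topological_space \<Rightarrow> 'a) \<Rightarrow> 'c set \<Rightarrow> bool" where
  "lifts_on \<phi> A \<longleftrightarrow> (\<forall>x\<in>topspace X. \<forall>z\<in>A. F x = \<phi> z \<longrightarrow>
     (\<exists>\<sigma>. continuous_map (top_of_set A) X \<sigma> \<and> \<sigma> z = x \<and> (\<forall>w\<in>A. F (\<sigma> w) = \<phi> w)))"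

lemma lifts_on_subset:
  assumes "lifts_on \<phi> A" "B \<subseteq> A"
  shows "lifts_on \<phi> B"
  unfolding lifts_on_def
proof (intro ballI impI)
  fix x z assume x: "x \<in> topspace X" "z \<in> B" "F x = \<phi> z"
  then obtain \<sigma> where "continuous_map (top_of_set A) X \<sigma>" "\<sigma> z = x" "\<forall>w\<in>A. F (\<sigma> w) = \<phi> w"
    using assms unfolding lifts_on_def by blast
  moreover from this have "continuous_map (top_of_set B) X \<sigma>"
    by (metis assms(2) continuous_map_from_subtopology_mono)
  ultimately show "\<exists>\<sigma>. continuous_map (top_of_set B) X \<sigma> \<and> \<sigma> z = x \<and> (\<forall>w\<in>B. F (\<sigma> w) = \<phi> w)"
    using assms by blast
qed

text \<open>The compact fibre over \<open>b\<close> lies in finitely many open sets on which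
  \<open>F\<close> is injective. What is left of \<open>X\<close> has a compact image that misses
  \<open>b\<close>; off this image, and inside the images of the finitely many sheets, every point
  of \<open>X\<close> lies on a sheet that has a section over all of \<open>N\<close>.\<close>

lemma evenly_covered:
  assumes b: "b \<in> S"
  obtains N where "openin (top_of_set S) N" "b \<in> N" "lifts_on id N"
proof -
  define P where "P U \<longleftrightarrow> openin X U \<and> inj_on F U" for U
  let ?fib = "{x \<in> topspace X. F x = b}"
  have "closedin (top_of_set S) {b}" using b by (simp add: closed_subset)
  from closedin_continuous_map_preimage[OF cont this]
  have "compactin X ?fib" by (intro closedin_compact_space[OF comp]) simp
  moreover have "\<exists>U. \<forall>x\<in>topspace X. P (U x) \<and> x \<in> U x"
    using linj unfolding P_def by (intro bchoice) blast
  then obtain U where U: "\<And>x. x \<in> topspace X \<Longrightarrow> P (U x) \<and> x \<in> U x" by blast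
  ultimately obtain \<F> where \<F>: "finite \<F>" "\<F> \<subseteq> U ` ?fib" "?fib \<subseteq> \<Union>\<F>"
    using compactinD[of X ?fib "U ` ?fib"] unfolding P_def by blast
  let ?W = "\<Union>\<F>"
  have PF: "P V" "b \<in> F ` V" if "V \<in> \<F>" for V using that \<F> U by blast+
  have W: "openin X ?W" using PF unfolding P_def by blast
  have "compactin X (topspace X - ?W)" using W by (intro closedin_compact_space[OF comp]) auto
  then have "compactin (top_of_set S) (F ` (topspace X - ?W))"
    using cont image_compactin by blast
  then have "closedin (top_of_set S) (F ` (topspace X - ?W))"
    by (intro compactin_imp_closedin) (auto simp: Hausdorff_space_subtopology)
  then have o1: "openin (top_of_set S) (S - F ` (topspace X - ?W))"
    by (metis openin_diff openin_subtopology_self)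
  have o2: "openin (top_of_set S) (F ` V)" if "V \<in> \<F>" for V
    using opn PF(1)[OF that] unfolding open_map_def P_def by blast
  \<comment> \<open>Inserting \<open>S\<close> keeps the family nonempty and its intersection inside
    \<open>S\<close> when the fibre over \<open>b\<close> is empty.\<close>
  define N where "N = (S - F ` (topspace X - ?W)) \<inter> \<Inter>(insert S ((`) F ` \<F>))"
  have "openin (top_of_set S) (\<Inter>(insert S ((`) F ` \<F>)))"
    using o2 \<F>(1) by (intro openin_Inter) auto
  then have N: "openin (top_of_set S) N" unfolding N_def using o1 by blast
  have "b \<in> N" using b PF(2) \<F>(3) unfolding N_def by auto
  moreover have "lifts_on id N"
    unfolding lifts_on_def
  proof (intro ballI impI)
    fix x z assume x: "x \<in> topspace X" "z \<in> N" "F x = id z"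
    then have "x \<in> ?W" unfolding N_def by auto
    then obtain V where V: "V \<in> \<F>" "x \<in> V" by blast
    note V' = PF(1)[OF V(1), unfolded P_def]
    define \<sigma> where "\<sigma> = inv_into V F"
    have NV: "N \<subseteq> F ` V" using V(1) unfolding N_def by blast
    have "continuous_map (top_of_set N) X \<sigma>"
      unfolding continuous_map_def
    proof (intro conjI allI impI)
      show "\<sigma> \<in> topspace (top_of_set N) \<rightarrow> topspace X"
        using NV V' inv_into_into[of _ F V] openin_subset unfolding \<sigma>_def by fastforce
      fix T assume T: "openin X T"
      have "openin (top_of_set S) (F ` (V \<inter> T) \<inter> N)"
        using opn V' T N unfolding open_map_def by blast
      moreover have "{w \<in> topspace (top_of_set N). \<sigma> w \<in> T} = F ` (V \<inter> T) \<inter> N"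
        using NV V' by (force simp: \<sigma>_def f_inv_into_f)
      ultimately show "openin (top_of_set N) {w \<in> topspace (top_of_set N). \<sigma> w \<in> T}"
        using N by (metis inf_le2 openin_subset_trans openin_imp_subset)
    qed
    moreover have "\<sigma> z = x" using x V V' by (auto simp: \<sigma>_def)
    moreover have "\<forall>w\<in>N. F (\<sigma> w) = id w" using NV by (auto simp: \<sigma>_def f_inv_into_f)
    ultimately show "\<exists>\<sigma>. continuous_map (top_of_set N) X \<sigma> \<and> \<sigma> z = x \<and> (\<forall>w\<in>N. F (\<sigma> w) = id w)"
      by blast
  qed
  ultimately show ?thesis using N that by blast
qed

lemma lifts_on_local:
  assumes \<phi>: "continuous_on UNIV \<phi>" "range \<phi> \<subseteq> S"
  obtains A where "open A" "z \<in> A" "lifts_on \<phi> A"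
proof -
  obtain N where N: "openin (top_of_set S) N" "\<phi> z \<in> N" "lifts_on id N"
    using evenly_covered \<phi>(2) by blast
  let ?A = "\<phi> -` N"
  have "openin (top_of_set UNIV) (UNIV \<inter> \<phi> -` N)"
    by (rule continuous_openin_preimage[OF \<phi>(1) _ N(1)]) (use \<phi>(2) in auto)
  then have "open ?A" by simp
  moreover have "lifts_on \<phi> ?A"
    unfolding lifts_on_def
  proof (intro ballI impI)
    fix x z assume x: "x \<in> topspace X" "z \<in> ?A" "F x = \<phi> z"
    then obtain \<sigma> where \<sigma>: "continuous_map (top_of_set N) X \<sigma>" "\<sigma> (\<phi> z) = x" "\<forall>w\<in>N. F (\<sigma> w) = w"
      using N(3) unfolding lifts_on_def by force
    have "continuous_map (top_of_set ?A) (top_of_set N) \<phi>"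
      using \<phi>(1) continuous_on_subset by fastforce
    then have "continuous_map (top_of_set ?A) X (\<sigma> \<circ> \<phi>)" using \<sigma>(1) continuous_map_compose by blast
    then show "\<exists>\<sigma>. continuous_map (top_of_set ?A) X \<sigma> \<and> \<sigma> z = x \<and> (\<forall>w\<in>?A. F (\<sigma> w) = \<phi> w)"
      using \<sigma> by (intro exI[of _ "\<sigma> \<circ> \<phi>"]) auto
  qed
  ultimately show ?thesis using that N(2) by blast
qed

text \<open>The lift over \<open>A\<close> is continued over \<open>B\<close> from one point of the
  overlap. Connectedness of the overlap makes the two lifts agree on all of it, so that they can be
  pasted.\<close>

lemma lifts_on_Un_aux:
  assumes A: "open A" "lifts_on \<phi> A" and B: "open B" "lifts_on \<phi> B"
    and AB: "connected (A \<inter> B)" "A \<inter> B \<noteq> {}"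
    and x: "x \<in> topspace X" "z \<in> A" "F x = \<phi> z"
  shows "\<exists>\<sigma>. continuous_map (top_of_set (A \<union> B)) X \<sigma> \<and> \<sigma> z = x \<and> (\<forall>w\<in>A \<union> B. F (\<sigma> w) = \<phi> w)"
proof -
  obtain \<sigma> where \<sigma>: "continuous_map (top_of_set A) X \<sigma>" "\<sigma> z = x" "\<forall>w\<in>A. F (\<sigma> w) = \<phi> w"
    using A x unfolding lifts_on_def by blast
  obtain c where c: "c \<in> A" "c \<in> B" using AB by blast
  have "\<sigma> c \<in> topspace X" using \<sigma>(1) c continuous_map_image_subset_topspace by fastforce
  moreover have "F (\<sigma> c) = \<phi> c" using \<sigma> c by blast
  ultimately obtain \<tau> where \<tau>: "continuous_map (top_of_set B) X \<tau>" "\<tau> c = \<sigma> c" "\<forall>w\<in>B. F (\<tau> w) = \<phi> w"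
    using B c unfolding lifts_on_def by blast
  have eq: "\<sigma> w = \<tau> w" if "w \<in> A \<inter> B" for w
  proof (rule connected_lift_unique[OF haus linj AB(1), of \<sigma> \<tau> c w])
    show "continuous_map (top_of_set (A \<inter> B)) X \<sigma>" "continuous_map (top_of_set (A \<inter> B)) X \<tau>"
      using \<sigma>(1) \<tau>(1) by (meson inf_le1 inf_le2 continuous_map_from_subtopology_mono)+
  qed (use c that \<sigma> \<tau> in auto)
  define \<rho> where "\<rho> w = (if w \<in> A then \<sigma> w else \<tau> w)" for w
  have "continuous_map (top_of_set (A \<union> B)) X \<rho>"
  proof (rule pasting_lemma[where I = "{True,False}" and T = "\<lambda>i. if i then A else B" and f = "\<lambda>i. if i then \<sigma> else \<tau>"])
    show "openin (top_of_set (A \<union> B)) (if i then A else B)" for i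
      using A(1) B(1) by (auto intro: open_subset)
    show "continuous_map (subtopology (top_of_set (A \<union> B)) (if i then A else B)) X (if i then \<sigma> else \<tau>)" for i
      using \<sigma>(1) \<tau>(1) by (auto simp: subtopology_subtopology Int_absorb1)
  qed (auto simp: eq \<rho>_def)
  then show ?thesis using \<sigma> \<tau> x by (intro exI[of _ \<rho>]) (auto simp: \<rho>_def)
qed

lemma lifts_on_Un:
  assumes "open A" "lifts_on \<phi> A" "open B" "lifts_on \<phi> B" "connected (A \<inter> B)" "A \<inter> B \<noteq> {}"
  shows "lifts_on \<phi> (A \<union> B)"
  unfolding lifts_on_def[of \<phi> "A \<union> B"]
proof (intro ballI impI)
  fix x z assume x: "x \<in> topspace X" "z \<in> A \<union> B" "F x = \<phi> z"
  show "\<exists>\<sigma>. continuous_map (top_of_set (A \<union> B)) X \<sigma> \<and> \<sigma> z = x \<and> (\<forall>w\<in>A \<union> B. F (\<sigma> w) = \<phi> w)"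
  proof (cases "z \<in> A")
    case True
    then show ?thesis using lifts_on_Un_aux[OF assms x(1) _ x(3)] by simp
  next
    case False
    then have "z \<in> B" using x by blast
    then show ?thesis
      using lifts_on_Un_aux[OF assms(3,4,1,2) _ _ x(1) _ x(3)] assms(5,6)
      by (simp add: Un_commute[of B] Int_commute[of B])
  qed
qed

text \<open>Bisection takes the place of a Lebesgue number: first along a horizontal segment, then
  for the resulting strips in the vertical direction. The margin \<open>e\<close> makes all pieces
  open and lets neighbours overlap in an open rectangle, which is connected.\<close>

lemma lifts_on_rectangle:
  fixes \<phi> :: "real \<times> real \<Rightarrow> 'a"
  assumes \<phi>: "continuous_on UNIV \<phi>" "range \<phi> \<subseteq> S" and ab: "a \<le> b" and cd: "c \<le> d"
  shows "\<exists>e>0. lifts_on \<phi> ({a-e<..<b+e} \<times> {c-e<..<d+e})"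
proof -
  define Q where "Q a b c d \<longleftrightarrow> (\<exists>e>0. lifts_on \<phi> ({a-e<..<b+e} \<times> {c-e<..<d+e}))" for a b c d
  have mono: "lifts_on \<phi> ({a'-e'<..<b'+e'} \<times> {c'-e'<..<d'+e'})"
    if "lifts_on \<phi> ({a-e<..<b+e} \<times> {c-e<..<d+e})" "a - e \<le> a' - e'" "b' + e' \<le> b + e"
       "c - e \<le> c' - e'" "d' + e' \<le> d + e" for a b c d e a' b' c' d' e'
    using that by (intro lifts_on_subset[OF that(1)]) auto
  have con: "connected ({a<..<b} \<times> {c<..<d})" for a b c d :: real
    by (intro convex_connected convex_Times) auto
  have loc: "\<exists>e>0. lifts_on \<phi> ({x-e<..<x+e} \<times> {y-e<..<y+e})" for x y
  proof -
    obtain A where A: "open A" "(x,y) \<in> A" "lifts_on \<phi> A" using lifts_on_local[OF \<phi>] by blast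
    then obtain e where e: "e > 0" "ball (x,y) e \<subseteq> A" using open_contains_ball by blast
    have "{x-e/2<..<x+e/2} \<times> {y-e/2<..<y+e/2} \<subseteq> ball (x,y) e"
    proof clarify
      fix u v assume "u \<in> {x-e/2<..<x+e/2}" "v \<in> {y-e/2<..<y+e/2}"
      then have "\<bar>x - u\<bar> < e/2" "\<bar>y - v\<bar> < e/2" unfolding greaterThanLessThan_iff by arith+
      moreover have "dist (x,y) (u,v) \<le> \<bar>x - u\<bar> + \<bar>y - v\<bar>"
        by (simp add: dist_Pair_Pair dist_real_def sqrt_sum_squares_le_sum_abs)
      ultimately show "(u,v) \<in> ball (x,y) e" by simp
    qed
    with e have "{x-e/2<..<x+e/2} \<times> {y-e/2<..<y+e/2} \<subseteq> A" by blast
    with e A lifts_on_subset show ?thesis by (intro exI[of _ "e/2"]) auto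
  qed
  have line: "Q a b y y" for y
    using ab
  proof (induction rule: Bolzano)
    case (trans a b c)
    then obtain e f where e: "e > 0" "lifts_on \<phi> ({a-e<..<b+e} \<times> {y-e<..<y+e})"
      and f: "f > 0" "lifts_on \<phi> ({b-f<..<c+f} \<times> {y-f<..<y+f})" unfolding Q_def by auto
    define g where "g = min e f"
    have g: "g > 0" "g \<le> e" "g \<le> f" using e f by (auto simp: g_def)
    have "lifts_on \<phi> ({a-g<..<b+g} \<times> {y-g<..<y+g} \<union> {b-g<..<c+g} \<times> {y-g<..<y+g})"
    proof (rule lifts_on_Un)
      have "{a-g<..<b+g} \<times> {y-g<..<y+g} \<inter> {b-g<..<c+g} \<times> {y-g<..<y+g} = {b-g<..<b+g} \<times> {y-g<..<y+g}"
        using trans g by auto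
      with con show "connected ({a-g<..<b+g} \<times> {y-g<..<y+g} \<inter> {b-g<..<c+g} \<times> {y-g<..<y+g})" by metis
      have "(b,y) \<in> {a-g<..<b+g} \<times> {y-g<..<y+g} \<inter> {b-g<..<c+g} \<times> {y-g<..<y+g}" using trans g by auto
      then show "{a-g<..<b+g} \<times> {y-g<..<y+g} \<inter> {b-g<..<c+g} \<times> {y-g<..<y+g} \<noteq> {}" by blast
    qed (use mono[OF e(2)] mono[OF f(2)] g in \<open>auto intro: open_Times\<close>)
    moreover have "{a-g<..<c+g} \<times> {y-g<..<y+g} \<subseteq> {a-g<..<b+g} \<times> {y-g<..<y+g} \<union> {b-g<..<c+g} \<times> {y-g<..<y+g}"
      using g by auto
    ultimately show ?case unfolding Q_def using g lifts_on_subset by blast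
  next
    case (local x)
    from loc[of x y] obtain e where e: "e > 0" "lifts_on \<phi> ({x-e<..<x+e} \<times> {y-e<..<y+e})" by blast
    \<comment> \<open>A segment through \<open>x\<close> of length below \<open>e/2\<close>, widened
      by \<open>e/2\<close>, stays inside the square given by \<open>loc\<close>.\<close>
    have "Q a b y y" if "a \<le> x" "x \<le> b" "b - a < e/2" for a b
      unfolding Q_def using that e by (intro exI[of _ "e/2"]) (auto intro!: mono[OF e(2)])
    with e show ?case by (intro exI[of _ "e/2"]) auto
  qed
  have "Q a b c d"
    using cd
  proof (induction rule: Bolzano)
    case (trans y z w)
    then obtain e f where e: "e > 0" "lifts_on \<phi> ({a-e<..<b+e} \<times> {y-e<..<z+e})"
      and f: "f > 0" "lifts_on \<phi> ({a-f<..<b+f} \<times> {z-f<..<w+f})" unfolding Q_def by auto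
    define g where "g = min e f"
    have g: "g > 0" "g \<le> e" "g \<le> f" using e f by (auto simp: g_def)
    have "lifts_on \<phi> ({a-g<..<b+g} \<times> {y-g<..<z+g} \<union> {a-g<..<b+g} \<times> {z-g<..<w+g})"
    proof (rule lifts_on_Un)
      have "{a-g<..<b+g} \<times> {y-g<..<z+g} \<inter> {a-g<..<b+g} \<times> {z-g<..<w+g} = {a-g<..<b+g} \<times> {z-g<..<z+g}"
        using trans g by auto
      with con show "connected ({a-g<..<b+g} \<times> {y-g<..<z+g} \<inter> {a-g<..<b+g} \<times> {z-g<..<w+g})" by metis
      have "(a,z) \<in> {a-g<..<b+g} \<times> {y-g<..<z+g} \<inter> {a-g<..<b+g} \<times> {z-g<..<w+g}" using trans g ab by auto
      then show "{a-g<..<b+g} \<times> {y-g<..<z+g} \<inter> {a-g<..<b+g} \<times> {z-g<..<w+g} \<noteq> {}" by blast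
    qed (use mono[OF e(2)] mono[OF f(2)] g in \<open>auto intro: open_Times\<close>)
    moreover have "{a-g<..<b+g} \<times> {y-g<..<w+g} \<subseteq> {a-g<..<b+g} \<times> {y-g<..<z+g} \<union> {a-g<..<b+g} \<times> {z-g<..<w+g}"
      using g by auto
    ultimately show ?case unfolding Q_def using g lifts_on_subset by blast
  next
    case (local y)
    from line[of y] obtain e where e: "e > 0" "lifts_on \<phi> ({a-e<..<b+e} \<times> {y-e<..<y+e})"
      unfolding Q_def by blast
    have "Q a b c d" if "c \<le> y" "y \<le> d" "d - c < e/2" for c d
      unfolding Q_def using that e by (intro exI[of _ "e/2"]) (auto intro!: mono[OF e(2)])
    with e show ?case by (intro exI[of _ "e/2"]) auto
  qed
  then show ?thesis unfolding Q_def .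
qed

text \<open>The constant map is a second lift of the same constant, so uniqueness of lifts
  applies.\<close>

lemma constant_lift:
  fixes I :: "'c::topological_space set"
  assumes "connected I" "continuous_map (top_of_set I) X f" "\<And>t. t \<in> I \<Longrightarrow> F (f t) = p"
    and "u \<in> I" "v \<in> I"
  shows "f u = f v"
proof -
  have "f u \<in> topspace X" using assms continuous_map_image_subset_topspace by fastforce
  then have "continuous_map (top_of_set I) X (\<lambda>_. f u)" by simp
  from connected_lift_unique[OF haus linj assms(1,2) this, of u v] assms(3-5) show ?thesis by auto
qed

text \<open>A path from \<open>x\<close> to \<open>y\<close> in \<open>X\<close> becomes a loop in
  \<open>S\<close>, and a contraction of that loop lifts to a square in \<open>X\<close>. One side
  of the lifted square is the given path; the other three lie over the base point, hence are
  constant, and they join \<open>x\<close> to \<open>y\<close>.\<close>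

theorem injective_if_simply_connected:
  assumes pc: "path_connected_space X" and S: "simply_connected S"
  shows "inj_on F (topspace X)"
proof (rule inj_onI)
  fix x y assume xy: "x \<in> topspace X" "y \<in> topspace X" "F x = F y"
  let ?I = "{0..1::real}"
  obtain g where g: "pathin X g" "g 0 = x" "g 1 = y"
    using pc xy unfolding path_connected_space_def by blast
  then have cg: "continuous_map (top_of_set ?I) X g" by (simp add: pathin_def)
  define p where "p = F \<circ> g"
  have "continuous_map (top_of_set ?I) (top_of_set S) p"
    unfolding p_def by (rule continuous_map_compose[OF cg cont])
  then have "path p" "path_image p \<subseteq> S"
    by (simp_all add: path_def path_image_def continuous_map_in_subtopology image_subset_iff_funcset)
  moreover have "pathfinish p = pathstart p" using g xy by (simp add: p_def pathfinish_def pathstart_def)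
  moreover from \<open>path_image p \<subseteq> S\<close> have "path_image (linepath (pathstart p) (pathstart p)) \<subseteq> S"
    using pathstart_in_path_image[of p] by (auto simp: linepath_refl)
  ultimately have "homotopic_paths S p (linepath (pathstart p) (pathstart p))"
    using S[unfolded simply_connected_eq_homotopic_paths, THEN conjunct2, rule_format,
        of p "linepath (pathstart p) (pathstart p)"]
    by simp
  then obtain H where H0: "continuous_on (?I \<times> ?I) H" "H \<in> ?I \<times> ?I \<rightarrow> S"
    "\<forall>t\<in>?I. H (0, t) = p t" "\<forall>t\<in>?I. H (1, t) = linepath (pathstart p) (pathstart p) t"
    "\<forall>t\<in>?I. pathstart (H \<circ> Pair t) = pathstart p \<and> pathfinish (H \<circ> Pair t) = pathfinish p"
    unfolding homotopic_paths by blast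
  have ps: "pathstart p = F x" "pathfinish p = F x"
    using g xy by (simp_all add: p_def pathfinish_def pathstart_def)
  note H = H0(1,2) H0(3)[rule_format] H0(4)[rule_format, unfolded ps linepath_refl]
    H0(5)[rule_format, unfolded ps, unfolded pathstart_def pathfinish_def o_def, THEN conjunct1]
    H0(5)[rule_format, unfolded ps, unfolded pathstart_def pathfinish_def o_def, THEN conjunct2]
  \<comment> \<open>Clamping both parameters to the unit interval extends the homotopy to the whole
    plane, where \<open>lifts_on_rectangle\<close> has room for its margin.\<close>
  define cl where "cl t = max 0 (min 1 t)" for t :: real
  define \<phi> where "\<phi> z = H (cl (fst z), cl (snd z))" for z
  have clI: "cl t \<in> ?I" "t \<in> ?I \<Longrightarrow> cl t = t" for t by (auto simp: cl_def)
  have ccl: "continuous_on A cl" for A unfolding cl_def by (intro continuous_intros)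
  have "continuous_on UNIV \<phi>" unfolding \<phi>_def
    by (rule continuous_on_compose2[OF H(1)])
       (auto intro!: continuous_intros continuous_on_compose2[OF ccl[of UNIV]] clI simp del: atLeastAtMost_iff)
  moreover have "range \<phi> \<subseteq> S" using H(2) clI by (auto simp: \<phi>_def simp del: atLeastAtMost_iff)
  ultimately obtain e where e: "e > 0" "lifts_on \<phi> ({0-e<..<1+e} \<times> {0-e<..<1+e})"
    using lifts_on_rectangle[of \<phi> 0 1 0 1] by auto
  have "lifts_on \<phi> (?I \<times> ?I)" by (rule lifts_on_subset[OF e(2)]) (use e(1) in auto)
  moreover have "F x = \<phi> (0,0)" using g by (simp add: \<phi>_def cl_def H(5))
  ultimately obtain L where L: "continuous_map (top_of_set (?I \<times> ?I)) X L" "L (0,0) = x"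
    "\<And>w. w \<in> ?I \<times> ?I \<Longrightarrow> F (L w) = \<phi> w"
    unfolding lifts_on_def using xy(1) by force
  have row: "continuous_map (top_of_set ?I) X (\<lambda>t. L (k t))"
    if "continuous_on ?I k" "k \<in> ?I \<rightarrow> ?I \<times> ?I" for k
  proof -
    have "continuous_map (top_of_set ?I) (top_of_set (?I \<times> ?I)) k" using that by auto
    from continuous_map_compose[OF this L(1)] show ?thesis by (simp add: o_def)
  qed
  have "L (0, 1) = g 1"
  proof (rule connected_lift_unique[OF haus linj _ _ cg, of "\<lambda>t. L (0,t)" 0 1])
    show "continuous_map (top_of_set ?I) X (\<lambda>t. L (0, t))" by (rule row) (auto intro!: continuous_intros)
    show "F (L (0, a)) = F (g a)" if "a \<in> ?I" for a using that L(3) H(3) clI by (simp add: \<phi>_def p_def cl_def)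
  qed (use L g in auto)
  moreover have "L (0, 0) = L (1, 0)"
    by (rule constant_lift[of ?I "\<lambda>t. L (t,0)" "F x"], simp, rule row)
       (auto intro!: continuous_intros simp: L(3) \<phi>_def cl_def H(5))
  moreover have "L (1, 0) = L (1, 1)"
    by (rule constant_lift[of ?I "\<lambda>t. L (1,t)" "F x"], simp, rule row)
       (auto intro!: continuous_intros simp: L(3) \<phi>_def cl_def H(4))
  moreover have "L (0, 1) = L (1, 1)"
    by (rule constant_lift[of ?I "\<lambda>t. L (t,1)" "F x"], simp, rule row)
       (auto intro!: continuous_intros simp: L(3) \<phi>_def cl_def H(6))
  ultimately show "x = y" using L(2) g by simp
qed

end

section \<open>The Riemann sphere\<close>

text \<open>The point with homogeneous coordinates (a : b). The vector (0, 0) has no meaning and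
  yields \<open>None\<close>, hence the hypotheses that exclude it below.\<close>

definition proj :: "complex \<Rightarrow> complex \<Rightarrow> complex option" where
  "proj a b = (if b = 0 then None else Some (a / b))"

text \<open>Inverse stereographic projection from the north pole (0, 1). It places the Riemann
  sphere in a Euclidean space, where simple connectedness and homology of spheres are known.\<close>

definition stereo :: "complex option \<Rightarrow> complex \<times> real" where
  "stereo x = (case x of None \<Rightarrow> (0, 1)
     | Some z \<Rightarrow> (2 * z / of_real (1 + (cmod z)\<^sup>2), ((cmod z)\<^sup>2 - 1) / (1 + (cmod z)\<^sup>2)))"

lemma one_plus_sq_pos: "1 + (cmod z)\<^sup>2 > 0" "1 + (cmod z)\<^sup>2 \<noteq> 0"
  by (simp_all add: add_pos_nonneg add_nonneg_eq_0_iff)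

lemma stereo_proj:
  assumes "a \<noteq> 0 \<or> b \<noteq> 0"
  shows "stereo (proj a b) = (2 * a * cnj b / of_real ((cmod a)\<^sup>2 + (cmod b)\<^sup>2),
    ((cmod a)\<^sup>2 - (cmod b)\<^sup>2) / ((cmod a)\<^sup>2 + (cmod b)\<^sup>2))"
proof (cases "b = 0")
  case True
  with assms show ?thesis by (simp add: proj_def stereo_def)
next
  case False
  define n where "n = (cmod b)\<^sup>2"
  have n: "n > 0" using False by (simp add: n_def)
  have e: "1 + (cmod (a / b))\<^sup>2 = ((cmod a)\<^sup>2 + n) / n"
    "(cmod (a / b))\<^sup>2 - 1 = ((cmod a)\<^sup>2 - n) / n"
    using n False by (simp_all add: n_def norm_divide power_divide field_simps)
  have "of_real n = b * cnj b" unfolding n_def by (rule complex_norm_square)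
  then have "2 * (a / b) / of_real (((cmod a)\<^sup>2 + n) / n) = 2 * a * cnj b / of_real ((cmod a)\<^sup>2 + n)"
    using False n by (simp add: field_simps)
  moreover have "((cmod a)\<^sup>2 - n) / n / (((cmod a)\<^sup>2 + n) / n) = ((cmod a)\<^sup>2 - n) / ((cmod a)\<^sup>2 + n)"
    using n by simp
  ultimately show ?thesis using False e by (simp add: proj_def stereo_def n_def)
qed

lemma stereo_in_sphere: "stereo x \<in> sphere 0 1"
proof (cases x)
  case (Some z)
  define t where "t = (cmod z)\<^sup>2"
  have t: "t \<ge> 0" by (simp add: t_def)
  have "(2 * cmod z / (1 + t))\<^sup>2 = 4 * t / (1 + t)\<^sup>2" by (simp add: power_divide power_mult_distrib t_def)
  moreover have "4 * t / (1 + t)\<^sup>2 + ((t - 1) / (1 + t))\<^sup>2 = 1"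
  proof -
    have "4 * t + (t - 1)\<^sup>2 = (1 + t)\<^sup>2" by (simp add: power2_eq_square algebra_simps)
    then have "4 * t / (1 + t)\<^sup>2 + ((t - 1) / (1 + t))\<^sup>2 = (1 + t)\<^sup>2 / (1 + t)\<^sup>2"
      by (simp add: power_divide flip: add_divide_distrib)
    with t show ?thesis by simp
  qed
  moreover have "cmod (2 * z / of_real (1 + t)) = 2 * cmod z / (1 + t)"
    using t by (simp add: norm_divide norm_mult del: of_real_add)
  ultimately show ?thesis using Some
    by (simp add: stereo_def norm_prod_def t_def[symmetric] power_divide del: of_real_add)
qed (simp add: stereo_def norm_prod_def)

text \<open>Two systems of homogeneous coordinates on the sphere. They describe the same point
  because |w|^2 = (1 - t) (1 + t); the first degenerates to (0, 0) at the north pole, the second at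
  the south pole.\<close>

lemma stereo_proj_coordinates:
  assumes "norm (w, t :: real) = 1"
  shows "t \<noteq> 1 \<Longrightarrow> stereo (proj w (of_real (1 - t))) = (w, t)"
    and "t \<noteq> -1 \<Longrightarrow> stereo (proj (of_real (1 + t)) (cnj w)) = (w, t)"
proof -
  have w: "(cmod w)\<^sup>2 = 1 - t\<^sup>2" using assms by (simp add: norm_prod_def)
  {
    assume t: "t \<noteq> 1"
    then have e: "w \<noteq> 0 \<or> complex_of_real (1 - t) \<noteq> 0" by (auto simp flip: of_real_diff)
    have A: "(cmod w)\<^sup>2 + (cmod (of_real (1 - t)))\<^sup>2 = 2 * (1 - t)"
      unfolding norm_of_real power2_abs w by (simp add: power2_eq_square algebra_simps)
    have B: "(cmod w)\<^sup>2 - (cmod (of_real (1 - t)))\<^sup>2 = 2 * (1 - t) * t"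
      unfolding norm_of_real power2_abs w by (simp add: power2_eq_square algebra_simps)
    have "complex_of_real (1 - t) \<noteq> 0" using t by (auto simp flip: of_real_diff)
    then show "stereo (proj w (of_real (1 - t))) = (w, t)"
      unfolding stereo_proj[OF e] A B of_real_mult complex_cnj_complex_of_real using t
      by (simp del: of_real_diff)
  }
  {
    assume t: "t \<noteq> - 1"
    then have t': "1 + t \<noteq> 0" by linarith
    then have e: "complex_of_real (1 + t) \<noteq> 0 \<or> cnj w \<noteq> 0" by (auto simp flip: of_real_add)
    have A: "(cmod (of_real (1 + t)))\<^sup>2 + (cmod (cnj w))\<^sup>2 = 2 * (1 + t)"
      unfolding norm_of_real power2_abs complex_mod_cnj w by (simp add: power2_eq_square algebra_simps)
    have B: "(cmod (of_real (1 + t)))\<^sup>2 - (cmod (cnj w))\<^sup>2 = 2 * (1 + t) * t"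
      unfolding norm_of_real power2_abs complex_mod_cnj w by (simp add: power2_eq_square algebra_simps)
    have "complex_of_real (1 + t) \<noteq> 0" using t' by (metis of_real_eq_0_iff)
    then show "stereo (proj (of_real (1 + t)) (cnj w)) = (w, t)"
      unfolding stereo_proj[OF e] A B of_real_mult complex_cnj_cnj using t'
      by (simp del: of_real_add)
  }
qed

lemma inj_stereo: "inj stereo"
proof -
  have None_eq: "stereo None = (0, 1)" by (simp add: stereo_def)
  have N: "snd (stereo (Some z)) \<noteq> 1" for z
    using one_plus_sq_pos[of z] by (simp add: stereo_def field_simps)
  have inv: "fst (stereo (Some z)) / of_real (1 - snd (stereo (Some z))) = z" for z
  proof -
    have "1 - ((cmod z)\<^sup>2 - 1) / (1 + (cmod z)\<^sup>2) = 2 / (1 + (cmod z)\<^sup>2)"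
      using one_plus_sq_pos[of z] by (simp add: field_simps)
    moreover have "complex_of_real (1 + (cmod z)\<^sup>2) \<noteq> 0" using one_plus_sq_pos(2) by (metis of_real_eq_0_iff)
    ultimately show ?thesis by (simp add: stereo_def del: of_real_add)
  qed
  show ?thesis
  proof (rule injI)
    fix x y assume xy: "stereo x = stereo y"
    show "x = y"
    proof (cases x)
      case None
      then have "snd (stereo y) = 1" using xy None_eq by (metis snd_conv)
      then show ?thesis using N None by (cases y) auto
    next
      case (Some z)
      then have "snd (stereo y) \<noteq> 1" using xy N by metis
      then have "y \<noteq> None" using None_eq by (metis snd_conv)
      then obtain w where w: "y = Some w" by blast
      have "z = fst (stereo x) / of_real (1 - snd (stereo x))" unfolding Some by (rule inv[symmetric])
      also have "\<dots> = w" unfolding xy w by (rule inv)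
      finally show ?thesis using Some w by simp
    qed
  qed
qed

section \<open>Moebius transformations in homogeneous coordinates\<close>

definition mob :: "complex \<Rightarrow> complex \<Rightarrow> complex \<Rightarrow> complex \<Rightarrow> complex option \<Rightarrow> complex option" where
  "mob a b c d x = (case x of None \<Rightarrow> proj a c | Some z \<Rightarrow> proj (a * z + b) (c * z + d))"

lemma proj_scale: "k \<noteq> 0 \<Longrightarrow> proj (k * a) (k * b) = proj a b"
  by (simp add: proj_def)

text \<open>Cramer's rule recovers the vector, times the determinant, from its image. This keeps
  \<open>proj\<close> away from its meaningless argument.\<close>

lemma mob_vector_nonzero:
  assumes "a * d - b * c \<noteq> (0::complex)" "u \<noteq> 0 \<or> v \<noteq> 0"
  shows "a * u + b * v \<noteq> 0 \<or> c * u + d * v \<noteq> 0"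
proof (rule ccontr)
  assume "\<not> ?thesis"
  then have 1: "a * u + b * v = 0" "c * u + d * v = 0" by auto
  have "(a * d - b * c) * u = d * (a * u + b * v) - b * (c * u + d * v)"
    "(a * d - b * c) * v = a * (c * u + d * v) - c * (a * u + b * v)" by (auto simp: algebra_simps)
  with 1 assms show False by auto
qed

lemma mob_proj:
  assumes "u \<noteq> 0 \<or> v \<noteq> 0"
  shows "mob a b c d (proj u v) = proj (a * u + b * v) (c * u + d * v)"
proof (cases "v = 0")
  case True
  then show ?thesis using assms proj_scale[of u a c] by (simp add: mob_def proj_def mult.commute)
next
  case False
  have "proj (a * u + b * v) (c * u + d * v) = proj (v * (a * (u / v) + b)) (v * (c * (u / v) + d))"
    using False by (simp add: algebra_simps)
  also have "\<dots> = proj (a * (u / v) + b) (c * (u / v) + d)" by (rule proj_scale[OF False])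
  finally show ?thesis using False by (simp add: mob_def proj_def)
qed

lemma option_eq_proj: obtains u v where "x = proj u v" "u \<noteq> 0 \<or> v \<noteq> 0"
proof (cases x)
  case None
  then show ?thesis using that[of 1 0] by (simp add: proj_def)
next
  case (Some z)
  then show ?thesis using that[of z 1] by (simp add: proj_def)
qed

lemma mob_mob:
  assumes "a' * d' - b' * c' \<noteq> 0"
  shows "mob a b c d (mob a' b' c' d' x) =
    mob (a * a' + b * c') (a * b' + b * d') (c * a' + d * c') (c * b' + d * d') x"
proof -
  obtain u v where x: "x = proj u v" "u \<noteq> 0 \<or> v \<noteq> 0" by (rule option_eq_proj)
  show ?thesis unfolding x(1) mob_proj[OF x(2)] mob_proj[OF mob_vector_nonzero[OF assms x(2)]]
    by (simp add: algebra_simps)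
qed

definition Mob :: "(complex option \<Rightarrow> complex option) set" where
  "Mob = {mob a b c d | a b c d. a * d - b * c \<noteq> 0}"

lemma Mob_I: "a * d - b * c \<noteq> 0 \<Longrightarrow> mob a b c d \<in> Mob"
  by (auto simp: Mob_def)

lemma Mob_comp:
  assumes "\<mu> \<in> Mob" "\<nu> \<in> Mob"
  shows "\<mu> \<circ> \<nu> \<in> Mob"
proof -
  obtain a b c d where m: "\<mu> = mob a b c d" "a * d - b * c \<noteq> 0" using assms by (auto simp: Mob_def)
  obtain a' b' c' d' where n: "\<nu> = mob a' b' c' d'" "a' * d' - b' * c' \<noteq> 0" using assms by (auto simp: Mob_def)
  have "(a * a' + b * c') * (c * b' + d * d') - (a * b' + b * d') * (c * a' + d * c') =
    (a * d - b * c) * (a' * d' - b' * c')" by (simp add: algebra_simps)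
  moreover have "\<mu> \<circ> \<nu> = mob (a * a' + b * c') (a * b' + b * d') (c * a' + d * c') (c * b' + d * d')"
    unfolding m n by (rule ext) (simp add: mob_mob[OF n(2)])
  ultimately show ?thesis using m(2) n(2) by (auto intro!: Mob_I)
qed

lemma mob_inverse:
  assumes "a * d - b * c \<noteq> 0"
  shows "mob d (- b) (- c) a (mob a b c d x) = x"
proof -
  obtain u v where x: "x = proj u v" "u \<noteq> 0 \<or> v \<noteq> 0" by (rule option_eq_proj)
  have "mob d (- b) (- c) a (mob a b c d x) = proj ((a * d - b * c) * u) ((a * d - b * c) * v)"
    unfolding x(1) mob_proj[OF x(2)] mob_proj[OF mob_vector_nonzero[OF assms x(2)]] by (simp add: algebra_simps)
  also have "\<dots> = x" unfolding x(1) by (rule proj_scale[OF assms])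
  finally show ?thesis .
qed

lemma Mob_inj:
  assumes "\<mu> \<in> Mob"
  shows "inj \<mu>"
proof -
  obtain a b c d where m: "\<mu> = mob a b c d" "a * d - b * c \<noteq> 0" using assms by (auto simp: Mob_def)
  show ?thesis unfolding m(1)
    by (rule inj_on_inverseI[where g = "mob d (- b) (- c) a"]) (rule mob_inverse[OF m(2)])
qed

lemma id_in_Mob: "id \<in> Mob"
proof -
  have "id = mob 1 0 0 1" by (rule ext) (auto simp: mob_def proj_def split: option.split)
  then show ?thesis using Mob_I[of 1 1 0 0] by simp
qed

text \<open>In homogeneous coordinates the only denominator is |a z + b|^2 + |c z + d|^2, which
  never vanishes, so a pole of \<mu> is not an exceptional point.\<close>

lemma continuous_chart:
  assumes "\<mu> \<in> Mob"
  shows "continuous_on UNIV (\<lambda>z. stereo (\<mu> (Some z)))"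
proof -
  obtain a b c d where m: "\<mu> = mob a b c d" "a * d - b * c \<noteq> 0" using assms by (auto simp: Mob_def)
  have nz: "a * z + b \<noteq> 0 \<or> c * z + d \<noteq> 0" for z using mob_vector_nonzero[OF m(2), of z 1] by simp
  then have "(cmod (a * z + b))\<^sup>2 + (cmod (c * z + d))\<^sup>2 \<noteq> 0" for z
    by (auto simp: add_nonneg_eq_0_iff)
  moreover from this have "complex_of_real ((cmod (a * z + b))\<^sup>2 + (cmod (c * z + d))\<^sup>2) \<noteq> 0" for z
    by (metis of_real_eq_0_iff)
  ultimately show ?thesis
    unfolding m(1) mob_def option.case stereo_proj[OF nz]
    by (intro continuous_on_Pair continuous_on_divide continuous_on_mult continuous_on_add continuous_on_diff
        continuous_on_of_real continuous_on_power continuous_on_norm continuous_on_cnj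
        continuous_on_const continuous_on_id) auto
qed

text \<open>A sphere point lies in the image exactly when the inverse Moebius map sends it to a
  finite point of \<open>U\<close>. On each of the two coordinate systems of the sphere this is an
  open condition.\<close>

lemma open_chart:
  assumes "\<mu> \<in> Mob" "open U"
  shows "openin (top_of_set (sphere 0 1)) ((\<lambda>z. stereo (\<mu> (Some z))) ` U)"
proof -
  obtain a b c d where m: "\<mu> = mob a b c d" "a * d - b * c \<noteq> 0" using assms by (auto simp: Mob_def)
  have m': "d * a - (- b) * (- c) \<noteq> 0" using m(2) by (simp add: algebra_simps)
  \<comment> \<open>\<open>p1 p : p2 p\<close> are homogeneous coordinates that depend continuously
    on \<open>p\<close>. The fraction is their image under the adjugate matrix, that is, under the
    inverse Moebius map.\<close>
  define H where "H p1 p2 = {p. - c * p1 p + a * p2 p \<noteq> 0} \<inter>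
    (\<lambda>p. (d * p1 p + - b * p2 p) / (- c * p1 p + a * p2 p)) -` U" for p1 p2 :: "complex \<times> real \<Rightarrow> complex"
  have oH: "open (H p1 p2)" if "continuous_on UNIV p1" "continuous_on UNIV p2" for p1 p2
    unfolding H_def
    by (rule continuous_open_preimage[OF _ _ assms(2)])
       (auto intro!: continuous_intros open_Collect_neq continuous_on_subset[OF that(1)] continuous_on_subset[OF that(2)])
  have key: "stereo (proj u v) \<in> (\<lambda>z. stereo (\<mu> (Some z))) ` U \<longleftrightarrow>
      (- c * u + a * v \<noteq> 0 \<and> (d * u + - b * v) / (- c * u + a * v) \<in> U)" if uv: "u \<noteq> 0 \<or> v \<noteq> 0" for u v
  proof -
    have "stereo (proj u v) \<in> (\<lambda>z. stereo (\<mu> (Some z))) ` U \<longleftrightarrow> (\<exists>z\<in>U. proj u v = \<mu> (Some z))"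
      using inj_stereo by (auto simp: inj_eq)
    also have "\<dots> \<longleftrightarrow> (\<exists>z\<in>U. mob d (- b) (- c) a (proj u v) = Some z)"
      using mob_inverse[OF m(2)] mob_inverse[OF m'] by (metis m(1) minus_minus)
    also have "\<dots> \<longleftrightarrow> (- c * u + a * v \<noteq> 0 \<and> (d * u + - b * v) / (- c * u + a * v) \<in> U)"
      unfolding mob_proj[OF uv] by (auto simp: proj_def)
    finally show ?thesis .
  qed
  let ?G = "(H fst (\<lambda>p. of_real (1 - snd p)) \<inter> {p. snd p \<noteq> 1}) \<union>
            (H (\<lambda>p. of_real (1 + snd p)) (\<lambda>p. cnj (fst p)) \<inter> {p. snd p \<noteq> - 1})"
  have "open ?G" by (intro open_Un open_Int oH open_Collect_neq continuous_intros)
  moreover have "(\<lambda>z. stereo (\<mu> (Some z))) ` U = sphere 0 1 \<inter> ?G"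
  proof (intro equalityI subsetI)
    fix p assume p: "p \<in> (\<lambda>z. stereo (\<mu> (Some z))) ` U"
    then have s: "p \<in> sphere 0 1" using stereo_in_sphere by blast
    obtain w t where wt: "p = (w, t)" by (cases p)
    have n: "norm (w, t) = 1" using s wt by simp
    have "t \<noteq> 1 \<or> t \<noteq> - 1" by linarith
    then show "p \<in> sphere 0 1 \<inter> ?G"
    proof
      assume t: "t \<noteq> 1"
      then have e: "w \<noteq> 0 \<or> complex_of_real (1 - t) \<noteq> 0" by (auto simp flip: of_real_diff)
      show ?thesis using p key[OF e] stereo_proj_coordinates(1)[OF n t] s t by (simp add: wt H_def)
    next
      assume t: "t \<noteq> - 1"
      then have "1 + t \<noteq> 0" by linarith
      then have e: "complex_of_real (1 + t) \<noteq> 0 \<or> cnj w \<noteq> 0" by (auto simp flip: of_real_add)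
      show ?thesis using p key[OF e] stereo_proj_coordinates(2)[OF n t] s t by (simp add: wt H_def)
    qed
  next
    fix p assume p: "p \<in> sphere 0 1 \<inter> ?G"
    obtain w t where wt: "p = (w, t)" by (cases p)
    have n: "norm (w, t) = 1" using p wt by simp
    from p consider (1) "t \<noteq> 1" "p \<in> H fst (\<lambda>p. of_real (1 - snd p))"
      | (2) "t \<noteq> - 1" "p \<in> H (\<lambda>p. of_real (1 + snd p)) (\<lambda>p. cnj (fst p))" using wt by auto
    then show "p \<in> (\<lambda>z. stereo (\<mu> (Some z))) ` U"
    proof cases
      case 1
      then have e: "w \<noteq> 0 \<or> complex_of_real (1 - t) \<noteq> 0" by (auto simp flip: of_real_diff)
      show ?thesis using 1 key[OF e] stereo_proj_coordinates(1)[OF n 1(1)] by (simp add: wt H_def)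
    next
      case 2
      then have "1 + t \<noteq> 0" by linarith
      then have e: "complex_of_real (1 + t) \<noteq> 0 \<or> cnj w \<noteq> 0" by (auto simp flip: of_real_add)
      show ?thesis using 2 key[OF e] stereo_proj_coordinates(2)[OF n 2(1)] by (simp add: wt H_def)
    qed
  qed
  ultimately show ?thesis by (auto simp: openin_open)
qed

section \<open>Homology of the sphere\<close>

lemma isomorphic_trivial_group:
  assumes "trivial_group G" "trivial_group H"
  shows "G \<cong> H"
proof -
  have G: "Group.group G" "carrier G = {\<one>\<^bsub>G\<^esub>}" and H: "Group.group H" "carrier H = {\<one>\<^bsub>H\<^esub>}"
    using assms by (auto simp: trivial_group_def)
  have "(\<lambda>_. \<one>\<^bsub>H\<^esub>) \<in> Group.iso G H"
    using G H by (auto simp: iso_def hom_def bij_betw_def group.is_monoid)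
  then show ?thesis by (rule is_isoI)
qed

text \<open>\<open>Basis\<close> consists of three orthogonal unit vectors, which identifies the
  sphere with \<open>nsphere 2\<close>. In degree 1 reduced and ordinary homology coincide, and both
  are trivial there, like the free group of rank 0.\<close>

lemma has_genus_0_if_homeomorphic_sphere:
  assumes "X homeomorphic_space top_of_set (sphere 0 1 :: (complex \<times> real) set)"
  shows "has_genus X 0"
proof -
  have "independent (Basis :: (complex \<times> real) set)" by (rule independent_Basis)
  then obtain f :: "(nat \<Rightarrow> real) \<Rightarrow> complex \<times> real" and g where
    "homeomorphic_maps (nsphere (3 - 1)) (top_of_set (sphere 0 1 \<inter> span Basis)) f g"
    using homeomorphic_maps_nsphere_euclidean_sphere[of "Basis :: (complex \<times> real) set" 3]
    by (auto simp: orthogonal_Basis DIM_complex)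
  then have "nsphere 2 homeomorphic_space top_of_set (sphere 0 1 :: (complex \<times> real) set)"
    by (auto simp: homeomorphic_space_def span_Basis)
  then have "X homeomorphic_space nsphere 2"
    using assms homeomorphic_space_sym homeomorphic_space_trans by blast
  then have "homology_group 1 X \<cong> reduced_homology_group 1 (nsphere 2)"
    using homeomorphic_space_imp_isomorphic_reduced_homology_groups[of X "nsphere 2" 1]
    by (simp add: un_reduced_homology_group)
  moreover have "trivial_group (reduced_homology_group 1 (nsphere 2))"
    by (simp add: trivial_reduced_homology_group_nsphere)
  ultimately have "trivial_group (homology_group 1 X)"
    using isomorphic_group_triviality[of "homology_group 1 X" "reduced_homology_group 1 (nsphere 2)"]
    by (simp add: group_reduced_homology_group)
  moreover have "trivial_group (free_Abelian_group ({}::nat set))"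
    by (simp add: trivial_group_def) (auto simp: free_Abelian_group_def)
  ultimately show ?thesis unfolding has_genus_def
    by (simp add: isomorphic_trivial_group)
qed

section \<open>The Eisenstein series of weight 4\<close>

lemma summable_on_inverse_one_plus_square:
  "(\<lambda>n::int. 1 / (1 + (of_int n)\<^sup>2 :: real)) summable_on UNIV"
proof -
  have "summable (\<lambda>n. 2 * (1 / (real n + 1)\<^sup>2))"
    using inverse_squares_sums[unfolded sums_iff] by (intro summable_mult) (simp add: add.commute)
  then have "summable (\<lambda>n::nat. 1 / (1 + (real n)\<^sup>2))"
  proof (rule summable_comparison_test[rotated], intro exI allI impI)
    fix n :: nat
    have "0 \<le> (real n - 1)\<^sup>2" by simp
    then have "(real n + 1)\<^sup>2 \<le> 2 * (1 + (real n)\<^sup>2)" by (simp add: power2_eq_square algebra_simps)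
    moreover have "0 < 1 + (real n)\<^sup>2" by (simp add: add_pos_nonneg)
    ultimately show "norm (1 / (1 + (real n)\<^sup>2)) \<le> 2 * (1 / (real n + 1)\<^sup>2)"
      by (simp add: field_simps)
  qed
  then have nat: "(\<lambda>n::nat. 1 / (1 + (real n)\<^sup>2)) summable_on UNIV"
    by (subst summable_on_UNIV_nonneg_real_iff) auto
  have "(\<lambda>n::int. 1 / (1 + (of_int n)\<^sup>2 :: real)) summable_on range int"
    by (subst summable_on_reindex) (use nat in \<open>auto simp: o_def\<close>)
  moreover have "(\<lambda>n::int. 1 / (1 + (of_int n)\<^sup>2 :: real)) summable_on range (\<lambda>n. - int n)"
    by (subst summable_on_reindex) (use nat in \<open>auto simp: o_def inj_on_def\<close>)
  ultimately have "(\<lambda>n::int. 1 / (1 + (of_int n)\<^sup>2 :: real)) summable_on (range int \<union> range (\<lambda>n. - int n))"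
    by (rule summable_on_union)
  moreover have "range int \<union> range (\<lambda>n. - int n) = UNIV"
    by (auto intro: int_cases2)
  ultimately show ?thesis by simp
qed

text \<open>Positive definiteness of |m \<tau> + n|^2. Writing n = u - m Re \<tau> with u the real
  part of m \<tau> + n bounds n^2 by twice the squares, and m is controlled by the imaginary part m
  Im \<tau>; this is where \<open>C\<close> comes from.\<close>

lemma norm_lattice_point_ge:
  assumes "Im \<tau> > 0"
  obtains C where "C > 0" "\<And>m n::real. m\<^sup>2 + n\<^sup>2 \<le> C * (cmod (of_real m * \<tau> + of_real n))\<^sup>2"
proof
  define C where "C = 2 + (1 + 2 * (Re \<tau>)\<^sup>2) / (Im \<tau>)\<^sup>2"
  show "C > 0" unfolding C_def by (intro add_pos_nonneg) auto
  fix m n :: real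
  let ?u = "m * Re \<tau> + n"
  have "0 \<le> (?u + m * Re \<tau>)\<^sup>2" by simp
  then have "m\<^sup>2 + n\<^sup>2 \<le> 2 * ?u\<^sup>2 + (1 + 2 * (Re \<tau>)\<^sup>2) * m\<^sup>2"
    by (simp add: power2_eq_square algebra_simps)
  also have "\<dots> = 2 * ?u\<^sup>2 + (1 + 2 * (Re \<tau>)\<^sup>2) / (Im \<tau>)\<^sup>2 * (m * Im \<tau>)\<^sup>2"
    using assms by (simp add: power_mult_distrib)
  also have "\<dots> \<le> C * ?u\<^sup>2 + C * (m * Im \<tau>)\<^sup>2"
    unfolding C_def by (intro add_mono mult_right_mono) auto
  also have "\<dots> = C * (cmod (of_real m * \<tau> + of_real n))\<^sup>2"
    by (simp add: cmod_power2 algebra_simps)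
  finally show "m\<^sup>2 + n\<^sup>2 \<le> C * (cmod (of_real m * \<tau> + of_real n))\<^sup>2" .
qed

text \<open>The pair (0, 0) contributes \<open>inverse 0 = 0\<close>, so a sum over all integer
  pairs omits the origin by itself and is the Eisenstein series of weight 4.\<close>

definition lattice_term :: "complex \<Rightarrow> int \<times> int \<Rightarrow> complex" where
  "lattice_term \<tau> = (\<lambda>(m, n). inverse ((of_int m * \<tau> + of_int n) ^ 4))"

text \<open>Comparison with the product of two convergent series: for N = m^2 + n^2 \<ge> 1 the
  product (1 + m^2) (1 + n^2) is at most 3 N^2, and N is at most C |m \<tau> + n|^2.\<close>

lemma abs_summable_lattice_term:
  assumes "Im \<tau> > 0"
  shows "(\<lambda>p. norm (lattice_term \<tau> p)) summable_on UNIV"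
proof -
  obtain C where C: "C > 0" "\<And>m n::real. m\<^sup>2 + n\<^sup>2 \<le> C * (cmod (of_real m * \<tau> + of_real n))\<^sup>2"
    using norm_lattice_point_ge[OF assms] by blast
  define a where "a n = 1 / (1 + (of_int n)\<^sup>2 :: real)" for n :: int
  have a: "a summable_on UNIV" "\<And>n. a n > 0"
    using summable_on_inverse_one_plus_square unfolding a_def by (auto simp: add_pos_nonneg)
  have "(\<lambda>p. a (fst p) * a (snd p)) summable_on (UNIV \<times> UNIV)"
  proof (rule summable_on_SigmaI[where g = "\<lambda>m. a m * infsum a UNIV"])
    show "((\<lambda>n. a (fst (m, n)) * a (snd (m, n))) has_sum a m * infsum a UNIV) UNIV" for m
      using a(1) by (auto intro!: has_sum_cmult_right has_sum_infsum)
    show "(\<lambda>m. a m * infsum a UNIV) summable_on UNIV" using a(1) by (rule summable_on_cmult_left)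
    show "0 \<le> a (fst (x, y)) * a (snd (x, y))" for x y using a(2) by (simp add: less_imp_le)
  qed
  then have s: "(\<lambda>p. 3 * C\<^sup>2 * (a (fst p) * a (snd p))) summable_on UNIV"
    by (simp add: summable_on_cmult_right)
  show ?thesis
  proof (rule Infinite_Sum.abs_summable_on_comparison_test'[OF s], clarify)
    fix m n :: int
    let ?N = "(of_int m)\<^sup>2 + (of_int n)\<^sup>2 :: real" and ?z = "of_int m * \<tau> + of_int n"
    show "norm (lattice_term \<tau> (m, n)) \<le> 3 * C\<^sup>2 * (a (fst (m, n)) * a (snd (m, n)))"
    proof (cases "m = 0 \<and> n = 0")
      case True
      then show ?thesis using a(2) C(1) by (simp add: lattice_term_def less_imp_le)
    next
      case False
      then have "m\<^sup>2 + n\<^sup>2 > 0" by (simp add: sum_power2_gt_zero_iff)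
      then have "m\<^sup>2 + n\<^sup>2 \<ge> 1" by linarith
      then have N: "?N \<ge> 1" by (metis (mono_tags) of_int_1 of_int_add of_int_le_iff of_int_power)
      have le: "?N \<le> C * (cmod ?z)\<^sup>2" using C(2)[of "of_int m" "of_int n"] by simp
      have "?N\<^sup>2 \<le> (C * (cmod ?z)\<^sup>2)\<^sup>2" using le N by (intro power_mono) auto
      then have le2: "?N\<^sup>2 \<le> C\<^sup>2 * (cmod ?z) ^ 4" by (simp add: power_mult_distrib flip: power_mult)
      have "?z \<noteq> 0"
      proof
        assume "?z = 0"
        then show False using le N by simp
      qed
      then have z: "(cmod ?z) ^ 4 > 0" by simp
      have "(1 + (of_int m)\<^sup>2) * (1 + (of_int n)\<^sup>2) = 1 + ?N + (of_int m)\<^sup>2 * (of_int n)\<^sup>2"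
        by (simp add: algebra_simps)
      also have "\<dots> \<le> 3 * ?N\<^sup>2"
      proof -
        have "(of_int m)\<^sup>2 * (of_int n)\<^sup>2 \<le> ?N * ?N" by (intro mult_mono) auto
        moreover have "?N \<le> ?N * ?N" "1 \<le> ?N * ?N"
          using N mult_mono[OF N N] mult_left_mono[OF N, of ?N] by auto
        ultimately show ?thesis by (simp add: power2_eq_square)
      qed
      also have "\<dots> \<le> 3 * C\<^sup>2 * (cmod ?z) ^ 4" using le2 by simp
      finally have "(1 + (of_int m)\<^sup>2) * (1 + (of_int n)\<^sup>2) \<le> 3 * C\<^sup>2 * (cmod ?z) ^ 4" .
      moreover have "0 < (1 + (of_int m)\<^sup>2) * (1 + (of_int n)\<^sup>2 :: real)"
        by (intro mult_pos_pos) (auto simp: add_pos_nonneg)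
      ultimately have "inverse ((cmod ?z) ^ 4) \<le> 3 * C\<^sup>2 * (1 / ((1 + (of_int m)\<^sup>2) * (1 + (of_int n)\<^sup>2)))"
        using z by (simp add: field_simps)
      then show ?thesis by (simp add: lattice_term_def a_def norm_inverse norm_power)
    qed
  qed
qed

text \<open>The sum over the row through \<open>z\<close> of the lattice is the third derivative of a cotangent.\<close>

lemma Digamma_reflection:
  assumes "z \<notin> \<int>"
  shows "Polygamma 0 z - Polygamma 0 (1 - z) = - (of_real pi * cos (of_real pi * z) / sin (of_real pi * z :: complex))"
proof -
  have z1: "1 - z \<notin> \<int>" using assms by (metis Ints_1 Ints_diff add_diff_cancel_left' diff_add_cancel minus_diff_eq diff_diff_eq2)
  then have nz: "z \<notin> \<int>\<^sub>\<le>\<^sub>0" "1 - z \<notin> \<int>\<^sub>\<le>\<^sub>0" using assms nonpos_Ints_Int by blast+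
  have s: "sin (of_real pi * z) \<noteq> 0"
    using assms unfolding Complex_Transcendental.sin_eq_0 by (auto simp: mult.commute[of _ "of_real pi"])
  \<comment> \<open>Both sides of Euler's reflection formula are differentiated; dividing by the
    formula itself leaves the logarithmic derivatives.\<close>
  have d1: "((\<lambda>z. Gamma z * Gamma (1 - z)) has_field_derivative
      Gamma z * Polygamma 0 z * Gamma (1 - z) + Gamma z * (Gamma (1 - z) * Polygamma 0 (1 - z) * (-1))) (at z)"
    using nz by (auto intro!: derivative_eq_intros)
  have d2: "((\<lambda>z. of_real pi / sin (of_real pi * z)) has_field_derivative
      - (of_real pi * (of_real pi * cos (of_real pi * z)) / (sin (of_real pi * z))\<^sup>2)) (at z)"
    using s by (auto intro!: derivative_eq_intros simp: power2_eq_square)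
  have "Gamma z * Gamma (1 - z) * (Polygamma 0 z - Polygamma 0 (1 - z)) =
      - (of_real pi * (of_real pi * cos (of_real pi * z)) / (sin (of_real pi * z))\<^sup>2)"
    using DERIV_unique[OF d1[unfolded Gamma_reflection_complex] d2] by (simp add: algebra_simps)
  then have "of_real pi / sin (of_real pi * z) * (Polygamma 0 z - Polygamma 0 (1 - z)) =
      of_real pi / sin (of_real pi * z) * - (of_real pi * cos (of_real pi * z) / sin (of_real pi * z))"
    unfolding Gamma_reflection_complex by (simp add: power2_eq_square)
  then show ?thesis using s by (subst (asm) mult_left_cancel) auto
qed

text \<open>Any closed form \<open>f0\<close> of the digamma difference can be differentiated three
  times. Each derivative flips the sign at 1 - z, so the difference becomes a sum at order 3. The
  closed form is a cotangent at 1/2 and a geometric series in the upper half-plane.\<close>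

lemma Polygamma_3_reflection:
  fixes f0 :: "complex \<Rightarrow> complex"
  assumes U: "open U" "U \<inter> \<int> = {}"
    and d0: "\<And>z. z \<in> U \<Longrightarrow> (f0 has_field_derivative f1 z) (at z)"
    and d1: "\<And>z. z \<in> U \<Longrightarrow> (f1 has_field_derivative f2 z) (at z)"
    and d2: "\<And>z. z \<in> U \<Longrightarrow> (f2 has_field_derivative f3 z) (at z)"
    and eq: "\<And>z. z \<in> U \<Longrightarrow> Polygamma 0 z - Polygamma 0 (1 - z) = f0 z"
    and z: "z \<in> U"
  shows "Polygamma 3 z + Polygamma 3 (1 - z) = f3 z"
proof -
  have nz: "z \<notin> \<int>\<^sub>\<le>\<^sub>0" "1 - z \<notin> \<int>\<^sub>\<le>\<^sub>0" if "z \<in> U" for z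
  proof -
    have "z \<notin> \<int>" using U that by blast
    then have "1 - z \<notin> \<int>" using Ints_diff[OF Ints_1, of "1 - z"] by auto
    with \<open>z \<notin> \<int>\<close> show "z \<notin> \<int>\<^sub>\<le>\<^sub>0" "1 - z \<notin> \<int>\<^sub>\<le>\<^sub>0" using nonpos_Ints_Int by blast+
  qed
  have P: "((\<lambda>z. Polygamma n z + c * Polygamma n (1 - z)) has_field_derivative
      Polygamma (Suc n) z + (- c) * Polygamma (Suc n) (1 - z)) (at z)" if "z \<in> U" for n c z
    using nz[OF that] by (auto intro!: derivative_eq_intros)
  have step: "Polygamma (Suc n) z + (- c) * Polygamma (Suc n) (1 - z) = f' z"
    if "\<And>z. z \<in> U \<Longrightarrow> Polygamma n z + c * Polygamma n (1 - z) = f z"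
       "\<And>z. z \<in> U \<Longrightarrow> (f has_field_derivative f' z) (at z)" "z \<in> U" for n c f f' z
  proof (rule DERIV_unique)
    show "(f has_field_derivative Polygamma (Suc n) z + (- c) * Polygamma (Suc n) (1 - z)) (at z)"
      by (rule has_field_derivative_transform_within_open[OF P[OF that(3)] U(1) that(3)]) (rule that(1))
  qed (rule that(2)[OF that(3)])
  have e1: "\<And>z. z \<in> U \<Longrightarrow> Polygamma 1 z + 1 * Polygamma 1 (1 - z) = f1 z"
    using step[of 0 "-1" f0 f1, OF _ d0] eq by simp
  have e2: "\<And>z. z \<in> U \<Longrightarrow> Polygamma 2 z + (-1) * Polygamma 2 (1 - z) = f2 z"
    using step[of 1 1 f1 f2, OF e1 d1] by (simp add: numeral_2_eq_2)
  show ?thesis using step[of 2 "-1" f2 f3, OF e2 d2 z] by (simp add: numeral_3_eq_3 numeral_2_eq_2)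
qed

text \<open>The cotangent \<open>c\<close> satisfies c' = - \<pi> (1 + c^2) and vanishes at 1/2, so
  the third derivative of - \<pi> c there is 2 \<pi>^4. The points z and 1 - z coincide, which
  accounts for the factor 2.\<close>

lemma Polygamma_3_one_half: "Polygamma 3 (1/2 :: complex) = of_real pi ^ 4"
proof -
  define c where "c z = cos (of_real pi * z) / sin (of_real pi * z)" for z :: complex
  let ?p = "of_real pi :: complex"
  have dc: "(c has_field_derivative - ?p * (1 + (c z)\<^sup>2)) (at z)" if "z \<in> - \<int>" for z
  proof -
    have s: "sin (?p * z) \<noteq> 0"
      using that unfolding Complex_Transcendental.sin_eq_0 by (auto simp: mult.commute[of _ ?p])
    then have "1 + (c z)\<^sup>2 = 1 / (sin (?p * z))\<^sup>2"
      using sin_cos_squared_add[of "?p * z"] by (simp add: c_def field_simps)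
    moreover have "(c has_field_derivative - ?p * (1 / (sin (?p * z))\<^sup>2)) (at z)"
      unfolding c_def
    proof (rule derivative_eq_intros refl s)+
      let ?S = "sin (?p * z)" and ?C = "cos (?p * z)"
      have "?S * ?S + ?C * ?C = 1"
        using sin_cos_squared_add[of "?p * z"] by (simp add: power2_eq_square)
      then have "- ?S * (0 * z + 1 * ?p) * ?S - ?C * (?C * (0 * z + 1 * ?p)) = - ?p"
        by (simp add: algebra_simps flip: distrib_left)
      then show "(- ?S * (0 * z + 1 * ?p) * ?S - ?C * (?C * (0 * z + 1 * ?p))) / (?S * ?S) =
        - ?p * (1 / ?S\<^sup>2)"
        by (simp add: power2_eq_square)
    qed
    ultimately show ?thesis by simp
  qed
  have "Polygamma 3 (1/2 :: complex) + Polygamma 3 (1 - 1/2) =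
      2 * ?p ^ 4 * (1 + (c (1/2))\<^sup>2) * (1 + 3 * (c (1/2))\<^sup>2)"
  proof (rule Polygamma_3_reflection[where U = "- \<int>"])
    show "((\<lambda>z. - (?p * c z)) has_field_derivative ?p\<^sup>2 * (1 + (c z)\<^sup>2)) (at z)" if "z \<in> - \<int>" for z
      by (auto intro!: derivative_eq_intros dc[OF that] simp: power2_eq_square)
    show "((\<lambda>z. ?p\<^sup>2 * (1 + (c z)\<^sup>2)) has_field_derivative - 2 * ?p ^ 3 * c z * (1 + (c z)\<^sup>2)) (at z)"
      if "z \<in> - \<int>" for z
      by (auto intro!: derivative_eq_intros dc[OF that] simp: power2_eq_square power3_eq_cube)
    show "((\<lambda>z. - 2 * ?p ^ 3 * c z * (1 + (c z)\<^sup>2)) has_field_derivative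
        2 * ?p ^ 4 * (1 + (c z)\<^sup>2) * (1 + 3 * (c z)\<^sup>2)) (at z)" if "z \<in> - \<int>" for z
      by (rule derivative_eq_intros dc[OF that] refl)+
         (simp add: algebra_simps power2_eq_square power3_eq_cube power4_eq_xxxx)
    show "(1/2 :: complex) \<in> - \<int>"
    proof
      assume "(1/2 :: complex) \<in> \<int>"
      then obtain k :: int where "1/2 = (of_int k :: complex)" by (auto elim: Ints_cases)
      then have "(of_int 1 :: complex) = of_int (2 * k)" by (simp add: field_simps)
      then have "1 = 2 * k" by (simp only: of_int_eq_iff)
      then show False by presburger
    qed
  qed (auto simp: closed_Ints open_Compl c_def Digamma_reflection)
  moreover have "c (1/2) = 0"
  proof -
    have "cos (complex_of_real pi * (1/2)) = 0"
      using cos_of_real[of "pi/2"] by (simp add: mult.commute)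
    then show ?thesis by (simp add: c_def)
  qed
  ultimately show ?thesis by simp
qed

section \<open>Power series in the nome\<close>

lemma power_sums_summable:
  assumes "norm (q :: complex) < 1"
  shows "summable (\<lambda>n. of_nat n ^ k * q ^ n)"
  using assms
proof (induction k arbitrary: q)
  case 0
  then show ?case by (simp add: summable_geometric)
next
  case (Suc k)
  from termdiff_converges[OF Suc.prems Suc.IH]
  have "summable (\<lambda>n. q * (diffs (\<lambda>n. of_nat n ^ k) n * q ^ n))" by (intro summable_mult) simp
  then have "summable (\<lambda>n. of_nat (Suc n) ^ Suc k * q ^ Suc n)"
    by (simp add: diffs_def algebra_simps)
  then show ?case by (subst (asm) summable_Suc_iff)
qed

text \<open>The polylogarithm of order -k, except that for k = 0 the term \<open>0 ^ 0 = 1\<close>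
  is included, which makes it 1 / (1 - q). The operator q d/dq raises k by one.\<close>

definition power_sums :: "nat \<Rightarrow> complex \<Rightarrow> complex" where
  "power_sums k q = suminf (\<lambda>n. of_nat n ^ k * q ^ n)"

lemma power_sums_deriv:
  assumes "norm q < 1"
  obtains D where "(power_sums k has_field_derivative D) (at q)" "q * D = power_sums (Suc k) q"
proof -
  let ?D = "suminf (\<lambda>n. diffs (\<lambda>n. of_nat n ^ k) n * q ^ n)"
  have "(power_sums k has_field_derivative ?D) (at q)"
    unfolding power_sums_def by (rule termdiffs_strong'[OF power_sums_summable assms])
  moreover have "q * ?D = power_sums (Suc k) q"
  proof -
    have "summable (\<lambda>n. diffs (\<lambda>n. of_nat n ^ k) n * q ^ n)"
      by (rule termdiff_converges[OF assms power_sums_summable])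
    then have "q * ?D = suminf (\<lambda>n. q * (diffs (\<lambda>n. of_nat n ^ k) n * q ^ n))" by (rule suminf_mult[symmetric])
    also have "\<dots> = suminf (\<lambda>n. of_nat (Suc n) ^ Suc k * q ^ Suc n)"
      by (simp add: diffs_def algebra_simps)
    also have "\<dots> = power_sums (Suc k) q"
      unfolding power_sums_def using suminf_split_head[OF power_sums_summable[OF assms, of "Suc k"]] by simp
    finally show ?thesis .
  qed
  ultimately show ?thesis using that by blast
qed

abbreviation nome :: "complex \<Rightarrow> complex" where
  "nome z \<equiv> exp (2 * of_real pi * \<i> * z)"

lemma norm_nome_less_1: "Im z > 0 \<Longrightarrow> norm (nome z) < 1"
  by (simp add: mult_less_0_iff)

lemma power_sums_nome_deriv:
  assumes "Im z > 0"
  shows "((\<lambda>z. power_sums k (nome z)) has_field_derivative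
    2 * of_real pi * \<i> * power_sums (Suc k) (nome z)) (at z)"
proof -
  obtain D where D: "(power_sums k has_field_derivative D) (at (nome z))" "nome z * D = power_sums (Suc k) (nome z)"
    using power_sums_deriv[OF norm_nome_less_1[OF assms]] by blast
  have "(nome has_field_derivative nome z * (2 * of_real pi * \<i>)) (at z)"
    by (auto intro!: derivative_eq_intros)
  from DERIV_chain2[OF D(1) this] show ?thesis
    by (rule DERIV_cong) (simp add: D(2)[symmetric])
qed

text \<open>In the upper half-plane - \<pi> cot(\<pi> z) is a geometric series in the nome up to a
  constant, and every derivative contributes a factor 2 \<pi> i. This is Lipschitz's formula for
  exponent 4 in terms of polygamma functions.\<close>

lemma Polygamma_3_reflection_nome:
  assumes "Im z > 0"
  shows "Polygamma 3 z + Polygamma 3 (1 - z) = 16 * of_real pi ^ 4 * power_sums 3 (nome z)"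
proof -
  let ?c = "2 * of_real pi * \<i> :: complex"
  have "Polygamma 3 z + Polygamma 3 (1 - z) = ?c ^ 4 * power_sums 3 (nome z)"
  proof (rule Polygamma_3_reflection[where U = "{z. Im z > 0}"])
    show "{z. Im z > 0} \<inter> \<int> = {}" by (auto elim!: Ints_cases)
    show "((\<lambda>z. ?c * power_sums 0 (nome z) - of_real pi * \<i>) has_field_derivative
        ?c\<^sup>2 * power_sums 1 (nome z)) (at z)" if "z \<in> {z. Im z > 0}" for z
      using that by (auto intro!: derivative_eq_intros power_sums_nome_deriv simp: power2_eq_square)
    show "((\<lambda>z. ?c\<^sup>2 * power_sums 1 (nome z)) has_field_derivative
        ?c ^ 3 * power_sums 2 (nome z)) (at z)" if "z \<in> {z. Im z > 0}" for z
      using that by (auto intro!: derivative_eq_intros power_sums_nome_deriv simp: eval_nat_numeral)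
    show "((\<lambda>z. ?c ^ 3 * power_sums 2 (nome z)) has_field_derivative
        ?c ^ 4 * power_sums 3 (nome z)) (at z)" if "z \<in> {z. Im z > 0}" for z
      using that by (auto intro!: derivative_eq_intros power_sums_nome_deriv simp: eval_nat_numeral)
    fix z assume z: "z \<in> {z. Im z > 0}"
    \<comment> \<open>A square root of the nome, in which sine and cosine are rational.\<close>
    define w where "w = exp (\<i> * (of_real pi * z))"
    have w: "nome z = w * w" "exp (- (\<i> * (of_real pi * z))) = inverse w" "w \<noteq> 0"
      by (auto simp: w_def exp_minus algebra_simps simp flip: exp_add)
    have n: "norm (w * w) < 1" using z norm_nome_less_1 w by (metis mem_Collect_eq)
    then have w1: "w * w \<noteq> 1" by auto
    have "z \<notin> \<int>" using z by (auto elim!: Ints_cases)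
    from Digamma_reflection[OF this]
    have "Polygamma 0 z - Polygamma 0 (1 - z) = - (of_real pi * cos (of_real pi * z) / sin (of_real pi * z))" .
    also have "\<dots> = - (of_real pi * ((w + inverse w) / 2) / ((w - inverse w) / (2 * \<i>)))"
      unfolding cos_exp_eq sin_exp_eq using w by (simp add: w_def)
    also have "\<dots> = - (of_real pi * \<i> * (w * w + 1) / (w * w - 1))"
      using w(3) w1 by (simp add: divide_simps)
    also have "\<dots> = ?c * (1 / (1 - w * w)) - of_real pi * \<i>"
      using w1 by (simp add: divide_simps) (simp add: algebra_simps)
    also have "1 / (1 - w * w) = power_sums 0 (nome z)"
      using suminf_geometric[OF n] w(1) by (simp add: power_sums_def)
    finally show "Polygamma 0 z - Polygamma 0 (1 - z) = ?c * power_sums 0 (nome z) - of_real pi * \<i>" .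
  qed (use assms in \<open>auto simp: open_halfspace_Im_gt\<close>)
  moreover have "?c ^ 4 = 16 * of_real pi ^ 4" by (simp add: power_mult_distrib)
  ultimately show ?thesis by simp
qed

section \<open>Summing the rows of the lattice\<close>

lemma int_eq_nat_Un_neg: "(UNIV :: int set) = range int \<union> range (\<lambda>k. - 1 - int k)"
proof -
  have "n \<in> range int \<union> range (\<lambda>k. - 1 - int k)" for n
  proof (cases "n \<ge> 0")
    case True
    then show ?thesis by (metis UnI1 nonneg_int_cases rangeI)
  next
    case False
    then have "n = - 1 - int (nat (- 1 - n))" by simp
    then show ?thesis by blast
  qed
  then show ?thesis by blast
qed

text \<open>Unordered summability is assumed; the two ordered sums only identify the value. Negative
  integers are listed as -1 - k because z - 1 - k = - (1 - z + k), which is the series of the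
  polygamma function at 1 - z.\<close>

lemma has_sum_int_split:
  fixes f :: "int \<Rightarrow> complex"
  assumes f: "f summable_on UNIV"
    and p: "(\<lambda>k. f (int k)) sums P" and n: "(\<lambda>k. f (- 1 - int k)) sums N"
  shows "(f has_sum (P + N)) UNIV"
proof -
  have *: "(f has_sum S) (range g)" if g: "inj g" "(\<lambda>k. f (g k)) sums S" for S and g :: "nat \<Rightarrow> int"
  proof -
    have "f summable_on range g" by (rule summable_on_subset_banach[OF f]) simp
    then have "(\<lambda>k. f (g k)) summable_on UNIV" using g by (subst (asm) summable_on_reindex) (auto simp: o_def)
    then obtain T where T: "((\<lambda>k. f (g k)) has_sum T) UNIV" unfolding summable_on_def by blast
    from has_sum_imp_sums[OF this] g(2) have "T = S" by (rule sums_unique2)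
    with T show ?thesis using g by (subst has_sum_reindex) (auto simp: o_def)
  qed
  have "(f has_sum (P + N)) (range int \<union> range (\<lambda>k. - 1 - int k))"
    by (intro has_sum_Un_disjoint * p n) (auto simp: inj_on_def)
  then show ?thesis by (simp flip: int_eq_nat_Un_neg)
qed

lemma summable_on_lattice_row:
  assumes "Im \<tau> > 0"
  shows "(\<lambda>n. lattice_term \<tau> (m, n)) summable_on UNIV"
proof -
  have "lattice_term \<tau> summable_on (UNIV \<times> UNIV)"
    using abs_summable_summable[OF abs_summable_lattice_term[OF assms]] by simp
  then have "(\<lambda>(x, y). lattice_term \<tau> (x, y)) summable_on (SIGMA x:UNIV. UNIV)" by simp
  then show ?thesis by (rule summable_on_SigmaD1) simp
qed

lemma Polygamma_3_sums:
  fixes z :: complex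
  assumes "z \<noteq> 0"
  shows "(\<lambda>k. inverse ((z + of_nat k) ^ 4)) sums (Polygamma 3 z / 6)"
proof -
  have "summable (\<lambda>k. inverse ((z + of_nat k) ^ 4))" by (rule Polygamma_converges'[OF assms]) simp
  then have "(\<lambda>k. inverse ((z + of_nat k) ^ 4)) sums suminf (\<lambda>k. inverse ((z + of_nat k) ^ 4))"
    by (rule summable_sums)
  moreover have "Polygamma 3 z = 6 * suminf (\<lambda>k. inverse ((z + of_nat k) ^ 4))"
    by (simp add: Polygamma_def fact_numeral)
  ultimately show ?thesis by simp
qed

text \<open>Nonnegative n give the polygamma series at z, negative n the one at 1 - z, since fourth
  powers ignore the sign. The constant is 16 / 3!.\<close>

lemma has_sum_lattice_row_one:
  assumes "Im z > 0"
  shows "((\<lambda>n. lattice_term z (1, n)) has_sum 8 / 3 * of_real pi ^ 4 * power_sums 3 (nome z)) UNIV"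
proof -
  have z: "z \<noteq> 0" "1 - z \<noteq> 0" using assms by (auto simp: complex_eq_iff)
  have "(\<lambda>k. lattice_term z (1, int k)) sums (Polygamma 3 z / 6)"
    using Polygamma_3_sums[OF z(1)] by (auto simp: lattice_term_def)
  moreover have "lattice_term z (1, - 1 - int k) = inverse ((1 - z + of_nat k) ^ 4)" for k
  proof -
    have "z + of_int (- 1 - int k) = - (1 - z + of_nat k)" by simp
    then have "(z + of_int (- 1 - int k)) ^ 4 = (1 - z + of_nat k) ^ 4"
      by (metis even_numeral power_minus_even)
    then show ?thesis by (simp add: lattice_term_def)
  qed
  then have "(\<lambda>k. lattice_term z (1, - 1 - int k)) sums (Polygamma 3 (1 - z) / 6)"
    using Polygamma_3_sums[OF z(2)] by simp
  ultimately have "((\<lambda>n. lattice_term z (1, n)) has_sum (Polygamma 3 z / 6 + Polygamma 3 (1 - z) / 6)) UNIV"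
    by (rule has_sum_int_split[OF summable_on_lattice_row[OF assms]])
  also have "Polygamma 3 z / 6 + Polygamma 3 (1 - z) / 6 = 8 / 3 * of_real pi ^ 4 * power_sums 3 (nome z)"
    using Polygamma_3_reflection_nome[OF assms] by (simp flip: add_divide_distrib)
  finally show ?thesis .
qed

text \<open>The value of zeta(4). The even terms give 1/16 of the whole sum Z, and the odd terms are
  the polygamma series at 1/2 scaled by 1/16, so Z = Z / 16 + \<pi>^4 / 96. The term at 0 is the
  default \<open>inverse 0 = 0\<close>.\<close>

lemma inverse_fourth_powers_sums: "(\<lambda>n. inverse (of_nat n ^ 4)) sums (of_real pi ^ 4 / 90 :: complex)"
proof -
  define f where "f n = inverse (of_nat n ^ 4 :: complex)" for n
  have "(\<lambda>n. lattice_term \<i> (0, n)) summable_on range int"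
    by (rule summable_on_subset_banach[OF summable_on_lattice_row]) auto
  then have sf: "f summable_on UNIV"
    by (subst (asm) summable_on_reindex) (auto simp: o_def lattice_term_def f_def[abs_def])
  then obtain Z where Z: "(f has_sum Z) UNIV" unfolding summable_on_def by blast
  have e: "(f has_sum (inverse 16 * Z)) (range (\<lambda>k. 2 * k))"
  proof (subst has_sum_reindex)
    have "((\<lambda>k. inverse 16 * f k) has_sum inverse 16 * Z) UNIV" by (rule has_sum_cmult_right[OF Z])
    then show "(f \<circ> (\<lambda>k. 2 * k) has_sum inverse 16 * Z) UNIV"
      by (rule has_sum_cong[THEN iffD1, rotated]) (simp add: f_def power_mult_distrib)
  qed (auto simp: inj_on_def)
  have o: "(f has_sum (of_real pi ^ 4 / 96)) (range (\<lambda>k. 2 * k + 1))"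
  proof (subst has_sum_reindex)
    have "f summable_on range (\<lambda>k. 2 * k + 1)" by (rule summable_on_subset_banach[OF sf]) auto
    then have "(f \<circ> (\<lambda>k. 2 * k + 1)) summable_on UNIV" by (subst (asm) summable_on_reindex) (auto simp: inj_on_def)
    then obtain T where T: "(f \<circ> (\<lambda>k. 2 * k + 1) has_sum T) UNIV" unfolding summable_on_def by blast
    have "(\<lambda>k. inverse 16 * inverse ((1/2 + of_nat k) ^ 4)) sums (inverse 16 * (Polygamma 3 (1/2) / 6 :: complex))"
      by (intro sums_mult Polygamma_3_sums) simp
    moreover have "inverse 16 * inverse ((1/2 + of_nat k) ^ 4) = (f \<circ> (\<lambda>k. 2 * k + 1)) k" for k
    proof -
      have "16 * (1/2 + of_nat k) ^ 4 = (of_nat (2 * k + 1) :: complex) ^ 4"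
        using power_mult_distrib[of "2 :: complex" "1/2 + of_nat k" 4] by (simp add: distrib_left)
      then show ?thesis unfolding f_def o_def by (metis inverse_mult_distrib)
    qed
    ultimately have "(f \<circ> (\<lambda>k. 2 * k + 1)) sums (of_real pi ^ 4 / 96)"
      by (simp add: Polygamma_3_one_half o_def)
    with has_sum_imp_sums[OF T] have "T = of_real pi ^ 4 / 96" by (rule sums_unique2)
    with T show "(f \<circ> (\<lambda>k. 2 * k + 1) has_sum (of_real pi ^ 4 / 96)) UNIV" by simp
  qed (auto simp: inj_on_def)
  have "range (\<lambda>k. 2 * k) \<inter> range (\<lambda>k. 2 * k + 1) = ({} :: nat set)" by (auto, presburger)
  from has_sum_Un_disjoint[OF e o this]
  have "(f has_sum (inverse 16 * Z + of_real pi ^ 4 / 96)) (range (\<lambda>k. 2 * k) \<union> range (\<lambda>k. 2 * k + 1))" .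
  moreover have "n \<in> range (\<lambda>k. 2 * k) \<union> range (\<lambda>k. 2 * k + 1)" for n :: nat
    by (cases "even n") (auto elim!: evenE oddE)
  then have "range (\<lambda>k. 2 * k) \<union> range (\<lambda>k. 2 * k + 1) = (UNIV :: nat set)" by blast
  ultimately have "Z = inverse 16 * Z + of_real pi ^ 4 / 96" using Z has_sum_unique by metis
  then have "Z = of_real pi ^ 4 / 90" by (simp add: field_simps)
  moreover have "f sums Z" by (rule has_sum_imp_sums[OF Z])
  ultimately show ?thesis unfolding f_def[abs_def] by (simp only:)
qed

lemma has_sum_lattice_row_zero:
  "((\<lambda>n. lattice_term \<tau> (0, n)) has_sum (of_real pi ^ 4 / 45)) UNIV"
proof -
  have s: "(\<lambda>n. lattice_term \<tau> (0, n)) summable_on UNIV"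
    using summable_on_lattice_row[of \<i> 0] by (simp add: lattice_term_def)
  have "(\<lambda>k. lattice_term \<tau> (0, int k)) sums (of_real pi ^ 4 / 90)"
    using inverse_fourth_powers_sums by (simp add: lattice_term_def)
  moreover have "(\<lambda>k. lattice_term \<tau> (0, - 1 - int k)) sums (of_real pi ^ 4 / 90)"
  proof -
    have "lattice_term \<tau> (0, - 1 - int k) = inverse (of_nat (Suc k) ^ 4)" for k
    proof -
      have "of_int (- 1 - int k) = - (of_nat (Suc k) :: complex)" by simp
      then have "of_int (- 1 - int k) ^ 4 = (of_nat (Suc k) :: complex) ^ 4"
        by (metis even_numeral power_minus_even)
      then show ?thesis by (simp add: lattice_term_def)
    qed
    moreover have "(\<lambda>k. inverse (of_nat (Suc k) ^ 4)) sums (of_real pi ^ 4 / 90 :: complex)"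
      using sums_Suc_iff[of "\<lambda>n. inverse (of_nat n ^ 4) :: complex"] inverse_fourth_powers_sums by simp
    ultimately show ?thesis by simp
  qed
  ultimately have "((\<lambda>n. lattice_term \<tau> (0, n)) has_sum (of_real pi ^ 4 / 90 + of_real pi ^ 4 / 90)) UNIV"
    by (rule has_sum_int_split[OF s])
  then show ?thesis by simp
qed

text \<open>Both sides sum \<open>n\<^sup>3 q\<^sup>m\<^sup>n\<close> over \<open>m, n > 0\<close>.\<close>

lemma divisor_sum_series:
  assumes q: "norm (q :: complex) < 1"
  shows "(\<lambda>m. power_sums 3 (q ^ Suc m)) summable_on UNIV"
    and "(\<lambda>k. of_nat (sigma3 k) * q ^ k) sums (infsum (\<lambda>m. power_sums 3 (q ^ Suc m)) UNIV)"
proof -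
  define f where "f = (\<lambda>(m, n). of_nat n ^ 3 * q ^ (Suc m * n))"
  let ?r = "norm q"
  have r: "\<bar>?r\<bar> < 1" using q by simp
  have "norm (of_real ?r :: complex) < 1" using q by simp
  from summable_Re[OF power_sums_summable[OF this, of 3]]
  have "summable (\<lambda>n. Re (of_nat n ^ 3 * of_real ?r ^ n))" .
  moreover have "Re (of_nat n ^ 3 * of_real ?r ^ n) = norm (of_nat n ^ 3 * q ^ n)" for n
  proof -
    have "of_nat n ^ 3 * of_real ?r ^ n = complex_of_real (real n ^ 3 * ?r ^ n)" by simp
    then show ?thesis by (metis Re_complex_of_real norm_mult norm_power norm_of_nat)
  qed
  ultimately have r3: "summable (\<lambda>n. norm (of_nat n ^ 3 * q ^ n))" by simp
  have nf: "(\<lambda>p. norm (f p)) summable_on (UNIV \<times> UNIV)"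
  proof -
    define g where "g n = norm (of_nat n ^ 3 * q ^ n)" for n :: nat
    have g: "g summable_on UNIV" using r3 unfolding g_def by (simp add: norm_summable_imp_summable_on)
    have geo: "(\<lambda>m. ?r ^ m) summable_on UNIV" using r by (subst summable_on_UNIV_nonneg_real_iff) auto
    have "(\<lambda>p. ?r ^ fst p * g (snd p)) summable_on (UNIV \<times> UNIV)"
    proof (rule summable_on_SigmaI[where g = "\<lambda>m. ?r ^ m * infsum g UNIV"])
      show "((\<lambda>n. ?r ^ fst (m, n) * g (snd (m, n))) has_sum ?r ^ m * infsum g UNIV) UNIV" for m
        using g by (auto intro!: has_sum_cmult_right has_sum_infsum)
      show "(\<lambda>m. ?r ^ m * infsum g UNIV) summable_on UNIV" using geo by (rule summable_on_cmult_left)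
    qed (simp add: g_def)
    then show ?thesis
    proof (rule Infinite_Sum.abs_summable_on_comparison_test')
      fix p :: "nat \<times> nat" obtain m n where p: "p = (m, n)" by (cases p)
      show "norm (f p) \<le> ?r ^ fst p * g (snd p)"
      proof (cases "n = 0")
        case False
        then obtain n' where n': "n = Suc n'" by (cases n) auto
        \<comment> \<open>For n > 0 the product \<open>Suc m * n\<close> is at least m + n, which
          decouples the two indices in the majorant.\<close>
        have "?r ^ (Suc m * n) \<le> ?r ^ (m + n)"
          using q by (intro power_decreasing) (auto simp: n')
        then have "of_nat n ^ 3 * ?r ^ (Suc m * n) \<le> of_nat n ^ 3 * ?r ^ (m + n)" by (intro mult_left_mono) auto
        then show ?thesis unfolding p
          by (simp add: f_def g_def norm_mult norm_power power_add algebra_simps)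
      qed (simp add: p f_def g_def)
    qed
  qed
  have row: "((\<lambda>n. f (m, n)) has_sum power_sums 3 (q ^ Suc m)) UNIV" for m
  proof -
    have "norm (q ^ Suc m) < 1" unfolding norm_power using q power_Suc_less_one[of "norm q" m]
      by (metis norm_ge_zero power_less_one_iff zero_less_Suc)
    from summable_sums[OF power_sums_summable[OF this, of 3]]
    have "(\<lambda>n. f (m, n)) sums power_sums 3 (q ^ Suc m)"
      by (simp add: f_def power_sums_def power_mult del: power_Suc mult_Suc)
    moreover have "summable (\<lambda>n. norm (f (m, n)))"
    proof -
      have "(\<lambda>n. norm (f (m, n))) summable_on UNIV"
      proof (rule summable_on_SigmaD1[where A = UNIV and f = "\<lambda>x y. norm (f (x, y))" and B = "\<lambda>_. UNIV"])
        show "(\<lambda>(x, y). norm (f (x, y))) summable_on (SIGMA x:UNIV. UNIV)"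
          using nf by (rule summable_on_cong[THEN iffD1, rotated]) auto
      qed simp
      then show ?thesis by (rule summable_on_imp_summable)
    qed
    ultimately show ?thesis by (intro norm_summable_imp_has_sum)
  qed
  have sf: "f summable_on (UNIV \<times> UNIV)" using nf by (rule abs_summable_summable)
  then obtain S where S: "(f has_sum S) (UNIV \<times> UNIV)" unfolding summable_on_def by blast
  have "((\<lambda>m. power_sums 3 (q ^ Suc m)) has_sum S) UNIV" by (rule has_sum_SigmaD[OF S row])
  note R = this
  show "(\<lambda>m. power_sums 3 (q ^ Suc m)) summable_on UNIV"
    using R unfolding summable_on_def by blast
  have S_eq: "infsum (\<lambda>m. power_sums 3 (q ^ Suc m)) UNIV = S" using R by (rule infsumI)
  \<comment> \<open>The pair (k, d) stands for n = d and Suc m = k / d. The value k = 0 has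
    infinitely many divisors and is left out; it corresponds to n = 0, where \<open>f\<close>
    vanishes.\<close>
  let ?D = "Sigma {0<..} (\<lambda>k::nat. {d. d dvd k})"
  have "(f has_sum S) (UNIV \<times> {0<..})"
    using S by (rule has_sum_cong_neutral[THEN iffD1, rotated 3]) (auto simp: f_def)
  moreover have "((\<lambda>(k, d). of_nat (d ^ 3) * q ^ k) has_sum S) ?D \<longleftrightarrow> (f has_sum S) (UNIV \<times> {0<..})"
  proof (rule has_sum_reindex_bij_witness[where j = "\<lambda>(k, d). (k div d - 1, d)" and i = "\<lambda>(m, n). (Suc m * n, n)"])
    show "f ((\<lambda>(k, d). (k div d - 1, d)) p) = (\<lambda>(k, d). of_nat (d ^ 3) * q ^ k) p" if pD: "p \<in> ?D" for p
    proof -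
      obtain m d where p: "p = (m * d, d)" "m > 0" "d > 0" using pD by (auto elim!: dvdE simp: mult.commute)
      then obtain m' where "m = Suc m'" by (cases m) auto
      with p show ?thesis by (auto simp: f_def)
    qed
    show "(\<lambda>(m, n). (Suc m * n, n)) ((\<lambda>(k, d). (k div d - 1, d)) p) = p" if pD: "p \<in> ?D" for p
    proof -
      obtain m d where p: "p = (m * d, d)" "m > 0" "d > 0" using pD by (auto elim!: dvdE simp: mult.commute)
      then obtain m' where "m = Suc m'" by (cases m) auto
      with p show ?thesis by auto
    qed
  qed (auto elim!: dvdE)
  ultimately have "((\<lambda>(k, d). of_nat (d ^ 3) * q ^ k) has_sum S) ?D" by blast
  then have "((\<lambda>k. of_nat (sigma3 k) * q ^ k) has_sum S) {0<..}"
  proof (rule has_sum_SigmaD)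
    fix k :: nat assume "k \<in> {0<..}"
    then have "finite {d. d dvd k}" by simp
    then show "((\<lambda>d. case (k, d) of (k, d) \<Rightarrow> of_nat (d ^ 3) * q ^ k) has_sum of_nat (sigma3 k) * q ^ k) {d. d dvd k}"
      by (intro has_sum_finiteI) (auto simp: sigma3_def sum_distrib_right)
  qed
  then have "((\<lambda>k. of_nat (sigma3 k) * q ^ k) has_sum S) UNIV"
  proof (rule has_sum_cong_neutral[THEN iffD1, rotated 3])
    \<comment> \<open>Every number divides 0, so the index set is infinite and the sum takes its
      default value 0.\<close>
    have "sigma3 0 = 0" by (simp add: sigma3_def)
    then show "of_nat (sigma3 k) * q ^ k = 0" if "k \<in> UNIV - {0<..}" for k using that by simp
  qed auto
  then show "(\<lambda>k. of_nat (sigma3 k) * q ^ k) sums (infsum (\<lambda>m. power_sums 3 (q ^ Suc m)) UNIV)"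
    unfolding S_eq by (rule has_sum_imp_sums)
qed

lemma E4_q_expansion: 
  assumes "Im \<tau> > 0"
  shows "E4 \<tau> = 1 + 240 * suminf (\<lambda>k. of_nat (sigma3 k) * nome \<tau> ^ k)"
proof -
  have "summable (\<lambda>k. of_nat (sigma3 k) * nome \<tau> ^ k)"
    using divisor_sum_series(2)[OF norm_nome_less_1[OF assms]] by (rule sums_summable)
  from suminf_split_head[OF this]
  have "suminf (\<lambda>k. of_nat (sigma3 k) * nome \<tau> ^ k) = suminf (\<lambda>k. of_nat (sigma3 (Suc k)) * nome \<tau> ^ Suc k)"
    by (simp add: sigma3_def)
  moreover have "nome \<tau> ^ Suc k = exp (2 * of_real pi * \<i> * of_nat (Suc k) * \<tau>)" for k
    by (subst exp_of_nat_mult[symmetric]) (simp add: algebra_simps)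
  ultimately show ?thesis unfolding E4_def by simp
qed

text \<open>Continuity keeps the right-hand side of the Schwarzian equation bounded near each point,
  which is what the computation of the order of h' uses.\<close>

lemma isCont_E4:
  assumes "Im \<tau> > 0"
  shows "isCont E4 \<tau>"
proof -
  have "((\<lambda>q. suminf (\<lambda>k. of_nat (sigma3 k) * q ^ k)) has_field_derivative
      suminf (\<lambda>k. diffs (\<lambda>k. of_nat (sigma3 k)) k * nome \<tau> ^ k)) (at (nome \<tau>))"
    using divisor_sum_series(2) by (intro termdiffs_strong'[OF _ norm_nome_less_1[OF assms]] sums_summable)
  then have "isCont (\<lambda>q. suminf (\<lambda>k. of_nat (sigma3 k) * q ^ k) :: complex) (nome \<tau>)" by (rule DERIV_isCont)
  then have "isCont (\<lambda>\<tau>. 1 + 240 * suminf (\<lambda>k. of_nat (sigma3 k) * nome \<tau> ^ k)) \<tau>"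
    by (intro continuous_intros isCont_o2[where f = nome])
  moreover have "\<forall>\<^sub>F \<tau> in nhds \<tau>. E4 \<tau> = 1 + 240 * suminf (\<lambda>k. of_nat (sigma3 k) * nome \<tau> ^ k)"
    using eventually_nhds_in_open[OF open_halfspace_Im_gt, of \<tau> 0] assms
    by (auto elim!: eventually_mono intro: E4_q_expansion)
  ultimately show ?thesis by (subst isCont_cong)
qed

text \<open>Row 0 contributes 2 zeta(4) = \<pi>^4 / 45 and the rows m and -m agree, so the factor in
  front of the divisor series is 2 (8/3) 45 = 240, the constant in \<open>E4\<close>.\<close>

lemma infsum_lattice_term:
  assumes "Im \<tau> > 0"
  shows "infsum (lattice_term \<tau>) UNIV = of_real pi ^ 4 / 45 * E4 \<tau>"
proof -
  define q where "q = nome \<tau>"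
  let ?P = "\<lambda>m. 8 / 3 * of_real pi ^ 4 * power_sums 3 (q ^ Suc m)"
  define row where "row m = infsum (\<lambda>n. lattice_term \<tau> (m, n)) UNIV" for m
  have q: "norm q < 1" unfolding q_def using assms by (rule norm_nome_less_1)
  have row: "((\<lambda>n. lattice_term \<tau> (m, n)) has_sum row m) UNIV" for m
    unfolding row_def using summable_on_lattice_row[OF assms] by (rule has_sum_infsum)
  have "(lattice_term \<tau> has_sum infsum (lattice_term \<tau>) UNIV) (UNIV \<times> UNIV)"
    using abs_summable_summable[OF abs_summable_lattice_term[OF assms]] by (simp add: has_sum_infsum)
  then have R: "(row has_sum infsum (lattice_term \<tau>) UNIV) UNIV" by (rule has_sum_SigmaD) (rule row)
  have pos: "row (int (Suc m)) = ?P m" for m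
  proof -
    let ?z = "of_nat (Suc m) * \<tau>"
    have "Im ?z > 0" using assms by simp
    from has_sum_lattice_row_one[OF this]
    have "((\<lambda>n. lattice_term \<tau> (int (Suc m), n)) has_sum 8 / 3 * of_real pi ^ 4 * power_sums 3 (nome ?z)) UNIV"
      by (simp add: lattice_term_def)
    moreover have "nome ?z = q ^ Suc m" unfolding q_def
      by (subst exp_of_nat_mult[symmetric]) (simp add: algebra_simps)
    ultimately show ?thesis using row has_sum_unique by metis
  qed
  have neg: "row (- m) = row m" for m
    unfolding row_def
  proof (rule infsum_reindex_bij_witness[where i = uminus and j = uminus])
    fix n
    have "(of_int (- m) * \<tau> + of_int n) ^ 4 = (- (of_int m * \<tau> + of_int (- n))) ^ 4" by (simp add: algebra_simps)
    also have "\<dots> = (of_int m * \<tau> + of_int (- n)) ^ 4" by (rule power_minus_even) simp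
    finally show "lattice_term \<tau> (m, - n) = lattice_term \<tau> (- m, n)" by (simp add: lattice_term_def)
  qed auto
  let ?S = "infsum (\<lambda>m. power_sums 3 (q ^ Suc m)) UNIV"
  have "(\<lambda>m. power_sums 3 (q ^ Suc m)) sums ?S"
    using divisor_sum_series(1)[OF q] by (intro has_sum_imp_sums has_sum_infsum)
  then have P: "?P sums (8 / 3 * of_real pi ^ 4 * ?S)" by (rule sums_mult)
  have "row 0 = of_real pi ^ 4 / 45" using has_sum_lattice_row_zero row has_sum_unique by metis
  moreover have "(\<lambda>k. row (int (Suc k))) sums (8 / 3 * of_real pi ^ 4 * ?S)" using P unfolding pos .
  ultimately have "(\<lambda>k. row (int k)) sums (8 / 3 * of_real pi ^ 4 * ?S + of_real pi ^ 4 / 45)"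
    using sums_Suc[of "\<lambda>k. row (int k)"] by (metis of_nat_0)
  moreover have "row (- 1 - int k) = ?P k" for k
    using neg[of "int (Suc k)"] pos[of k] by (simp add: algebra_simps)
  then have "(\<lambda>k. row (- 1 - int k)) sums (8 / 3 * of_real pi ^ 4 * ?S)" using P by (simp only:)
  ultimately have "(row has_sum (8 / 3 * of_real pi ^ 4 * ?S + of_real pi ^ 4 / 45 + 8 / 3 * of_real pi ^ 4 * ?S)) UNIV"
    using R by (intro has_sum_int_split) (auto simp: summable_on_def)
  with R have "infsum (lattice_term \<tau>) UNIV = 8 / 3 * of_real pi ^ 4 * ?S + of_real pi ^ 4 / 45 + 8 / 3 * of_real pi ^ 4 * ?S"
    by (rule has_sum_unique)
  also have "\<dots> = of_real pi ^ 4 / 45 * (1 + 240 * ?S)" by (simp add: field_simps)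
  also have "1 + 240 * ?S = E4 \<tau>"
    unfolding E4_q_expansion[OF assms] using sums_unique[OF divisor_sum_series(2)[OF q]] by (simp add: q_def)
  finally show ?thesis .
qed

text \<open>Replacing \<tau> by \<tau>' divides each lattice vector by c \<tau> + d and permutes the
  index pairs by an integer matrix of determinant 1. Absolute convergence allows the
  rearrangement.\<close>

lemma E4_modular:
  fixes a b c d :: int
  assumes \<tau>: "Im \<tau> > 0" and det: "a * d - b * c = 1"
    and \<tau>': "\<tau>' = (of_int a * \<tau> + of_int b) / (of_int c * \<tau> + of_int d)" "Im \<tau>' > 0"
    and J: "of_int c * \<tau> + of_int d \<noteq> 0"
  shows "E4 \<tau>' = (of_int c * \<tau> + of_int d) ^ 4 * E4 \<tau>"
proof -
  let ?J = "of_int c * \<tau> + of_int d"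
  have "lattice_term \<tau>' (m, n) = ?J ^ 4 * lattice_term \<tau> (m * a + n * c, m * b + n * d)" for m n
  proof -
    have "of_int m * \<tau>' + of_int n = (of_int (m * a + n * c) * \<tau> + of_int (m * b + n * d)) / ?J"
      using J unfolding \<tau>' by (simp add: add_divide_eq_iff algebra_simps)
    then show ?thesis by (simp add: lattice_term_def power_divide field_simps)
  qed
  then have "infsum (lattice_term \<tau>') UNIV =
      infsum (\<lambda>p. ?J ^ 4 * lattice_term \<tau> ((\<lambda>(m, n). (m * a + n * c, m * b + n * d)) p)) UNIV"
    by (intro infsum_cong) auto
  also have "\<dots> = ?J ^ 4 * infsum (\<lambda>p. lattice_term \<tau> ((\<lambda>(m, n). (m * a + n * c, m * b + n * d)) p)) UNIV"
    by (rule infsum_cmult_right')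
  also have "infsum (\<lambda>p. lattice_term \<tau> ((\<lambda>(m, n). (m * a + n * c, m * b + n * d)) p)) UNIV = infsum (lattice_term \<tau>) UNIV"
  proof (rule infsum_reindex_bij_betw)
    have "bij (\<lambda>(m, n). (m * a + n * c, m * b + n * d))"
    proof (rule o_bij[where g = "\<lambda>(x, y). (x * d - y * c, y * a - x * b)"])
      have "(m * a + n * c) * d - (m * b + n * d) * c = m * (a * d - b * c)"
           "(m * b + n * d) * a - (m * a + n * c) * b = n * (a * d - b * c)"
           "(m * d - n * c) * a + (n * a - m * b) * c = m * (a * d - b * c)"
           "(m * d - n * c) * b + (n * a - m * b) * d = n * (a * d - b * c)" for m n :: int
        by (simp_all add: algebra_simps)
      then show "(\<lambda>(x, y). (x * d - y * c, y * a - x * b)) \<circ> (\<lambda>(m, n). (m * a + n * c, m * b + n * d)) = id"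
        "(\<lambda>(m, n). (m * a + n * c, m * b + n * d)) \<circ> (\<lambda>(x, y). (x * d - y * c, y * a - x * b)) = id"
        using det by (auto simp: fun_eq_iff)
    qed
    then show "bij_betw (\<lambda>(m, n). (m * a + n * c, m * b + n * d)) UNIV UNIV" .
  qed
  finally show ?thesis
    unfolding infsum_lattice_term[OF \<tau>] infsum_lattice_term[OF \<tau>'(2)] by simp
qed

section \<open>The modular group on the extended upper half-plane\<close>

definition mat2 :: "int \<Rightarrow> int \<Rightarrow> int \<Rightarrow> int \<Rightarrow> int^2^2" where
  "mat2 a b c d = vector [vector [a, b], vector [c, d]]"

lemma mat2_nth [simp]:
  "mat2 a b c d $ 1 $ 1 = a" "mat2 a b c d $ 1 $ 2 = b"
  "mat2 a b c d $ 2 $ 1 = c" "mat2 a b c d $ 2 $ 2 = d"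
  by (simp_all add: mat2_def)

lemma mat2_cases: obtains a b c d where "\<gamma> = mat2 a b c d"
  using that[of "\<gamma> $ 1 $ 1" "\<gamma> $ 1 $ 2" "\<gamma> $ 2 $ 1" "\<gamma> $ 2 $ 2"]
  by (simp add: vec_eq_iff forall_2)

lemma mat2_mult: "mat2 a b c d ** mat2 a' b' c' d' =
    mat2 (a * a' + b * c') (a * b' + b * d') (c * a' + d * c') (c * b' + d * d')"
  by (simp add: vec_eq_iff forall_2 matrix_matrix_mult_def sum_2)

lemma mat_1_eq: "mat 1 = mat2 1 0 0 1"
  by (simp add: vec_eq_iff forall_2 mat_def)

lemma mat2_in_SL2Z: "mat2 a b c d \<in> carrier SL2Z \<longleftrightarrow> a * d - b * c = 1"
  by (simp add: SL2Z_def det_2)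

lemma mult_in_SL2Z: "\<gamma> \<in> carrier SL2Z \<Longrightarrow> \<delta> \<in> carrier SL2Z \<Longrightarrow> \<gamma> ** \<delta> \<in> carrier SL2Z"
  by (simp add: SL2Z_def det_mul)

lemma one_in_SL2Z: "mat 1 \<in> carrier SL2Z"
  by (simp add: SL2Z_def)

lemma moebius_ext_eq_mob: "moebius_ext (mat2 a b c d) = mob (of_int a) (of_int b) (of_int c) (of_int d)"
proof
  show "moebius_ext (mat2 a b c d) x = mob (of_int a) (of_int b) (of_int c) (of_int d) x" for x
    by (cases x) (simp_all add: mob_def proj_def moebius_def)
qed

lemma moebius_ext_mult:
  assumes "\<delta> \<in> carrier SL2Z"
  shows "moebius_ext (\<gamma> ** \<delta>) x = moebius_ext \<gamma> (moebius_ext \<delta> x)"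
proof -
  obtain a b c d where \<gamma>: "\<gamma> = mat2 a b c d" by (rule mat2_cases)
  obtain a' b' c' d' where \<delta>: "\<delta> = mat2 a' b' c' d'" by (rule mat2_cases)
  have "a' * d' - b' * c' = 1" using assms by (simp add: \<delta> mat2_in_SL2Z)
  then have "of_int (a' * d' - b' * c') = (1 :: complex)" by simp
  then have "complex_of_int a' * of_int d' - of_int b' * of_int c' \<noteq> 0" by simp
  then show ?thesis unfolding \<gamma> \<delta> mat2_mult moebius_ext_eq_mob by (simp add: mob_mob)
qed

lemma moebius_ext_one: "moebius_ext (mat 1) x = x"
  by (cases x) (auto simp: mat_1_eq moebius_def)

definition adj :: "int^2^2 \<Rightarrow> int^2^2" where
  "adj \<gamma> = mat2 (\<gamma> $ 2 $ 2) (- \<gamma> $ 1 $ 2) (- \<gamma> $ 2 $ 1) (\<gamma> $ 1 $ 1)"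

lemma adj_SL2Z:
  assumes "\<gamma> \<in> carrier SL2Z"
  shows "adj \<gamma> \<in> carrier SL2Z" "adj \<gamma> ** \<gamma> = mat 1" "\<gamma> ** adj \<gamma> = mat 1"
proof -
  obtain a b c d where \<gamma>: "\<gamma> = mat2 a b c d" by (rule mat2_cases)
  have "a * d - b * c = 1" using assms by (simp add: \<gamma> mat2_in_SL2Z)
  then show "adj \<gamma> \<in> carrier SL2Z" "adj \<gamma> ** \<gamma> = mat 1" "\<gamma> ** adj \<gamma> = mat 1"
    by (simp_all add: \<gamma> adj_def mat2_in_SL2Z mat2_mult mat_1_eq algebra_simps)
qed

lemma moebius_ext_adj:
  assumes "\<gamma> \<in> carrier SL2Z"
  shows "moebius_ext (adj \<gamma>) (moebius_ext \<gamma> x) = x" "moebius_ext \<gamma> (moebius_ext (adj \<gamma>) x) = x"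
  using adj_SL2Z[OF assms] assms by (simp_all add: moebius_ext_one flip: moebius_ext_mult)

definition automorphy :: "int^2^2 \<Rightarrow> complex \<Rightarrow> complex" where
  "automorphy \<gamma> z = of_int (\<gamma> $ 2 $ 1) * z + of_int (\<gamma> $ 2 $ 2)"

lemma automorphy_nonzero:
  assumes "\<gamma> \<in> carrier SL2Z" "Im z > 0"
  shows "automorphy \<gamma> z \<noteq> 0"
proof
  obtain a b c d where \<gamma>: "\<gamma> = mat2 a b c d" by (rule mat2_cases)
  have det: "a * d - b * c = 1" using assms by (simp add: \<gamma> mat2_in_SL2Z)
  assume 0: "automorphy \<gamma> z = 0"
  then have "Im (automorphy \<gamma> z) = 0" by simp
  then have "c = 0" using assms(2) by (simp add: automorphy_def \<gamma>)
  with 0 have "d = 0" by (simp add: automorphy_def \<gamma>)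
  with \<open>c = 0\<close> det show False by simp
qed

lemma Im_moebius:
  assumes "\<gamma> \<in> carrier SL2Z" "Im z > 0"
  shows "Im (moebius \<gamma> z) = Im z / (cmod (automorphy \<gamma> z))\<^sup>2"
proof -
  obtain a b c d where \<gamma>: "\<gamma> = mat2 a b c d" by (rule mat2_cases)
  have det: "a * d - b * c = 1" using assms by (simp add: \<gamma> mat2_in_SL2Z)
  then have det': "of_int a * of_int d - of_int b * of_int c = (1 :: real)"
    by (metis of_int_1 of_int_diff of_int_mult)
  let ?N = "of_int a * z + of_int b" and ?J = "automorphy \<gamma> z"
  have "moebius \<gamma> z = ?N / ?J" by (simp add: moebius_def automorphy_def \<gamma>)
  also have "\<dots> = ?N * cnj ?J / of_real ((cmod ?J)\<^sup>2)" by (rule complex_div_cnj)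
  finally have "Im (moebius \<gamma> z) = Im (?N * cnj ?J) / (cmod ?J)\<^sup>2" by (simp only: Im_divide_of_real)
  moreover have "Im (?N * cnj ?J) = (of_int a * of_int d - of_int b * of_int c) * Im z"
    by (simp add: automorphy_def \<gamma> algebra_simps)
  ultimately show ?thesis using det' by simp
qed

lemma Im_moebius_pos:
  assumes "\<gamma> \<in> carrier SL2Z" "Im z > 0"
  shows "Im (moebius \<gamma> z) > 0"
  using Im_moebius[OF assms] automorphy_nonzero[OF assms] assms by simp

lemma moebius_ext_Some:
  assumes "\<gamma> \<in> carrier SL2Z" "Im z > 0"
  shows "moebius_ext \<gamma> (Some z) = Some (moebius \<gamma> z)"
  using automorphy_nonzero[OF assms] by (simp add: automorphy_def)

declare moebius_ext.simps [simp del]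

lemma moebius_mult:
  assumes "\<gamma> \<in> carrier SL2Z" "\<delta> \<in> carrier SL2Z" "Im z > 0"
  shows "moebius (\<gamma> ** \<delta>) z = moebius \<gamma> (moebius \<delta> z)"
  using moebius_ext_mult[OF assms(2), of \<gamma> "Some z"] assms
  by (simp only: moebius_ext_Some mult_in_SL2Z Im_moebius_pos option.inject)

lemma moebius_adj:
  assumes "\<gamma> \<in> carrier SL2Z" "Im z > 0"
  shows "moebius (adj \<gamma>) (moebius \<gamma> z) = z" "moebius \<gamma> (moebius (adj \<gamma>) z) = z"
  using moebius_ext_adj[OF assms(1), of "Some z"] assms adj_SL2Z[OF assms(1)]
  by (simp_all only: moebius_ext_Some mult_in_SL2Z Im_moebius_pos option.inject)

lemma moebius_has_field_derivative:
  assumes "\<gamma> \<in> carrier SL2Z" "Im z > 0"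
  shows "(moebius \<gamma> has_field_derivative 1 / (automorphy \<gamma> z)\<^sup>2) (at z)"
proof -
  obtain a b c d where \<gamma>: "\<gamma> = mat2 a b c d" by (rule mat2_cases)
  have det: "a * d - b * c = 1" using assms by (simp add: \<gamma> mat2_in_SL2Z)
  then have det': "of_int a * of_int d - of_int b * of_int c = (1 :: complex)"
    by (metis of_int_1 of_int_diff of_int_mult)
  have J: "of_int c * z + of_int d \<noteq> 0" using automorphy_nonzero[OF assms] by (simp add: automorphy_def \<gamma>)
  have "((\<lambda>z. (of_int a * z + of_int b) / (of_int c * z + of_int d)) has_field_derivative
     (of_int a * (of_int c * z + of_int d) - (of_int a * z + of_int b) * of_int c) /
       ((of_int c * z + of_int d) * (of_int c * z + of_int d))) (at z)"
    by (auto intro!: derivative_eq_intros J)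
  moreover have "of_int a * (of_int c * z + of_int d) - (of_int a * z + of_int b) * of_int c = (1 :: complex)"
    using det' by (simp add: algebra_simps)
  moreover have "moebius \<gamma> = (\<lambda>z. (of_int a * z + of_int b) / (of_int c * z + of_int d))"
    by (simp add: fun_eq_iff moebius_def \<gamma>)
  ultimately show ?thesis by (simp add: automorphy_def \<gamma> power2_eq_square)
qed

lemma continuous_on_moebius: "\<gamma> \<in> carrier SL2Z \<Longrightarrow> continuous_on upper_half_plane (moebius \<gamma>)"
  by (intro continuous_at_imp_continuous_on ballI DERIV_isCont[OF moebius_has_field_derivative]) auto

lemma open_moebius_vimage:
  assumes "\<gamma> \<in> carrier SL2Z" "open U"
  shows "open {z \<in> upper_half_plane. moebius \<gamma> z \<in> U}"
  using continuous_open_preimage[OF continuous_on_moebius[OF assms(1)] _ assms(2)]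
  by (simp add: open_halfspace_Im_gt vimage_def Int_def)

text \<open>Transitivity on the cusps: a reduced fraction is a first column, which Bezout
  coefficients complete to determinant 1.\<close>

lemma cusp_eq_moebius_ext_None:
  assumes "x \<in> \<rat>"
  obtains \<gamma> :: "int^2^2" where "\<gamma> \<in> carrier SL2Z" "moebius_ext \<gamma> None = Some x" "\<gamma> $ 2 $ 1 \<noteq> 0"
    "x = of_int (\<gamma> $ 1 $ 1) / of_int (\<gamma> $ 2 $ 1)"
proof -
  obtain a c where ac: "c > 0" "coprime a c" "x = of_int a / of_int c"
    using assms by (rule Rats_cases') 
  obtain u v where "u * a + v * c = 1" using bezout_int[of a c] ac(2) by (auto simp: coprime_iff_gcd_eq_1)
  then have "mat2 a (- v) c u \<in> carrier SL2Z" by (simp add: mat2_in_SL2Z algebra_simps)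
  then show ?thesis using that[of "mat2 a (- v) c u"] ac by (simp add: moebius_ext.simps)
qed

lemma moebius_ext_None_in_points: "moebius_ext \<gamma> None \<in> extended_half_plane_points"
  by (auto simp: extended_half_plane_points_def moebius_ext.simps)

lemma extended_half_plane_points_cases:
  assumes "x \<in> extended_half_plane_points"
  obtains z where "Im z > 0" "x = Some z"
  | \<gamma> where "\<gamma> \<in> carrier SL2Z" "x = moebius_ext \<gamma> None"
proof (cases x)
  case None
  then show ?thesis using that(2)[OF one_in_SL2Z] by (simp add: moebius_ext_one)
next
  case (Some z)
  then have "Im z > 0 \<or> z \<in> \<rat>" using assms by (auto simp: extended_half_plane_points_def)
  then show ?thesis using that Some by (metis cusp_eq_moebius_ext_None)
qed

lemma moebius_ext_in_points:
  assumes "\<gamma> \<in> carrier SL2Z" "x \<in> extended_half_plane_points"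
  shows "moebius_ext \<gamma> x \<in> extended_half_plane_points"
  using assms(2)
proof (cases rule: extended_half_plane_points_cases)
  case (1 z)
  then show ?thesis using moebius_ext_Some[OF assms(1)] Im_moebius_pos[OF assms(1)]
    by (auto simp: extended_half_plane_points_def)
next
  case (2 \<delta>)
  then show ?thesis using moebius_ext_None_in_points by (simp flip: moebius_ext_mult)
qed

text \<open>A half-plane at infinity is carried to a horoball. The ball is described by |w - x|^2 <
  2 r Im w; for w = \<gamma> z both sides contain the factor 1 / |c z + d|^2, which cancels.\<close>

lemma moebius_in_horoball_iff:
  fixes \<gamma> :: "int^2^2"
  assumes \<gamma>: "\<gamma> \<in> carrier SL2Z" "\<gamma> $ 2 $ 1 \<noteq> 0" and z: "Im z > 0" and r: "r > 0"
    and x: "x = of_int (\<gamma> $ 1 $ 1) / of_int (\<gamma> $ 2 $ 1)"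
  shows "moebius \<gamma> z \<in> ball (x + of_real r * \<i>) r \<longleftrightarrow> Im z > 1 / (2 * r * (of_int (\<gamma> $ 2 $ 1))\<^sup>2)"
proof -
  obtain a b c d where \<gamma>': "\<gamma> = mat2 a b c d" by (rule mat2_cases)
  have c: "c \<noteq> 0" using \<gamma>(2) by (simp add: \<gamma>')
  have det: "a * d - b * c = 1" using \<gamma>(1) by (simp add: \<gamma>' mat2_in_SL2Z)
  then have det': "of_int a * of_int d - of_int b * of_int c = (1 :: complex)"
    by (metis of_int_1 of_int_diff of_int_mult)
  let ?w = "moebius \<gamma> z" and ?J = "automorphy \<gamma> z"
  have J: "?J \<noteq> 0" by (rule automorphy_nonzero[OF \<gamma>(1) z])
  have "?w - x = - 1 / (of_int c * ?J)"
  proof -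
    have "?w - x = ((of_int a * z + of_int b) * of_int c - of_int a * ?J) / (of_int c * ?J)"
      using c J by (simp add: moebius_def automorphy_def \<gamma>' x divide_simps)
    also have "(of_int a * z + of_int b) * of_int c - of_int a * ?J = - 1"
      using det' by (simp add: automorphy_def \<gamma>' algebra_simps)
    finally show ?thesis by simp
  qed
  then have n: "(cmod (?w - x))\<^sup>2 = 1 / ((of_int c)\<^sup>2 * (cmod ?J)\<^sup>2)"
    by (simp add: norm_divide norm_mult power_divide power_mult_distrib)
  have xr: "Im x = 0" by (simp add: x Im_divide)
  have "dist (x + of_real r * \<i>) ?w = cmod (?w - x - of_real r * \<i>)"
    by (simp add: dist_norm norm_minus_commute diff_diff_eq)
  then have "?w \<in> ball (x + of_real r * \<i>) r \<longleftrightarrow> (cmod (?w - x - of_real r * \<i>))\<^sup>2 < r\<^sup>2"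
    using r by (metis abs_norm_cancel abs_of_pos abs_le_square_iff mem_ball not_le)
  also have "(cmod (?w - x - of_real r * \<i>))\<^sup>2 = (cmod (?w - x))\<^sup>2 - 2 * r * Im ?w + r\<^sup>2"
    unfolding cmod_power2 using xr by (simp add: power2_eq_square algebra_simps)
  also have "\<dots> < r\<^sup>2 \<longleftrightarrow> 1 / ((of_int c)\<^sup>2 * (cmod ?J)\<^sup>2) < 2 * r * (Im z / (cmod ?J)\<^sup>2)"
    unfolding n Im_moebius[OF \<gamma>(1) z] by auto
  also have "\<dots> \<longleftrightarrow> Im z > 1 / (2 * r * (of_int c)\<^sup>2)"
    using c J r by (simp add: field_simps)
  finally show ?thesis by (simp add: \<gamma>')
qed

text \<open>A description of the topology that treats all cusps alike, each through a matrix that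
  carries infinity to it. The action of \<open>SL2Z\<close> becomes visibly continuous, and
  arguments at a cusp reduce to half-planes.\<close>

lemma openin_extended_half_plane_iff:
  "openin extended_half_plane U \<longleftrightarrow> U \<subseteq> extended_half_plane_points \<and>
     open {z \<in> upper_half_plane. Some z \<in> U} \<and>
     (\<forall>\<gamma>\<in>carrier SL2Z. moebius_ext \<gamma> None \<in> U \<longrightarrow>
        (\<exists>M>0. \<forall>z. Im z > M \<longrightarrow> moebius_ext \<gamma> (Some z) \<in> U))"
proof -
  have "(None \<in> U \<longrightarrow> (\<exists>M>0. \<forall>z. Im z > M \<longrightarrow> Some z \<in> U)) \<and>
        (\<forall>x\<in>\<rat>. Some x \<in> U \<longrightarrow> (\<exists>r>0. \<forall>z\<in>ball (x + of_real r * \<i>) r. Some z \<in> U)) \<longleftrightarrow>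
     (\<forall>\<gamma>\<in>carrier SL2Z. moebius_ext \<gamma> None \<in> U \<longrightarrow>
        (\<exists>M>0. \<forall>z. Im z > M \<longrightarrow> moebius_ext \<gamma> (Some z) \<in> U))" (is "?L \<longleftrightarrow> ?R")
  proof
    assume L: ?L
    show ?R
    proof (intro ballI impI)
      fix \<gamma> assume \<gamma>: "\<gamma> \<in> carrier SL2Z" "moebius_ext \<gamma> None \<in> U"
      show "\<exists>M>0. \<forall>z. Im z > M \<longrightarrow> moebius_ext \<gamma> (Some z) \<in> U"
      proof (cases "\<gamma> $ 2 $ 1 = 0")
        case True
        obtain a b c d where \<gamma>': "\<gamma> = mat2 a b c d" by (rule mat2_cases)
        have c: "c = 0" using True by (simp add: \<gamma>')
        then have ad: "a * d = 1" using \<gamma>(1) by (simp add: \<gamma>' mat2_in_SL2Z)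
        then have ad': "d = 1 \<and> a = 1 \<or> d = - 1 \<and> a = - 1" using zmult_eq_1_iff by auto
        from True \<gamma> L obtain M where M: "M > 0" "\<And>z. Im z > M \<Longrightarrow> Some z \<in> U"
          by (auto simp: moebius_ext.simps)
        have "moebius_ext \<gamma> (Some z) \<in> U" if "Im z > M" for z
        proof -
          have "Im (moebius \<gamma> z) = Im z" using ad' by (auto simp: moebius_def \<gamma>' c)
          then show ?thesis using M that moebius_ext_Some[OF \<gamma>(1), of z] by simp
        qed
        with M(1) show ?thesis by blast
      next
        case False
        define x :: complex where "x = of_int (\<gamma> $ 1 $ 1) / of_int (\<gamma> $ 2 $ 1)"
        have "x \<in> \<rat>" "Some x \<in> U" using \<gamma>(2) False by (auto simp: x_def moebius_ext.simps)
        with L obtain r where r: "r > 0" "\<forall>z\<in>ball (x + of_real r * \<i>) r. Some z \<in> U" by blast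
        define M where "M = 1 / (2 * r * (of_int (\<gamma> $ 2 $ 1))\<^sup>2)"
        have M: "M > 0" using r False by (simp add: M_def)
        have "moebius_ext \<gamma> (Some z) \<in> U" if "Im z > M" for z
        proof -
          have "Im z > 0" using that M by linarith
          with r that moebius_in_horoball_iff[OF \<gamma>(1) False this r(1) x_def] show ?thesis
            by (simp add: moebius_ext_Some[OF \<gamma>(1)] M_def)
        qed
        with M show ?thesis by blast
      qed
    qed
  next
    assume R: ?R
    show ?L
    proof (intro conjI impI ballI)
      assume "None \<in> U"
      then show "\<exists>M>0. \<forall>z. Im z > M \<longrightarrow> Some z \<in> U"
        using bspec[OF R one_in_SL2Z] by (simp add: moebius_ext_one)
    next
      fix x :: complex assume x: "x \<in> \<rat>" "Some x \<in> U"
      obtain \<gamma> :: "int^2^2" where \<gamma>: "\<gamma> \<in> carrier SL2Z" "moebius_ext \<gamma> None = Some x" "\<gamma> $ 2 $ 1 \<noteq> 0"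
        "x = of_int (\<gamma> $ 1 $ 1) / of_int (\<gamma> $ 2 $ 1)"
        by (rule cusp_eq_moebius_ext_None[OF x(1)])
      then obtain M where M: "M > 0" "\<And>z. Im z > M \<Longrightarrow> moebius_ext \<gamma> (Some z) \<in> U"
        using bspec[OF R \<gamma>(1)] x by auto
      \<comment> \<open>The relation M = 1 / (2 r c^2) of \<open>moebius_in_horoball_iff\<close>,
        solved for \<open>r\<close>.\<close>
      define r where "r = 1 / (2 * M * (of_int (\<gamma> $ 2 $ 1))\<^sup>2)"
      have r: "r > 0" using M \<gamma>(3) by (simp add: r_def)
      have rM: "1 / (2 * r * (of_int (\<gamma> $ 2 $ 1))\<^sup>2) = M" using M \<gamma>(3) by (simp add: r_def field_simps)
      have "Some w \<in> U" if w: "w \<in> ball (x + of_real r * \<i>) r" for w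
      proof -
        have "Im x = 0" using \<gamma>(4) by (simp add: Im_divide)
        moreover have "\<bar>Im (x + of_real r * \<i> - w)\<bar> < r"
          using w abs_Im_le_cmod[of "x + of_real r * \<i> - w"] by (simp add: dist_norm)
        ultimately have "Im w > 0" by simp
        define z where "z = moebius (adj \<gamma>) w"
        have z: "Im z > 0" "moebius \<gamma> z = w"
          using Im_moebius_pos[OF adj_SL2Z(1)[OF \<gamma>(1)] \<open>Im w > 0\<close>] moebius_adj[OF \<gamma>(1) \<open>Im w > 0\<close>]
          by (auto simp: z_def)
        then have "Im z > M"
          using w moebius_in_horoball_iff[OF \<gamma>(1,3) z(1) r \<gamma>(4)] rM by simp
        then show ?thesis using M(2) z moebius_ext_Some[OF \<gamma>(1) z(1)] by metis
      qed
      with r show "\<exists>r>0. \<forall>z\<in>ball (x + of_real r * \<i>) r. Some z \<in> U" by blast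
    qed
  qed
  then show ?thesis
    unfolding openin_extended_half_plane extended_half_plane_open_def by (intro conj_cong refl)
qed

lemma continuous_map_moebius_ext:
  assumes "\<gamma> \<in> carrier SL2Z"
  shows "continuous_map extended_half_plane extended_half_plane (moebius_ext \<gamma>)"
  unfolding continuous_map_def topspace_extended_half_plane
proof (intro conjI allI impI)
  show "moebius_ext \<gamma> \<in> extended_half_plane_points \<rightarrow> extended_half_plane_points"
    using moebius_ext_in_points[OF assms] by blast
  fix U assume "openin extended_half_plane U"
  then have U: "U \<subseteq> extended_half_plane_points" "open {z \<in> upper_half_plane. Some z \<in> U}"
    "\<And>\<gamma>. \<gamma> \<in> carrier SL2Z \<Longrightarrow> moebius_ext \<gamma> None \<in> U \<Longrightarrow>
      \<exists>M>0. \<forall>z. Im z > M \<longrightarrow> moebius_ext \<gamma> (Some z) \<in> U"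
    unfolding openin_extended_half_plane_iff by blast+
  show "openin extended_half_plane {x \<in> extended_half_plane_points. moebius_ext \<gamma> x \<in> U}"
    unfolding openin_extended_half_plane_iff
  proof (intro conjI ballI impI)
    have "{z \<in> upper_half_plane. Some z \<in> {x \<in> extended_half_plane_points. moebius_ext \<gamma> x \<in> U}} =
      {z \<in> upper_half_plane. moebius \<gamma> z \<in> {z \<in> upper_half_plane. Some z \<in> U}}"
      using moebius_ext_Some[OF assms] Im_moebius_pos[OF assms]
      by (auto simp: extended_half_plane_points_def)
    then show "open {z \<in> upper_half_plane. Some z \<in> {x \<in> extended_half_plane_points. moebius_ext \<gamma> x \<in> U}}"
      using open_moebius_vimage[OF assms U(2)] by simp
    fix \<delta> assume \<delta>: "\<delta> \<in> carrier SL2Z"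
      "moebius_ext \<delta> None \<in> {x \<in> extended_half_plane_points. moebius_ext \<gamma> x \<in> U}"
    then have "moebius_ext (\<gamma> ** \<delta>) None \<in> U" by (simp add: moebius_ext_mult)
    from U(3)[OF mult_in_SL2Z[OF assms \<delta>(1)] this]
    obtain M where M: "M > 0" "\<And>z. Im z > M \<Longrightarrow> moebius_ext (\<gamma> ** \<delta>) (Some z) \<in> U" by blast
    have "moebius_ext \<delta> (Some z) \<in> {x \<in> extended_half_plane_points. moebius_ext \<gamma> x \<in> U}" if "Im z > M" for z
    proof -
      have "Im z > 0" using that M by linarith
      then have "Some z \<in> extended_half_plane_points" by (simp add: extended_half_plane_points_def)
      from moebius_ext_in_points[OF \<delta>(1) this] show ?thesis using M(2)[OF that] \<delta>(1) by (simp add: moebius_ext_mult)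
    qed
    with M(1) show "\<exists>M>0. \<forall>z. Im z > M \<longrightarrow> moebius_ext \<delta> (Some z) \<in> {x \<in> extended_half_plane_points. moebius_ext \<gamma> x \<in> U}"
      by blast
  qed blast
qed

lemma moebius_ext_image_eq_vimage:
  assumes "\<gamma> \<in> carrier SL2Z" "U \<subseteq> extended_half_plane_points"
  shows "moebius_ext \<gamma> ` U = {x \<in> extended_half_plane_points. moebius_ext (adj \<gamma>) x \<in> U}"
proof (intro equalityI subsetI)
  fix x assume "x \<in> moebius_ext \<gamma> ` U"
  then show "x \<in> {x \<in> extended_half_plane_points. moebius_ext (adj \<gamma>) x \<in> U}"
    using assms moebius_ext_in_points moebius_ext_adj by auto
next
  fix x assume "x \<in> {x \<in> extended_half_plane_points. moebius_ext (adj \<gamma>) x \<in> U}"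
  then show "x \<in> moebius_ext \<gamma> ` U" using moebius_ext_adj(2)[OF assms(1), of x] by (metis (lifting) image_eqI mem_Collect_eq)
qed

lemma openin_moebius_ext_image:
  assumes "\<gamma> \<in> carrier SL2Z" "openin extended_half_plane U"
  shows "openin extended_half_plane (moebius_ext \<gamma> ` U)"
proof -
  have "U \<subseteq> extended_half_plane_points" using openin_subset[OF assms(2)] by (simp add: topspace_extended_half_plane)
  from moebius_ext_image_eq_vimage[OF assms(1) this]
  show ?thesis
    using openin_continuous_map_preimage[OF continuous_map_moebius_ext[OF adj_SL2Z(1)[OF assms(1)]] assms(2)]
    by (simp add: topspace_extended_half_plane)
qed

lemma Some_notin_moebius_ext_None: "Im z > 0 \<Longrightarrow> moebius_ext \<gamma> None \<noteq> Some z"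
  by (auto simp: moebius_ext.simps Im_divide split: if_splits)

lemma continuous_map_Some: "continuous_map (top_of_set upper_half_plane) extended_half_plane Some"
  unfolding continuous_map_def
proof (intro conjI allI impI)
  show "Some \<in> topspace (top_of_set upper_half_plane) \<rightarrow> topspace extended_half_plane"
    by (auto simp: topspace_extended_half_plane extended_half_plane_points_def)
  fix U assume "openin extended_half_plane U"
  then have "open {z \<in> upper_half_plane. Some z \<in> U}" unfolding openin_extended_half_plane_iff by blast
  then show "openin (top_of_set upper_half_plane) {x \<in> topspace (top_of_set upper_half_plane). Some x \<in> U}"
    by (intro open_subset) auto
qed

lemma openin_Some_image:
  assumes "open U" "U \<subseteq> upper_half_plane"
  shows "openin extended_half_plane (Some ` U)"
  unfolding openin_extended_half_plane_iff
proof (intro conjI ballI impI)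
  have "{z \<in> upper_half_plane. Some z \<in> Some ` U} = U" using assms by auto
  with assms show "open {z \<in> upper_half_plane. Some z \<in> Some ` U}" by simp
  fix \<gamma> assume "moebius_ext \<gamma> None \<in> Some ` U"
  then show "\<exists>M>0. \<forall>z. Im z > M \<longrightarrow> moebius_ext \<gamma> (Some z) \<in> Some ` U"
    using assms(2) Some_notin_moebius_ext_None by blast
qed (use assms in \<open>auto simp: extended_half_plane_points_def\<close>)

lemma stabilizer_infinity:
  assumes "\<gamma> \<in> carrier SL2Z" "moebius_ext \<gamma> None = None"
  obtains k :: int where "\<And>z. moebius \<gamma> z = z + of_int k" "\<gamma> = mat2 1 k 0 1 \<or> \<gamma> = mat2 (- 1) (- k) 0 (- 1)"
proof -
  obtain a b c d where \<gamma>: "\<gamma> = mat2 a b c d" by (rule mat2_cases)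
  have c: "c = 0" using assms(2) by (simp add: \<gamma> moebius_ext.simps split: if_splits)
  then have "a * d = 1" using assms(1) by (simp add: \<gamma> mat2_in_SL2Z)
  then consider "a = 1" "d = 1" | "a = - 1" "d = - 1" using zmult_eq_1_iff by auto
  then show ?thesis
  proof cases
    case 1
    then show ?thesis using c by (intro that[of b]) (simp_all add: \<gamma> moebius_def)
  next
    case 2
    then show ?thesis using c by (intro that[of "- b"]) (simp_all add: \<gamma> moebius_def)
  qed
qed

definition cusp_nbhd :: "real \<Rightarrow> complex option set" where
  "cusp_nbhd M = insert None (Some ` {z. Im z > M})"

lemma openin_cusp_nbhd:
  assumes "M \<ge> 0"
  shows "openin extended_half_plane (cusp_nbhd M)"
  unfolding openin_extended_half_plane_iff
proof (intro conjI ballI impI)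
  have "{z \<in> upper_half_plane. Some z \<in> cusp_nbhd M} = {z. Im z > M}" using assms by (auto simp: cusp_nbhd_def)
  then show "open {z \<in> upper_half_plane. Some z \<in> cusp_nbhd M}" by (simp add: open_halfspace_Im_gt)
  fix \<gamma> assume \<gamma>: "\<gamma> \<in> carrier SL2Z" "moebius_ext \<gamma> None \<in> cusp_nbhd M"
  then have "moebius_ext \<gamma> None = None"
    using Some_notin_moebius_ext_None[of _ \<gamma>] assms by (force simp: cusp_nbhd_def)
  then obtain k :: int where k: "\<And>z. moebius \<gamma> z = z + of_int k" using stabilizer_infinity[OF \<gamma>(1)] by metis
  have "moebius_ext \<gamma> (Some z) \<in> cusp_nbhd M" if "Im z > M + 1" for z
    using that assms moebius_ext_Some[OF \<gamma>(1), of z] k by (simp add: cusp_nbhd_def)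
  then show "\<exists>M'>0. \<forall>z. Im z > M' \<longrightarrow> moebius_ext \<gamma> (Some z) \<in> cusp_nbhd M"
    using assms by (intro exI[of _ "M + 1"]) auto
qed (use assms in \<open>auto simp: cusp_nbhd_def extended_half_plane_points_def\<close>)

section \<open>Proper discontinuity, separation of orbits and reduction\<close>

text \<open>A nonzero integer c has |c| \<ge> 1, so |c z + d| \<ge> Im z. Thus every matrix that
  moves infinity sends high points low, which separates the cusp from everything else.\<close>

lemma Im_moebius_le_inverse:
  fixes \<gamma> :: "int^2^2"
  assumes "\<gamma> \<in> carrier SL2Z" "\<gamma> $ 2 $ 1 \<noteq> 0" "Im z > 0"
  shows "Im (moebius \<gamma> z) \<le> 1 / Im z"
proof -
  have "1 \<le> \<bar>\<gamma> $ 2 $ 1\<bar>" using assms(2) by linarith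
  then have 1: "1 \<le> \<bar>real_of_int (\<gamma> $ 2 $ 1)\<bar>" by (metis of_int_1_le_iff of_int_abs)
  have "Im z \<le> \<bar>real_of_int (\<gamma> $ 2 $ 1)\<bar> * Im z" using mult_right_mono[OF 1, of "Im z"] assms(3) by simp
  also have "\<dots> = \<bar>Im (automorphy \<gamma> z)\<bar>" using assms(3) by (simp add: automorphy_def abs_mult)
  also have "\<dots> \<le> cmod (automorphy \<gamma> z)" by (rule abs_Im_le_cmod)
  finally have "(Im z)\<^sup>2 \<le> (cmod (automorphy \<gamma> z))\<^sup>2" using assms(3) by (intro power_mono) auto
  moreover have "cmod (automorphy \<gamma> z) > 0" using automorphy_nonzero[OF assms(1,3)] by simp
  ultimately show ?thesis
    unfolding Im_moebius[OF assms(1,3)] using assms(3) by (simp add: field_simps power2_eq_square)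
qed

lemma moebius_ext_None_iff_c:
  fixes \<gamma> :: "int^2^2"
  shows "moebius_ext \<gamma> None = None \<longleftrightarrow> \<gamma> $ 2 $ 1 = 0"
  by (simp add: moebius_ext.simps)

text \<open>If z and \<gamma> z both lie in \<open>K\<close>, the formula for the imaginary part
  bounds |c z + d|, hence c and d. The same bound for the inverse controls a, and b is recovered
  from \<gamma> z (c z + d) - a z.\<close>

lemma finite_SL2Z_bounded:
  assumes K: "bounded K" "\<And>z. z \<in> K \<Longrightarrow> Im z \<ge> e" "e > 0"
  shows "finite {\<gamma> \<in> carrier SL2Z. \<exists>z\<in>K. moebius \<gamma> z \<in> K}"
proof -
  obtain B where B: "B > 0" "\<And>z. z \<in> K \<Longrightarrow> cmod z \<le> B" using K(1) bounded_pos by blast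
  define J where "J = sqrt (B / e)"
  have J: "J \<ge> 0" using B K(3) by (simp add: J_def)
  have cd: "\<bar>real_of_int c\<bar> \<le> J / e \<and> \<bar>real_of_int d\<bar> \<le> J + J / e * B \<and> cmod (of_int c * z + of_int d) \<le> J"
    if "\<gamma> \<in> carrier SL2Z" "z \<in> K" "moebius \<gamma> z \<in> K" "c = \<gamma> $ 2 $ 1" "d = \<gamma> $ 2 $ 2" for \<gamma> :: "int^2^2" and z c d
  proof -
    have z: "Im z \<ge> e" "Im z > 0" using K that by force+
    let ?j = "of_int c * z + of_int d"
    have j: "cmod ?j > 0" using automorphy_nonzero[OF that(1) z(2)] by (simp add: automorphy_def that)
    have "e \<le> Im z / (cmod ?j)\<^sup>2" using K(2)[OF that(3)] Im_moebius[OF that(1) z(2)] by (simp add: automorphy_def that)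
    then have "e * (cmod ?j)\<^sup>2 \<le> Im z" using j by (simp add: field_simps)
    also have "\<dots> \<le> B" using B(2)[OF that(2)] abs_Im_le_cmod[of z] by linarith
    finally have "(cmod ?j)\<^sup>2 \<le> B / e" using K(3) by (simp add: field_simps)
    then have jJ: "cmod ?j \<le> J" unfolding J_def by (rule real_le_rsqrt)
    have "\<bar>real_of_int c\<bar> * e \<le> \<bar>real_of_int c\<bar> * Im z" using z by (intro mult_left_mono) auto
    also have "\<dots> = \<bar>Im ?j\<bar>" using z by (simp add: abs_mult)
    also have "\<dots> \<le> J" using jJ abs_Im_le_cmod order_trans by blast
    finally have c: "\<bar>real_of_int c\<bar> \<le> J / e" using K(3) by (simp add: field_simps)
    have A: "cmod (of_int c * z) \<le> J / e * B"
      unfolding norm_mult norm_of_int by (rule mult_mono) (use c B(2)[OF that(2)] J K(3) in auto)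
    have "\<bar>real_of_int d\<bar> = cmod (?j - of_int c * z)" by (simp add: norm_of_int)
    also have "\<dots> \<le> cmod ?j + cmod (of_int c * z)" by (rule norm_triangle_ineq4)
    also have "\<dots> \<le> J + J / e * B" by (rule add_mono[OF jJ A])
    finally show ?thesis using c jJ by blast
  qed
  define N where "N = \<lceil>J / e\<rceil> + \<lceil>J + J / e * B\<rceil> + \<lceil>B * J + (J + J / e * B) * B\<rceil>"
  have pos: "0 \<le> J / e" "0 \<le> J + J / e * B" "0 \<le> B * J + (J + J / e * B) * B" using J B K(3) by simp_all
  have N: "\<bar>k\<bar> \<le> N" if "\<bar>real_of_int k\<bar> \<le> J / e \<or> \<bar>real_of_int k\<bar> \<le> J + J / e * B \<or>
      \<bar>real_of_int k\<bar> \<le> B * J + (J + J / e * B) * B" for k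
  proof -
    have "0 \<le> \<lceil>J / e\<rceil>" "0 \<le> \<lceil>J + J / e * B\<rceil>" "0 \<le> \<lceil>B * J + (J + J / e * B) * B\<rceil>" using pos by linarith+
    moreover have "\<bar>k\<bar> \<le> \<lceil>J / e\<rceil> \<or> \<bar>k\<bar> \<le> \<lceil>J + J / e * B\<rceil> \<or> \<bar>k\<bar> \<le> \<lceil>B * J + (J + J / e * B) * B\<rceil>"
      using that by (simp add: le_ceiling_iff) linarith
    ultimately show ?thesis unfolding N_def by linarith
  qed
  have "{\<gamma> \<in> carrier SL2Z. \<exists>z\<in>K. moebius \<gamma> z \<in> K} \<subseteq>
      (\<lambda>(a, b, c, d). mat2 a b c d) ` ({- N..N} \<times> {- N..N} \<times> {- N..N} \<times> {- N..N})"
  proof (intro subsetI, clarify)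
    fix \<gamma> z assume \<gamma>: "\<gamma> \<in> carrier SL2Z" and z: "z \<in> K" "moebius \<gamma> z \<in> K"
    obtain a b c d where \<gamma>': "\<gamma> = mat2 a b c d" by (rule mat2_cases)
    have Imz: "Im z > 0" using K z by force
    have 1: "\<bar>real_of_int c\<bar> \<le> J / e" "\<bar>real_of_int d\<bar> \<le> J + J / e * B" "cmod (of_int c * z + of_int d) \<le> J"
      using cd[OF \<gamma> z] by (auto simp: \<gamma>')
    have 2: "\<bar>real_of_int a\<bar> \<le> J + J / e * B"
      using cd[OF adj_SL2Z(1)[OF \<gamma>] z(2) _ refl refl] moebius_adj[OF \<gamma> Imz] z(1) by (simp add: adj_def \<gamma>')
    have j: "of_int c * z + of_int d \<noteq> 0" using automorphy_nonzero[OF \<gamma> Imz] by (simp add: automorphy_def \<gamma>')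
    have "of_int b = moebius \<gamma> z * (of_int c * z + of_int d) - of_int a * z"
      using j by (simp add: moebius_def \<gamma>')
    then have "\<bar>real_of_int b\<bar> = cmod (moebius \<gamma> z * (of_int c * z + of_int d) - of_int a * z)"
      by (metis norm_of_int)
    also have "\<dots> \<le> cmod (moebius \<gamma> z * (of_int c * z + of_int d)) + cmod (of_int a * z)" by (rule norm_triangle_ineq4)
    also have "\<dots> \<le> B * J + (J + J / e * B) * B"
      unfolding norm_mult norm_of_int using 1 2 B z pos by (intro add_mono mult_mono) auto
    finally have "\<bar>a\<bar> \<le> N" "\<bar>b\<bar> \<le> N" "\<bar>c\<bar> \<le> N" "\<bar>d\<bar> \<le> N"
      using N 1 2 by blast+
    then show "\<gamma> \<in> (\<lambda>(a, b, c, d). mat2 a b c d) ` ({- N..N} \<times> {- N..N} \<times> {- N..N} \<times> {- N..N})"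
      unfolding \<gamma>' by (intro image_eqI[of _ _ "(a, b, c, d)"]) auto
  qed
  then show ?thesis by (rule finite_subset) simp
qed

text \<open>Only finitely many matrices bring the two small balls into contact. For each of them
  that does not carry x to y, the two points have disjoint neighbourhoods, and the finitely many
  conditions are intersected.\<close>

lemma separation_interior:
  assumes "Im x > 0" "Im y > 0"
  obtains U V where "open U" "x \<in> U" "U \<subseteq> upper_half_plane" "open V" "y \<in> V" "V \<subseteq> upper_half_plane"
    "\<And>\<gamma> z. \<gamma> \<in> carrier SL2Z \<Longrightarrow> z \<in> U \<Longrightarrow> moebius \<gamma> z \<in> V \<Longrightarrow> moebius \<gamma> x = y"
proof -
  define e where "e = min (Im x) (Im y) / 2"
  have e: "e > 0" using assms by (simp add: e_def)
  define K where "K = ball x e \<union> ball y e"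
  have "Im z \<ge> e" if "z \<in> K" for z
  proof -
    have "\<bar>Im (x - z)\<bar> < e \<or> \<bar>Im (y - z)\<bar> < e"
      using that abs_Im_le_cmod[of "x - z"] abs_Im_le_cmod[of "y - z"] unfolding K_def dist_norm mem_ball Un_iff by linarith
    moreover have "2 * e \<le> Im x" "2 * e \<le> Im y" by (simp_all add: e_def)
    ultimately show ?thesis by auto
  qed
  moreover have "bounded K" unfolding K_def by simp
  ultimately have fin: "finite {\<gamma> \<in> carrier SL2Z. \<exists>z\<in>K. moebius \<gamma> z \<in> K}" (is "finite ?F")
    using finite_SL2Z_bounded e by blast
  have Kpos: "K \<subseteq> upper_half_plane" using \<open>\<And>z. z \<in> K \<Longrightarrow> Im z \<ge> e\<close> e by force
  let ?B = "{\<gamma> \<in> ?F. moebius \<gamma> x \<noteq> y}"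
  have "\<forall>\<gamma>\<in>?B. \<exists>p. open (fst p) \<and> open (snd p) \<and> moebius \<gamma> x \<in> fst p \<and> y \<in> snd p \<and> fst p \<inter> snd p = {}"
  proof
    fix \<gamma> assume "\<gamma> \<in> ?B"
    then have "moebius \<gamma> x \<noteq> y" by blast
    from hausdorff[OF this] show "\<exists>p. open (fst p) \<and> open (snd p) \<and> moebius \<gamma> x \<in> fst p \<and> y \<in> snd p \<and> fst p \<inter> snd p = {}"
      by auto
  qed
  from bchoice[OF this] obtain p where "\<forall>\<gamma>\<in>?B. open (fst (p \<gamma>)) \<and> open (snd (p \<gamma>)) \<and>
      moebius \<gamma> x \<in> fst (p \<gamma>) \<and> y \<in> snd (p \<gamma>) \<and> fst (p \<gamma>) \<inter> snd (p \<gamma>) = {}" ..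
  then have p: "open (fst (p \<gamma>)) \<and> open (snd (p \<gamma>)) \<and>
      moebius \<gamma> x \<in> fst (p \<gamma>) \<and> y \<in> snd (p \<gamma>) \<and> fst (p \<gamma>) \<inter> snd (p \<gamma>) = {}" if "\<gamma> \<in> ?B" for \<gamma>
    using that by blast
  define U where "U = ball x e \<inter> (\<Inter>\<gamma>\<in>?B. {z \<in> upper_half_plane. moebius \<gamma> z \<in> fst (p \<gamma>)})"
  define V where "V = ball y e \<inter> (\<Inter>\<gamma>\<in>?B. snd (p \<gamma>))"
  have fB: "finite ?B" by (rule finite_subset[OF _ fin]) auto
  show ?thesis
  proof
    show "open U" unfolding U_def using p fB by (intro open_Int open_INT ballI open_moebius_vimage) auto
    show "open V" unfolding V_def using p fB by (intro open_Int open_INT ballI) auto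
    show "x \<in> U" "y \<in> V" using p e assms by (auto simp: U_def V_def)
    show "U \<subseteq> upper_half_plane" "V \<subseteq> upper_half_plane" using Kpos by (auto simp: U_def V_def K_def)
    fix \<gamma> z assume g: "\<gamma> \<in> carrier SL2Z" "z \<in> U" "moebius \<gamma> z \<in> V"
    show "moebius \<gamma> x = y"
    proof (rule ccontr)
      assume n: "moebius \<gamma> x \<noteq> y"
      have "z \<in> K" "moebius \<gamma> z \<in> K" using g by (auto simp: U_def V_def K_def)
      then have gB: "\<gamma> \<in> ?B" using g n by blast
      then have "moebius \<gamma> z \<in> fst (p \<gamma>)" "moebius \<gamma> z \<in> snd (p \<gamma>)" using g by (auto simp: U_def V_def)
      then show False using p[OF gB] by blast
    qed
  qed
qed

text \<open>Stated for all of \<open>SL2Z\<close>, so that the neighbourhoods serve every subgroup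
  at once and may be translated by any matrix. The conclusion is an equation and not disjointness,
  because points equivalent under \<open>SL2Z\<close> may still lie in different
  \<Gamma>-orbits.\<close>

definition separated_mod :: "complex option \<Rightarrow> complex option \<Rightarrow> bool" where
  "separated_mod x y \<longleftrightarrow> (\<exists>U V. openin extended_half_plane U \<and> openin extended_half_plane V \<and> x \<in> U \<and> y \<in> V \<and>
     (\<forall>\<gamma>\<in>carrier SL2Z. \<forall>u\<in>U. moebius_ext \<gamma> u \<in> V \<longrightarrow> moebius_ext \<gamma> x = y))"

lemma separated_mod_sym:
  assumes "separated_mod x y"
  shows "separated_mod y x"
proof -
  obtain U V where UV: "openin extended_half_plane U" "openin extended_half_plane V" "x \<in> U" "y \<in> V"
    "\<And>\<gamma> u. \<gamma> \<in> carrier SL2Z \<Longrightarrow> u \<in> U \<Longrightarrow> moebius_ext \<gamma> u \<in> V \<Longrightarrow> moebius_ext \<gamma> x = y"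
    using assms unfolding separated_mod_def by blast
  have "moebius_ext \<gamma> y = x" if "\<gamma> \<in> carrier SL2Z" "v \<in> V" "moebius_ext \<gamma> v \<in> U" for \<gamma> v
    using UV(5)[OF adj_SL2Z(1)[OF that(1)] that(3)] that moebius_ext_adj[OF that(1)] by metis
  with UV show ?thesis unfolding separated_mod_def by blast
qed

lemma separated_mod_translate:
  assumes "separated_mod x y" "\<delta> \<in> carrier SL2Z"
  shows "separated_mod (moebius_ext \<delta> x) y"
proof -
  obtain U V where UV: "openin extended_half_plane U" "openin extended_half_plane V" "x \<in> U" "y \<in> V"
    "\<And>\<gamma> u. \<gamma> \<in> carrier SL2Z \<Longrightarrow> u \<in> U \<Longrightarrow> moebius_ext \<gamma> u \<in> V \<Longrightarrow> moebius_ext \<gamma> x = y"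
    using assms unfolding separated_mod_def by blast
  have "moebius_ext \<gamma> (moebius_ext \<delta> x) = y" if "\<gamma> \<in> carrier SL2Z" "u \<in> U" "moebius_ext \<gamma> (moebius_ext \<delta> u) \<in> V" for \<gamma> u
    using UV(5)[OF mult_in_SL2Z[OF that(1) assms(2)] that(2)] that assms(2) by (simp add: moebius_ext_mult)
  with UV openin_moebius_ext_image[OF assms(2) UV(1)] show ?thesis
    unfolding separated_mod_def by (intro exI[of _ "moebius_ext \<delta> ` U"] exI[of _ V]) auto
qed

lemma separated_mod_None_Some:
  assumes "Im y > 0"
  shows "separated_mod None (Some y)"
proof -
  \<comment> \<open>A horizontal strip around y. From above the height \<open>M\<close>, matrices
    that fix infinity keep the height and end above the strip; all others end below it, at height
    less than Im y / 2.\<close>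
  define V where "V = {z. Im z > Im y / 2} \<inter> {z. Im z < Im y + 1}"
  define M where "M = max (Im y + 1) (2 / Im y)"
  have M: "M > 0" using assms by (simp add: M_def less_max_iff_disj)
  have "open V" unfolding V_def by (intro open_Int open_halfspace_Im_gt open_halfspace_Im_lt)
  then have "openin extended_half_plane (Some ` V)"
    using assms by (intro openin_Some_image) (auto simp: V_def)
  moreover have "moebius_ext \<gamma> u \<notin> Some ` V" if \<gamma>: "\<gamma> \<in> carrier SL2Z" and u: "u \<in> cusp_nbhd M" for \<gamma> u
  proof (cases u)
    case None
    have "Im w > 0" if "w \<in> V" for w using that assms by (simp add: V_def)
    then show ?thesis unfolding None using Some_notin_moebius_ext_None[of _ \<gamma>] by blast
  next
    case (Some z)
    then have z: "Im z > M" "Im z > 0" using u M by (auto simp: cusp_nbhd_def)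
    have "moebius \<gamma> z \<notin> V"
    proof (cases "\<gamma> $ 2 $ 1 = 0")
      case True
      then obtain k :: int where "\<And>z. moebius \<gamma> z = z + of_int k"
        using stabilizer_infinity[OF \<gamma>] moebius_ext_None_iff_c by metis
      then show ?thesis using z by (auto simp: V_def M_def)
    next
      case False
      have "Im (moebius \<gamma> z) \<le> 1 / Im z" by (rule Im_moebius_le_inverse[OF \<gamma> False z(2)])
      also have "\<dots> < Im y / 2"
      proof -
        have "2 / Im y < Im z" using z by (simp add: M_def)
        then show ?thesis using assms z(2) by (simp add: field_simps)
      qed
      finally show ?thesis by (simp add: V_def)
    qed
    then show ?thesis using Some moebius_ext_Some[OF \<gamma> z(2)] by auto
  qed
  ultimately show ?thesis unfolding separated_mod_def
    using openin_cusp_nbhd[of M] M assms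
    by (intro exI[of _ "cusp_nbhd M"] exI[of _ "Some ` V"]) (auto simp: cusp_nbhd_def V_def)
qed

text \<open>Height 1 is the threshold: a matrix that moves infinity takes imaginary parts above 1 to
  imaginary parts below 1.\<close>

lemma separated_mod_None_None: "separated_mod None None"
proof -
  have "moebius_ext \<gamma> None = None"
    if \<gamma>: "\<gamma> \<in> carrier SL2Z" and u: "u \<in> cusp_nbhd 1" "moebius_ext \<gamma> u \<in> cusp_nbhd 1" for \<gamma> u
  proof (rule ccontr)
    assume n: "moebius_ext \<gamma> None \<noteq> None"
    then have c: "\<gamma> $ 2 $ 1 \<noteq> 0" by (simp add: moebius_ext_None_iff_c)
    show False
    proof (cases u)
      case None
      have "Im w > 0" if "w \<in> {z. Im z > 1}" for w using that by simp
      then show ?thesis using u n Some_notin_moebius_ext_None[of _ \<gamma>] unfolding None cusp_nbhd_def by blast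
    next
      case (Some z)
      then have z: "Im z > 1" using u by (auto simp: cusp_nbhd_def)
      then have "Im (moebius \<gamma> z) \<le> 1 / Im z" using Im_moebius_le_inverse[OF \<gamma> c] by simp
      also have "\<dots> < 1" using z by simp
      finally show ?thesis using u Some moebius_ext_Some[OF \<gamma>, of z] z by (auto simp: cusp_nbhd_def)
    qed
  qed
  then show ?thesis unfolding separated_mod_def using openin_cusp_nbhd[of 1]
    by (intro exI[of _ "cusp_nbhd 1"]) (auto simp: cusp_nbhd_def)
qed

lemma separated_mod:
  assumes "x \<in> extended_half_plane_points" "y \<in> extended_half_plane_points"
  shows "separated_mod x y"
proof -
  have N: "separated_mod None y" if "y \<in> extended_half_plane_points" for y
    using that
  proof (cases rule: extended_half_plane_points_cases)
    case (2 \<gamma>)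
    then show ?thesis
      using separated_mod_sym[OF separated_mod_translate[OF separated_mod_None_None]] by blast
  qed (use separated_mod_None_Some in auto)
  from assms(1) show ?thesis
  proof (cases rule: extended_half_plane_points_cases)
    case x: (1 z)
    from assms(2) show ?thesis
    proof (cases rule: extended_half_plane_points_cases)
      case y: (1 w)
      obtain U V where UV: "open U" "z \<in> U" "U \<subseteq> upper_half_plane" "open V" "w \<in> V" "V \<subseteq> upper_half_plane"
        "\<And>\<gamma> u. \<gamma> \<in> carrier SL2Z \<Longrightarrow> u \<in> U \<Longrightarrow> moebius \<gamma> u \<in> V \<Longrightarrow> moebius \<gamma> z = w"
        using separation_interior[OF x(1) y(1)] by blast
      have "moebius_ext \<gamma> x = y" if g: "\<gamma> \<in> carrier SL2Z" "u \<in> Some ` U" "moebius_ext \<gamma> u \<in> Some ` V" for \<gamma> u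
      proof -
        obtain u' where u': "u = Some u'" "u' \<in> U" using g(2) by blast
        then have "Im u' > 0" using UV(3) by blast
        then have "moebius \<gamma> u' \<in> V" using g(3) unfolding u'(1) moebius_ext_Some[OF g(1) \<open>Im u' > 0\<close>] by auto
        then have "moebius \<gamma> z = w" by (rule UV(7)[OF g(1) u'(2)])
        then show ?thesis unfolding x(2) y(2) moebius_ext_Some[OF g(1) x(1)] by simp
      qed
      with UV x y openin_Some_image[OF UV(1,3)] openin_Some_image[OF UV(4,6)] show ?thesis
        unfolding separated_mod_def by (intro exI[of _ "Some ` U"] exI[of _ "Some ` V"]) auto
    next
      case (2 \<gamma>)
      then show ?thesis
        using separated_mod_sym[OF separated_mod_translate[OF N[OF assms(1)]]] by blast
    qed
  next
    case (2 \<gamma>)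
    show ?thesis unfolding 2(2) by (rule separated_mod_translate[OF N[OF assms(2)] 2(1)])
  qed
qed

text \<open>A minimum of |c \<tau> + d| is a maximum of the height in the orbit. After a translation
  the inversion cannot raise the point w, hence |w| \<ge> 1, and |Re w| \<le> 1/2 leaves (Im w)^2
  \<ge> 3/4. The rounder bound 1/2 is enough for compactness.\<close>

lemma reduction_to_strip:
  assumes \<tau>: "Im \<tau> > 0"
  obtains \<gamma> where "\<gamma> \<in> carrier SL2Z" "\<bar>Re (moebius \<gamma> \<tau>)\<bar> \<le> 1/2" "Im (moebius \<gamma> \<tau>) \<ge> 1/2"
proof -
  obtain C where C: "C > 0" "\<And>m n::real. m\<^sup>2 + n\<^sup>2 \<le> C * (cmod (of_real m * \<tau> + of_real n))\<^sup>2"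
    using norm_lattice_point_ge[OF \<tau>] by blast
  define f where "f = (\<lambda>(c::int, d::int). cmod (of_int c * \<tau> + of_int d))"
  define S where "S = {(\<gamma> $ 2 $ 1, \<gamma> $ 2 $ 2) | \<gamma> :: int^2^2. \<gamma> \<in> carrier SL2Z}"
  \<comment> \<open>The set \<open>S\<close> is infinite, but only finitely many of its pairs have
    \<open>f\<close> at most 1. Since (0, 1) is one of them, a minimum over \<open>S1\<close> is a
    minimum over \<open>S\<close>.\<close>
  define S1 where "S1 = {p \<in> S. f p \<le> 1}"
  have "(0, 1) \<in> S" using one_in_SL2Z unfolding S_def mat_1_eq by force
  then have ne: "(0, 1) \<in> S1" by (simp add: S1_def f_def)
  have "S1 \<subseteq> {- \<lceil>C\<rceil>..\<lceil>C\<rceil>} \<times> {- \<lceil>C\<rceil>..\<lceil>C\<rceil>}"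
  proof clarify
    fix c d assume "(c, d) \<in> S1"
    then have "cmod (of_int c * \<tau> + of_int d) \<le> 1" by (simp add: S1_def f_def)
    then have "(cmod (of_int c * \<tau> + of_int d))\<^sup>2 \<le> 1" by (simp add: power_le_one)
    then have "C * (cmod (of_int c * \<tau> + of_int d))\<^sup>2 \<le> C * 1" using C(1) by (intro mult_left_mono) auto
    then have s: "(real_of_int c)\<^sup>2 + (real_of_int d)\<^sup>2 \<le> C" using C(2)[of "of_int c" "of_int d"] by simp
    have "\<bar>k\<bar> \<le> \<lceil>C\<rceil>" if "(real_of_int k)\<^sup>2 \<le> C" for k
    proof -
      have "\<bar>k\<bar> \<le> k\<^sup>2"
      proof (cases "k = 0")
        case False
        then have "\<bar>k\<bar> * 1 \<le> \<bar>k\<bar> * \<bar>k\<bar>" by (intro mult_left_mono) auto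
        then show ?thesis by (simp add: power2_eq_square flip: abs_mult)
      qed simp
      then have "real_of_int \<bar>k\<bar> \<le> (real_of_int k)\<^sup>2" by (metis of_int_le_iff of_int_power)
      with that show ?thesis by (simp add: le_ceiling_iff)
    qed
    moreover have "(real_of_int c)\<^sup>2 \<le> C" "(real_of_int d)\<^sup>2 \<le> C" using s zero_le_power2 by (smt (verit))+
    ultimately have "\<bar>c\<bar> \<le> \<lceil>C\<rceil>" "\<bar>d\<bar> \<le> \<lceil>C\<rceil>" by blast+
    then show "c \<in> {- \<lceil>C\<rceil>..\<lceil>C\<rceil>} \<and> d \<in> {- \<lceil>C\<rceil>..\<lceil>C\<rceil>}" by auto
  qed
  then have "finite S1" by (rule finite_subset) simp
  then obtain p where p: "p \<in> S1" "\<And>q. q \<in> S1 \<Longrightarrow> f p \<le> f q"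
    using ne by (metis arg_min_if_finite(1) arg_min_least empty_iff)
  have pS: "f p \<le> f q" if "q \<in> S" for q
  proof (cases "f q \<le> 1")
    case True
    then show ?thesis using p(2) that by (simp add: S1_def)
  next
    case False
    then show ?thesis using p(1) by (simp add: S1_def)
  qed
  obtain \<gamma> where \<gamma>: "\<gamma> \<in> carrier SL2Z" "f p = cmod (automorphy \<gamma> \<tau>)"
    using p(1) by (auto simp: S1_def S_def f_def automorphy_def)
  have max: "Im (moebius \<delta> \<tau>) \<le> Im (moebius \<gamma> \<tau>)" if \<delta>: "\<delta> \<in> carrier SL2Z" for \<delta>
  proof -
    have "(\<delta> $ 2 $ 1, \<delta> $ 2 $ 2) \<in> S" using \<delta> by (auto simp: S_def)
    from pS[OF this] have "cmod (automorphy \<gamma> \<tau>) \<le> cmod (automorphy \<delta> \<tau>)" using \<gamma>(2) by (simp add: f_def automorphy_def)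
    then have "(cmod (automorphy \<gamma> \<tau>))\<^sup>2 \<le> (cmod (automorphy \<delta> \<tau>))\<^sup>2" by (intro power_mono) auto
    moreover have "(cmod (automorphy \<gamma> \<tau>))\<^sup>2 > 0" using automorphy_nonzero[OF \<gamma>(1) \<tau>] by simp
    ultimately show ?thesis unfolding Im_moebius[OF \<gamma>(1) \<tau>] Im_moebius[OF \<delta> \<tau>] using \<tau>
      by (intro divide_left_mono) (auto intro!: mult_pos_pos)
  qed
  define k where "k = round (Re (moebius \<gamma> \<tau>))"
  define T where "T = mat2 1 (- k) 0 1"
  have T: "T \<in> carrier SL2Z" by (simp add: T_def mat2_in_SL2Z)
  define w where "w = moebius (T ** \<gamma>) \<tau>"
  have w: "w = moebius \<gamma> \<tau> - of_int k" unfolding w_def moebius_mult[OF T \<gamma>(1) \<tau>] by (simp add: T_def moebius_def)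
  have Tg: "T ** \<gamma> \<in> carrier SL2Z" by (rule mult_in_SL2Z[OF T \<gamma>(1)])
  have re: "\<bar>Re w\<bar> \<le> 1/2" using of_int_round_abs_le[of "Re (moebius \<gamma> \<tau>)"] by (simp add: w k_def abs_minus_commute)
  have wpos: "Im w > 0" unfolding w_def by (rule Im_moebius_pos[OF Tg \<tau>])
  \<comment> \<open>The inversion z -> -1/z, which divides the height of \<open>w\<close> by
    |w|^2.\<close>
  define Q where "Q = mat2 0 (- 1) 1 0"
  have Q: "Q \<in> carrier SL2Z" by (simp add: Q_def mat2_in_SL2Z)
  have "Im (moebius Q w) \<le> Im w"
    using max[OF mult_in_SL2Z[OF Q Tg]] moebius_mult[OF Q Tg \<tau>] w by (simp add: w_def)
  then have "Im w / (cmod w)\<^sup>2 \<le> Im w" using Im_moebius[OF Q wpos] by (simp add: automorphy_def Q_def)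
  moreover have "cmod w > 0" using wpos by auto
  ultimately have "(cmod w)\<^sup>2 \<ge> 1" using wpos by (simp add: field_simps)
  then have "(Re w)\<^sup>2 + (Im w)\<^sup>2 \<ge> 1" by (simp add: cmod_power2)
  moreover have "(Re w)\<^sup>2 \<le> (1/2)\<^sup>2" using re by (metis abs_le_square_iff abs_of_pos half_gt_zero_iff zero_less_one)
  ultimately have "(1/2)\<^sup>2 \<le> (Im w)\<^sup>2" by (simp add: power2_eq_square)
  then have "Im w \<ge> 1/2" using wpos by (meson less_imp_le power2_le_imp_le)
  with re Tg show ?thesis using that w_def by blast
qed

section \<open>Topology of modular curves\<close>

lemma path_component_Some:
  assumes "Im z > 0" "Im w > 0"
  shows "path_component_of extended_half_plane (Some z) (Some w)"
proof -
  have "convex upper_half_plane" by (rule convex_halfspace_Im_gt)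
  then have "path_connectedin (top_of_set upper_half_plane) upper_half_plane"
    by (simp add: convex_imp_path_connected path_connectedin_subtopology path_connectedin_euclidean)
  then have "path_connectedin extended_half_plane (Some ` upper_half_plane)"
    using continuous_map_Some path_connectedin_continuous_map_image by blast
  then show ?thesis using assms by (auto simp: path_component_of intro: path_component_of)
qed

lemma path_component_None: "path_component_of extended_half_plane None (Some \<i>)"
proof -
  \<comment> \<open>The path comes down the imaginary axis, with height 1/t at time t, so that times
    below 1/M are exactly those above height M or at infinity.\<close>
  define g where "g t = (if t \<le> 0 then None else Some (\<i> / complex_of_real t))" for t :: real
  have "continuous_map (top_of_set {0..1}) extended_half_plane g"
    unfolding continuous_map_def
  proof (intro conjI allI impI)
    show "g \<in> topspace (top_of_set {0..1}) \<rightarrow> topspace extended_half_plane"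
      by (auto simp: g_def topspace_extended_half_plane extended_half_plane_points_def Im_divide_of_real)
    fix U assume "openin extended_half_plane U"
    then have U: "open {z \<in> upper_half_plane. Some z \<in> U}"
      "None \<in> U \<Longrightarrow> \<exists>M>0. \<forall>z. Im z > M \<longrightarrow> Some z \<in> U"
      unfolding openin_extended_half_plane extended_half_plane_open_def by blast+
    have "continuous_on {0<..} (\<lambda>t. \<i> / complex_of_real t)" by (intro continuous_intros) auto
    from continuous_open_preimage[OF this _ U(1)]
    have o: "open ({0<..} \<inter> (\<lambda>t. \<i> / complex_of_real t) -` {z \<in> upper_half_plane. Some z \<in> U})" (is "open ?V") by simp
    have V: "t \<in> ?V \<longleftrightarrow> t > 0 \<and> g t \<in> U" for t by (auto simp: g_def)
    show "openin (top_of_set {0..1}) {x \<in> topspace (top_of_set {0..1}). g x \<in> U}"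
    proof (cases "None \<in> U")
      case True
      then obtain M where M: "M > 0" "\<And>z. Im z > M \<Longrightarrow> Some z \<in> U" using U(2) by blast
      have "g t \<in> U" if "t < 1 / M" for t
      proof (cases "t \<le> 0")
        case False
        then have "M < 1 / t" using that M(1) by (simp add: field_simps)
        then show ?thesis using False M(2)[of "\<i> / of_real t"] by (simp add: g_def)
      qed (use True in \<open>simp add: g_def\<close>)
      moreover have "0 < 1 / M" using M(1) by simp
      ultimately have eq: "{x \<in> topspace (top_of_set {0..1}). g x \<in> U} = {0..1} \<inter> ({..<1/M} \<union> ?V)"
        using V by (auto simp: not_less intro: order.strict_trans2[of 0 "1 / M"])
      show ?thesis unfolding eq by (intro openin_open_Int open_Un open_lessThan o)
    next
      case False
      then have "t > 0" if "g t \<in> U" for t using that by (cases "t \<le> 0") (auto simp: g_def)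
      then have "t \<in> ?V \<longleftrightarrow> g t \<in> U" for t using V by blast
      then have eq: "{x \<in> topspace (top_of_set {0..1}). g x \<in> U} = {0..1} \<inter> ?V"
        unfolding topspace_euclidean_subtopology by blast
      show ?thesis unfolding eq by (intro openin_open_Int o)
    qed
  qed
  then show ?thesis unfolding path_component_of_def pathin_def
    by (intro exI[of _ g]) (simp add: g_def)
qed

lemma path_connected_extended_half_plane: "path_connected_space extended_half_plane"
proof -
  have i: "path_component_of extended_half_plane x (Some \<i>)" if "x \<in> extended_half_plane_points" for x
    using that
  proof (cases rule: extended_half_plane_points_cases)
    case (1 z)
    then show ?thesis using path_component_Some[of z \<i>] by simp
  next
    case (2 \<gamma>)
    obtain g where g: "pathin extended_half_plane g" "g 0 = None" "g 1 = Some \<i>"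
      using path_component_None unfolding path_component_of_def by blast
    have "pathin extended_half_plane (moebius_ext \<gamma> \<circ> g)"
      using g(1) continuous_map_moebius_ext[OF 2(1)] unfolding pathin_def by (rule continuous_map_compose)
    then have "path_component_of extended_half_plane x (moebius_ext \<gamma> (Some \<i>))"
      unfolding path_component_of_def using g 2 by (intro exI[of _ "moebius_ext \<gamma> \<circ> g"]) simp
    moreover have "path_component_of extended_half_plane (moebius_ext \<gamma> (Some \<i>)) (Some \<i>)"
      using moebius_ext_Some[OF 2(1), of \<i>] Im_moebius_pos[OF 2(1), of \<i>] path_component_Some by simp
    ultimately show ?thesis by (rule path_component_of_trans)
  qed
  show ?thesis unfolding path_connected_space_iff_path_component topspace_extended_half_plane
    using i path_component_of_sym path_component_of_trans by metis
qed

definition reduced_points :: "complex option set" where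
  "reduced_points = insert None (Some ` {z. \<bar>Re z\<bar> \<le> 1/2 \<and> Im z \<ge> 1/2})"

text \<open>The member of the cover that contains infinity swallows everything above some height.
  The rest of the strip is a closed rectangle.\<close>

lemma compactin_reduced_points: "compactin extended_half_plane reduced_points"
  unfolding compactin_def
proof (intro conjI allI impI)
  show "reduced_points \<subseteq> topspace extended_half_plane"
    by (auto simp: reduced_points_def topspace_extended_half_plane extended_half_plane_points_def)
  fix \<U> assume "(\<forall>U\<in>\<U>. openin extended_half_plane U) \<and> reduced_points \<subseteq> \<Union>\<U>"
  then have \<U>: "\<And>U. U \<in> \<U> \<Longrightarrow> openin extended_half_plane U" "reduced_points \<subseteq> \<Union>\<U>" by blast+
  then obtain U0 where U0: "U0 \<in> \<U>" "None \<in> U0" by (auto simp: reduced_points_def)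
  then obtain M where M: "M > 0" "\<And>z. Im z > M \<Longrightarrow> Some z \<in> U0"
    using \<U>(1) unfolding openin_extended_half_plane extended_half_plane_open_def by blast
  define R where "R = cbox (Complex (-1/2) (1/2)) (Complex (1/2) M)"
  have R: "z \<in> R \<longleftrightarrow> \<bar>Re z\<bar> \<le> 1/2 \<and> 1/2 \<le> Im z \<and> Im z \<le> M" for z
    by (auto simp: R_def in_cbox_complex_iff)
  have "compactin (top_of_set upper_half_plane) R"
    using R by (auto simp: compactin_subtopology R_def compact_cbox)
  from image_compactin[OF this continuous_map_Some] have "compactin extended_half_plane (Some ` R)" .
  moreover have "Some ` R \<subseteq> \<Union>\<U>" using \<U>(2) R by (auto simp: reduced_points_def)
  ultimately obtain \<F> where \<F>: "finite \<F>" "\<F> \<subseteq> \<U>" "Some ` R \<subseteq> \<Union>\<F>"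
    using \<U>(1) compactinD by metis
  have "reduced_points \<subseteq> \<Union>(insert U0 \<F>)"
  proof
    fix x assume x: "x \<in> reduced_points"
    show "x \<in> \<Union>(insert U0 \<F>)"
    proof (cases x)
      case (Some z)
      then show ?thesis using x M(2)[of z] \<F>(3) R[of z] by (cases "Im z > M") (auto simp: reduced_points_def)
    qed (use U0 in auto)
  qed
  with \<F> U0 show "\<exists>\<F>. finite \<F> \<and> \<F> \<subseteq> \<U> \<and> reduced_points \<subseteq> \<Union>\<F>"
    by (intro exI[of _ "insert U0 \<F>"]) auto
qed

lemma exists_reduced:
  assumes "x \<in> extended_half_plane_points"
  obtains \<gamma> where "\<gamma> \<in> carrier SL2Z" "moebius_ext \<gamma> x \<in> reduced_points"
  using assms
proof (cases rule: extended_half_plane_points_cases)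
  case (1 z)
  obtain \<gamma> where "\<gamma> \<in> carrier SL2Z" "\<bar>Re (moebius \<gamma> z)\<bar> \<le> 1/2" "Im (moebius \<gamma> z) \<ge> 1/2"
    using reduction_to_strip[OF 1(1)] by blast
  then show ?thesis using that moebius_ext_Some[OF _ 1(1)] 1(2) by (auto simp: reduced_points_def)
next
  case (2 \<gamma>)
  then show ?thesis using that[OF adj_SL2Z(1)[OF 2(1)]] moebius_ext_adj[OF 2(1)] by (simp add: reduced_points_def)
qed

section \<open>Orbit spaces of subgroups of the modular group\<close>

locale modular_group =
  fixes \<Gamma> :: "(int^2^2) set"
  assumes subset_SL2Z: "\<Gamma> \<subseteq> carrier SL2Z"
    and one_in: "mat 1 \<in> \<Gamma>"
    and mult_in: "\<gamma> \<in> \<Gamma> \<Longrightarrow> \<delta> \<in> \<Gamma> \<Longrightarrow> \<gamma> ** \<delta> \<in> \<Gamma>"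
    and adj_in: "\<gamma> \<in> \<Gamma> \<Longrightarrow> adj \<gamma> \<in> \<Gamma>"
begin

abbreviation "p \<equiv> modular_orbit \<Gamma>"

lemma topspace_modular_curve: "topspace (modular_curve \<Gamma>) = p ` extended_half_plane_points"
  using quotient_map_modular_orbit[of \<Gamma>] by (auto simp: quotient_map_def topspace_extended_half_plane)

lemma in_orbit: "x \<in> p x"
  using one_in moebius_ext_one unfolding modular_orbit_def by (metis image_eqI)

lemma orbit_eq_iff: "p x = p y \<longleftrightarrow> (\<exists>\<gamma>\<in>\<Gamma>. y = moebius_ext \<gamma> x)"
proof
  assume "p x = p y"
  then have "y \<in> p x" using in_orbit by blast
  then show "\<exists>\<gamma>\<in>\<Gamma>. y = moebius_ext \<gamma> x" by (auto simp: modular_orbit_def)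
next
  have sub: "p (moebius_ext \<gamma> x) \<subseteq> p x" if "\<gamma> \<in> \<Gamma>" for \<gamma> x
  proof
    fix z assume "z \<in> p (moebius_ext \<gamma> x)"
    then obtain \<delta> where \<delta>: "\<delta> \<in> \<Gamma>" "z = moebius_ext \<delta> (moebius_ext \<gamma> x)" by (auto simp: modular_orbit_def)
    have "\<gamma> \<in> carrier SL2Z" using that subset_SL2Z by blast
    then have "z = moebius_ext (\<delta> ** \<gamma>) x" by (simp add: \<delta>(2) moebius_ext_mult)
    then show "z \<in> p x" unfolding modular_orbit_def using mult_in[OF \<delta>(1) that] by blast
  qed
  assume "\<exists>\<gamma>\<in>\<Gamma>. y = moebius_ext \<gamma> x"
  then obtain \<gamma> where \<gamma>: "\<gamma> \<in> \<Gamma>" "y = moebius_ext \<gamma> x" by blast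
  have "x = moebius_ext (adj \<gamma>) y" using \<gamma> subset_SL2Z moebius_ext_adj(1)[of \<gamma> x] by auto
  then have "p x \<subseteq> p y" using sub[OF adj_in[OF \<gamma>(1)]] by simp
  moreover have "p y \<subseteq> p x" using sub \<gamma> by simp
  ultimately show "p x = p y" by blast
qed

lemma orbit_moebius_ext: "\<gamma> \<in> \<Gamma> \<Longrightarrow> p (moebius_ext \<gamma> x) = p x"
  using orbit_eq_iff by blast

lemma continuous_map_orbit: "continuous_map extended_half_plane (modular_curve \<Gamma>) p"
  using quotient_imp_continuous_map[OF quotient_map_modular_orbit] .

lemma open_map_orbit: "open_map extended_half_plane (modular_curve \<Gamma>) p"
  unfolding open_map_def
proof (intro allI impI)
  fix U assume U: "openin extended_half_plane U"
  then have Us: "U \<subseteq> extended_half_plane_points" using openin_subset topspace_extended_half_plane by blast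
  \<comment> \<open>The saturation of \<open>U\<close> is the union of its translates, and
    translation by a matrix preserves openness.\<close>
  have "{x \<in> topspace extended_half_plane. p x \<in> p ` U} = (\<Union>\<gamma>\<in>\<Gamma>. moebius_ext \<gamma> ` U)"
  proof (intro equalityI subsetI)
    fix x assume "x \<in> {x \<in> topspace extended_half_plane. p x \<in> p ` U}"
    then obtain u where "u \<in> U" "p u = p x" by (metis (mono_tags, lifting) image_iff mem_Collect_eq)
    then show "x \<in> (\<Union>\<gamma>\<in>\<Gamma>. moebius_ext \<gamma> ` U)" using orbit_eq_iff by blast
  next
    fix x assume "x \<in> (\<Union>\<gamma>\<in>\<Gamma>. moebius_ext \<gamma> ` U)"
    then obtain \<gamma> u where "\<gamma> \<in> \<Gamma>" "u \<in> U" "x = moebius_ext \<gamma> u" by blast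
    then have "p x = p u" "x \<in> extended_half_plane_points"
      using orbit_moebius_ext moebius_ext_in_points[of \<gamma> u] subset_SL2Z Us by blast+
    then show "x \<in> {x \<in> topspace extended_half_plane. p x \<in> p ` U}"
      using \<open>u \<in> U\<close> by (simp add: topspace_extended_half_plane)
  qed
  also have "openin extended_half_plane \<dots>"
    using openin_moebius_ext_image[OF _ U] subset_SL2Z by (intro openin_Union) auto
  finally have "openin extended_half_plane {x \<in> topspace extended_half_plane. p x \<in> p ` U}" .
  moreover have "p ` U \<subseteq> topspace (modular_curve \<Gamma>)" using Us by (auto simp: topspace_modular_curve)
  ultimately show "openin (modular_curve \<Gamma>) (p ` U)"
    using quotient_map_modular_orbit[of \<Gamma>] unfolding quotient_map_def by blast
qed

text \<open>If the images of separating neighbourhoods met, some element of \<Gamma> would carry a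
  point of one into the other, hence x to y, and the two orbits would be equal.\<close>

lemma Hausdorff_modular_curve: "Hausdorff_space (modular_curve \<Gamma>)"
  unfolding Hausdorff_space_def
proof (intro allI impI)
  fix X Y assume "X \<in> topspace (modular_curve \<Gamma>) \<and> Y \<in> topspace (modular_curve \<Gamma>) \<and> X \<noteq> Y"
  then obtain x y where xy: "X = p x" "Y = p y" "x \<in> extended_half_plane_points" "y \<in> extended_half_plane_points" "p x \<noteq> p y"
    unfolding topspace_modular_curve by blast
  obtain U V where UV: "openin extended_half_plane U" "openin extended_half_plane V" "x \<in> U" "y \<in> V"
    "\<And>\<gamma> u. \<gamma> \<in> carrier SL2Z \<Longrightarrow> u \<in> U \<Longrightarrow> moebius_ext \<gamma> u \<in> V \<Longrightarrow> moebius_ext \<gamma> x = y"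
    using separated_mod[OF xy(3,4)] unfolding separated_mod_def by blast
  have "disjnt (p ` U) (p ` V)"
  proof (rule ccontr)
    assume "\<not> disjnt (p ` U) (p ` V)"
    then obtain u v where uv: "u \<in> U" "v \<in> V" "p u = p v" by (auto simp: disjnt_def)
    then obtain \<gamma> where "\<gamma> \<in> \<Gamma>" "v = moebius_ext \<gamma> u" using orbit_eq_iff by blast
    then have "moebius_ext \<gamma> x = y" using UV(5) uv subset_SL2Z by blast
    then show False using xy(5) orbit_eq_iff \<open>\<gamma> \<in> \<Gamma>\<close> by blast
  qed
  moreover have "openin (modular_curve \<Gamma>) (p ` U)" "openin (modular_curve \<Gamma>) (p ` V)"
    using open_map_orbit UV unfolding open_map_def by blast+
  ultimately show "\<exists>U V. openin (modular_curve \<Gamma>) U \<and> openin (modular_curve \<Gamma>) V \<and> X \<in> U \<and> Y \<in> V \<and> disjnt U V"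
    using xy UV by blast
qed

lemma path_connected_modular_curve: "path_connected_space (modular_curve \<Gamma>)"
  using path_connected_space_quotient_map_image[OF quotient_map_modular_orbit path_connected_extended_half_plane] .

text \<open>Every point is a translate of a reduced point, so the curve is the union of finitely
  many compact pieces, one for each coset representative.\<close>

lemma compact_modular_curve:
  assumes R: "finite R" "R \<subseteq> carrier SL2Z" "\<And>\<gamma>. \<gamma> \<in> carrier SL2Z \<Longrightarrow> \<exists>\<delta>\<in>\<Gamma>. \<exists>r\<in>R. \<gamma> = \<delta> ** r"
  shows "compact_space (modular_curve \<Gamma>)"
proof -
  have "compactin (modular_curve \<Gamma>) (p ` moebius_ext r ` reduced_points)" if "r \<in> R" for r
    using image_compactin[OF image_compactin[OF compactin_reduced_points continuous_map_moebius_ext] continuous_map_orbit] that R(2)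
    by blast
  then have "compactin (modular_curve \<Gamma>) (\<Union>r\<in>R. p ` moebius_ext r ` reduced_points)"
    using R(1) by (intro compactin_Union) auto
  moreover have "(\<Union>r\<in>R. p ` moebius_ext r ` reduced_points) = topspace (modular_curve \<Gamma>)"
  proof (intro equalityI subsetI)
    fix X assume "X \<in> topspace (modular_curve \<Gamma>)"
    then obtain x where x: "X = p x" "x \<in> extended_half_plane_points" unfolding topspace_modular_curve by blast
    obtain \<gamma> where \<gamma>: "\<gamma> \<in> carrier SL2Z" "moebius_ext \<gamma> x \<in> reduced_points" using exists_reduced[OF x(2)] by blast
    obtain \<delta> r where \<delta>: "\<delta> \<in> \<Gamma>" "r \<in> R" "adj \<gamma> = \<delta> ** r" using R(3)[OF adj_SL2Z(1)[OF \<gamma>(1)]] by blast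
    have "x = moebius_ext (adj \<gamma>) (moebius_ext \<gamma> x)" using moebius_ext_adj[OF \<gamma>(1)] by simp
    also have "\<dots> = moebius_ext \<delta> (moebius_ext r (moebius_ext \<gamma> x))"
      unfolding \<delta>(3) using \<delta>(2) R(2) by (simp add: moebius_ext_mult subset_iff)
    finally have "p x = p (moebius_ext r (moebius_ext \<gamma> x))" using orbit_moebius_ext[OF \<delta>(1)] by metis
    then show "X \<in> (\<Union>r\<in>R. p ` moebius_ext r ` reduced_points)" using x \<delta>(2) \<gamma>(2) by blast
  qed (use \<open>compactin (modular_curve \<Gamma>) (\<Union>r\<in>R. p ` moebius_ext r ` reduced_points)\<close> compactin_subset_topspace in blast)
  ultimately show ?thesis by (simp add: compact_space_def)
qed

end

section \<open>The Schwarzian equation\<close>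

text \<open>At a zero or pole of order \<open>N\<close> of \<open>h'\<close> the Schwarzian has the leading term
  \<open>- (N + N\<^sup>2 / 2) / (w - z)\<^sup>2\<close>.\<close>

lemma zorder_deriv_if_schwarzian_bounded:
  assumes mero: "h meromorphic_on {z0}"
    and ev: "\<forall>\<^sub>F w in at z0. deriv h w \<noteq> 0 \<and> schwarzian h w = G w"
    and G: "((\<lambda>w. (w - z0)\<^sup>2 * G w) \<longlongrightarrow> 0) (at z0)"
  shows "zorder (deriv h) z0 = 0 \<or> zorder (deriv h) z0 = - 2"
proof -
  define P where "P = deriv h"
  define N where "N = zorder P z0"
  define g where "g = zor_poly P z0"
  have "P meromorphic_on {z0}" unfolding P_def using mero by (rule meromorphic_on_deriv)
  then have "isolated_singularity_at P z0" "not_essential P z0" by (auto simp: meromorphic_at_iff)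
  moreover have "\<exists>\<^sub>F w in at z0. P w \<noteq> 0"
    using ev by (intro eventually_frequently) (auto elim: eventually_mono simp: P_def)
  ultimately obtain r where r: "r > 0" "g holomorphic_on cball z0 r" "g z0 \<noteq> 0"
    "\<And>w. w \<in> cball z0 r - {z0} \<Longrightarrow> P w = g w * (w - z0) powi N \<and> g w \<noteq> 0"
    using zorder_exist[of P z0] unfolding N_def g_def by blast
  let ?D = "ball z0 r - {z0}"
  define k where "k w = deriv g w / g w" for w
  have gh: "g holomorphic_on ball z0 r" using r(2) by (rule holomorphic_on_subset) auto
  have gnz: "g w \<noteq> 0" if "w \<in> ball z0 r" for w using that r by (cases "w = z0") auto
  have kh: "k holomorphic_on ball z0 r"
    unfolding k_def using gh gnz by (intro holomorphic_intros holomorphic_deriv) auto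
  \<comment> \<open>The logarithmic derivative h'' / h', in terms of which the Schwarzian is l' -
    l^2 / 2.\<close>
  define l where "l w = of_int N / (w - z0) + k w" for w
  define l' where "l' w = - of_int N / (w - z0)\<^sup>2 + deriv k w" for w
  have oD: "open ?D" by (simp add: open_delete)
  have Pd: "(P has_field_derivative l w * P w) (at w)" if w: "w \<in> ?D" for w
  proof -
    have "w \<noteq> z0" "w \<in> ball z0 r" using w by auto
    have "((\<lambda>w. g w * (w - z0) powi N) has_field_derivative
        deriv g w * (w - z0) powi N + (of_int N * (w - z0) powi (N - 1) * 1) * g w) (at w)"
      using \<open>w \<noteq> z0\<close> holomorphic_derivI[OF gh _ \<open>w \<in> ball z0 r\<close>]
      by (intro DERIV_mult DERIV_power_int[THEN DERIV_cong]) (auto intro!: derivative_eq_intros)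
    moreover have "deriv g w * (w - z0) powi N + (of_int N * (w - z0) powi (N - 1) * 1) * g w = l w * P w"
      using r(4)[of w] w gnz[of w] \<open>w \<noteq> z0\<close> by (auto simp: l_def k_def power_int_diff field_simps)
    ultimately have "((\<lambda>w. g w * (w - z0) powi N) has_field_derivative l w * P w) (at w)" by simp
    then show ?thesis
      by (rule has_field_derivative_transform_within_open[OF _ oD w]) (use r(4) in auto)
  qed
  have ld: "(l has_field_derivative l' w) (at w)" if w: "w \<in> ?D" for w
  proof -
    have "(k has_field_derivative deriv k w) (at w)"
      using holomorphic_derivI[OF kh _ , of w] w by auto
    then show ?thesis unfolding l_def[abs_def] l'_def using w
      by (auto intro!: derivative_eq_intros simp: power2_eq_square)
  qed
  have d1: "deriv P w = l w * P w" if "w \<in> ?D" for w using Pd[OF that] by (rule DERIV_imp_deriv)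
  have d2: "deriv (deriv P) w = (l' w + (l w)\<^sup>2) * P w" if w: "w \<in> ?D" for w
  proof (rule DERIV_imp_deriv, rule has_field_derivative_transform_within_open[OF _ oD w])
    show "((\<lambda>w. l w * P w) has_field_derivative (l' w + (l w)\<^sup>2) * P w) (at w)"
      by (rule DERIV_cong[OF DERIV_mult[OF ld[OF w] Pd[OF w]]]) (simp add: power2_eq_square algebra_simps)
  qed (use d1 in auto)
  have S: "schwarzian h w = l' w - (l w)\<^sup>2 / 2" if w: "w \<in> ?D" "P w \<noteq> 0" for w
  proof -
    have "(deriv ^^ 3) h w = deriv (deriv P) w" "(deriv ^^ 2) h w = deriv P w"
      by (simp_all add: P_def eval_nat_numeral)
    then have "schwarzian h w = (l' w + (l w)\<^sup>2) - 3 / 2 * (l w)\<^sup>2"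
      unfolding schwarzian_def using d1[OF w(1)] d2[OF w(1)] w(2) by (simp add: P_def)
    then show ?thesis by (simp add: field_simps)
  qed
  have ev2: "\<forall>\<^sub>F w in at z0. w \<in> ?D" using eventually_at_in_open[OF open_ball, of z0 z0 r] r(1) by simp
  have "\<forall>\<^sub>F w in at z0. (w - z0)\<^sup>2 * G w =
      - of_int N + (w - z0)\<^sup>2 * deriv k w - (of_int N + (w - z0) * k w)\<^sup>2 / 2"
    using ev ev2
  proof eventually_elim
    case (elim w)
    then have "G w = l' w - (l w)\<^sup>2 / 2" using S[of w] by (auto simp: P_def)
    moreover have "(w - z0)\<^sup>2 * l' w = - of_int N + (w - z0)\<^sup>2 * deriv k w" "(w - z0) * l w = of_int N + (w - z0) * k w"
      using elim by (auto simp: l'_def l_def distrib_left right_diff_distrib)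
    ultimately show ?case by (metis power_mult_distrib right_diff_distrib times_divide_eq_right)
  qed
  moreover have "((\<lambda>w. - of_int N + (w - z0)\<^sup>2 * deriv k w - (of_int N + (w - z0) * k w)\<^sup>2 / 2) \<longlongrightarrow>
      - of_int N + (z0 - z0)\<^sup>2 * deriv k z0 - (of_int N + (z0 - z0) * k z0)\<^sup>2 / 2) (at z0)"
  proof -
    have "isCont k z0" "isCont (deriv k) z0"
      using kh holomorphic_deriv[OF kh] r(1)
      by (auto intro!: continuous_on_interior[of "ball z0 r"] holomorphic_on_imp_continuous_on)
    then show ?thesis by (intro tendsto_intros) (auto simp: isCont_def)
  qed
  ultimately have "((\<lambda>w. (w - z0)\<^sup>2 * G w) \<longlongrightarrow> - of_int N - (of_int N)\<^sup>2 / 2) (at z0)"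
    by (simp add: tendsto_cong)
  with G have "- of_int N - (of_int N)\<^sup>2 / 2 = (0 :: complex)"
    using tendsto_unique[OF at_neq_bot] by blast
  moreover have "of_int (N * (N + 2)) = - 2 * (- of_int N - (of_int N)\<^sup>2 / 2 :: complex)"
    by (simp add: power2_eq_square algebra_simps)
  ultimately have "of_int (N * (N + 2)) = (0 :: complex)" by (simp only: mult_zero_right)
  \<comment> \<open>The root 0 makes h' finite and nonzero; the root -2 belongs to a simple pole of
    \<open>h\<close>.\<close>
  then have "N * (N + 2) = 0" by (simp only: of_int_eq_0_iff)
  then show ?thesis unfolding N_def P_def by auto
qed

definition sphere_valued :: "(complex \<Rightarrow> complex) \<Rightarrow> complex \<Rightarrow> complex option" where
  "sphere_valued h z = (if is_pole h z then None else Some (h z))"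

locale schwarzian_solution =
  fixes s :: complex and h :: "complex \<Rightarrow> complex"
  assumes solves: "solves_schwarzian_E4 s h"
begin

abbreviation "hv \<equiv> sphere_valued h"

lemma nice: "h nicely_meromorphic_on upper_half_plane"
  using solves by (simp add: solves_schwarzian_E4_def)

lemma mero: "h meromorphic_on upper_half_plane"
  using nice by (simp add: nicely_meromorphic_on_def)

lemma analytic: "Im z > 0 \<Longrightarrow> \<not> is_pole h z \<Longrightarrow> h analytic_on {z}"
  using nicely_meromorphic_on_imp_analytic_at[OF nice] by auto

lemma eventually_schwarzian:
  assumes "Im z > 0"
  shows "\<forall>\<^sub>F w in at z. deriv h w \<noteq> 0 \<and> schwarzian h w = s * E4 w"
  using solves assms unfolding solves_schwarzian_E4_def
  by (auto intro: eventually_cosparse_imp_eventually_at)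

lemma zorder_deriv:
  assumes "Im z > 0"
  shows "zorder (deriv h) z = 0 \<or> zorder (deriv h) z = - 2"
proof (rule zorder_deriv_if_schwarzian_bounded[OF _ eventually_schwarzian[OF assms]])
  show "h meromorphic_on {z}" using mero by (rule meromorphic_on_subset) (use assms in auto)
  have "(E4 \<longlongrightarrow> E4 z) (at z)" using isCont_E4[OF assms] by (simp add: isCont_def)
  then have "((\<lambda>w. (w - z)\<^sup>2 * (s * E4 w)) \<longlongrightarrow> (z - z)\<^sup>2 * (s * E4 z)) (at z)"
    by (intro tendsto_intros)
  then show "((\<lambda>w. (w - z)\<^sup>2 * (s * E4 w)) \<longlongrightarrow> 0) (at z)" by simp
qed

lemma deriv_nonconstant:
  assumes "Im z > 0"
  shows "\<exists>\<^sub>F w in at z. deriv h w \<noteq> 0"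
proof -
  have "\<forall>\<^sub>F w in at z. deriv h w \<noteq> 0"
    by (rule eventually_mono[OF eventually_schwarzian[OF assms]]) simp
  then show ?thesis by (intro eventually_frequently) simp_all
qed

text \<open>The order -2 would make z a pole of h', hence of \<open>h\<close>; so h' has order 0 and
  does not vanish.\<close>

lemma deriv_nonzero:
  assumes z: "Im z > 0" "\<not> is_pole h z"
  shows "deriv h z \<noteq> 0"
proof -
  have m: "h meromorphic_on {z}" using mero by (rule meromorphic_on_subset) (use z in auto)
  then have md: "deriv h meromorphic_on {z}" by (rule meromorphic_on_deriv)
  have ad: "deriv h analytic_on {z}" using analytic[OF z] by (rule analytic_deriv)
  have "\<not> is_pole (deriv h) z" using is_pole_deriv_iff[OF m] z by simp
  moreover have "\<forall>\<^sub>F w in at z. deriv h w \<noteq> 0"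
    by (rule eventually_mono[OF eventually_schwarzian[OF z(1)]]) simp
  ultimately have "zorder (deriv h) z \<noteq> - 2" using zorder_neg_imp_is_pole[OF md] by fastforce
  then have "zorder (deriv h) z = 0" using zorder_deriv[OF z(1)] by blast
  show ?thesis
  proof
    assume "deriv h z = 0"
    obtain e where e: "e > 0" "deriv h holomorphic_on ball z e" using ad by (auto simp: analytic_on_def)
    have "\<exists>w\<in>ball z e. deriv h w \<noteq> 0"
    proof (rule ccontr)
      assume "\<not> ?thesis"
      then have "\<forall>\<^sub>F w in at z. \<not> deriv h w \<noteq> 0"
        using eventually_at_ball[OF e(1), of z UNIV] by (auto elim: eventually_mono)
      then show False using deriv_nonconstant[OF z(1)] by (simp add: frequently_def)
    qed
    then have "zorder (deriv h) z > 0"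
      using zorder_exist_zero[OF e(2)] \<open>deriv h z = 0\<close> e(1) by auto
    then show False using \<open>zorder (deriv h) z = 0\<close> by simp
  qed
qed

text \<open>At a pole of \<open>h\<close> the order of h' can only be -2, so \<open>h\<close> has
  order -1. The dummy value 0 of \<open>h\<close> fits in well: \<open>inverse 0 = 0\<close> is the
  correct value of 1/h at the pole.\<close>

lemma inverse_simple_zero:
  assumes z: "Im z > 0" "is_pole h z"
  shows "(\<lambda>w. inverse (h w)) analytic_on {z}" "deriv (\<lambda>w. inverse (h w)) z \<noteq> 0" "h z = 0"
proof -
  let ?k = "\<lambda>w. inverse (h w)"
  have m: "h meromorphic_on {z}" using mero by (rule meromorphic_on_subset) (use z in auto)
  then have iso: "isolated_singularity_at h z" "not_essential h z" by (auto simp: meromorphic_at_iff)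
  show hz: "h z = 0" using is_pole_zero_at_nicely_mero[OF nice z(2)] z by simp
  have "\<not> isolated_zero h z"
    using z(2) pole_is_not_zero by (metis (no_types, lifting) isolated_zero_def at_neq_bot is_pole_def not_tendsto_and_filterlim_at_infinity)
  then have "\<not> is_pole ?k z" by (simp add: is_pole_inverse_iff)
  moreover have "?k nicely_meromorphic_on upper_half_plane" by (rule nicely_meromorphic_on_inverse[OF nice])
  ultimately show an: "?k analytic_on {z}" using nicely_meromorphic_on_imp_analytic_at z(1) by blast
  have nc: "\<exists>\<^sub>F w in at z. h w \<noteq> 0"
    using non_zero_neighbour_pole[OF z(2)] by (intro eventually_frequently) auto
  have "is_pole (deriv h) z" using is_pole_deriv_iff[OF m] z by simp
  moreover have "isolated_singularity_at (deriv h) z" "not_essential (deriv h) z"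
    using meromorphic_on_deriv[OF m] by (auto simp: meromorphic_at_iff)
  ultimately have "zorder (deriv h) z < 0" using isolated_pole_imp_neg_zorder by blast
  then have "zorder (deriv h) z = - 2" using zorder_deriv[OF z(1)] by auto
  moreover have "zorder h z < 0" using isolated_pole_imp_neg_zorder[OF iso(1) z(2)] .
  ultimately have "zorder h z = - 1" using zorder_deriv_minus_1[OF iso nc] by simp
  then have zk: "zorder ?k z = 1" using zorder_inverse[OF iso nc] by simp
  show "deriv ?k z \<noteq> 0"
  proof -
    obtain e where e: "e > 0" "?k holomorphic_on ball z e" using an by (auto simp: analytic_on_def)
    have "\<exists>w\<in>ball z e. ?k w \<noteq> 0"
    proof -
      have "\<forall>\<^sub>F w in at z. w \<in> ball z e" using e(1) eventually_at_in_open'[of "ball z e" z] by simp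
      with nc have "\<exists>\<^sub>F w in at z. h w \<noteq> 0 \<and> w \<in> ball z e" by (rule frequently_eventually_frequently)
      then show ?thesis using frequently_ex by fastforce
    qed
    then obtain r where r: "r > 0" "cball z r \<subseteq> ball z e" "zor_poly ?k z holomorphic_on cball z r"
      "\<And>w. w \<in> cball z r \<Longrightarrow> ?k w = zor_poly ?k z w * (w - z) \<and> zor_poly ?k z w \<noteq> 0"
      using zorder_exist_zero[OF e(2), of z] e(1) unfolding zk by auto
    let ?m = "zor_poly ?k z"
    have "?m holomorphic_on ball z r" using r(3) by (rule holomorphic_on_subset) auto
    then have "(?m has_field_derivative deriv ?m z) (at z)" using holomorphic_derivI[of ?m "ball z r" z] r(1) by simp
    then have "((\<lambda>w. ?m w * (w - z)) has_field_derivative ?m z) (at z)"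
      by (auto intro!: derivative_eq_intros)
    then have "(?k has_field_derivative ?m z) (at z)"
      by (rule has_field_derivative_transform_within_open[of _ _ _ "ball z r"]) (use r in auto)
    then have "deriv ?k z = ?m z" by (rule DERIV_imp_deriv)
    then show ?thesis using r(1) r(4)[of z] by simp
  qed
qed

text \<open>One local form for regular points and poles: an injective holomorphic function followed
  by a Moebius map, which is the identity or z -> 1/z. Later arguments need not single out the
  poles.\<close>

lemma local_chart:
  assumes z: "Im z > 0"
  obtains \<mu> k r where "\<mu> \<in> Mob" "r > 0" "ball z r \<subseteq> upper_half_plane" "k holomorphic_on ball z r"
    "inj_on k (ball z r)" "\<And>w. w \<in> ball z r \<Longrightarrow> hv w = \<mu> (Some (k w))"
proof (cases "is_pole h z")
  case False
  obtain e where e: "e > 0" "h holomorphic_on ball z e" using analytic[OF z False] by (auto simp: analytic_on_def)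
  have o: "open (ball z e \<inter> upper_half_plane)" by (intro open_Int open_ball open_halfspace_Im_gt)
  have "h holomorphic_on (ball z e \<inter> upper_half_plane)" using e(2) by (rule holomorphic_on_subset) auto
  from has_complex_derivative_locally_injective[OF this _ o deriv_nonzero[OF z False]] z e(1)
  obtain r where r: "r > 0" "ball z r \<subseteq> ball z e \<inter> upper_half_plane" "inj_on h (ball z r)" by auto
  have "hv w = id (Some (h w))" if "w \<in> ball z r" for w
  proof -
    have "h analytic_on {w}" using e(2) that r(2) analytic_at_ball by (metis (no_types, lifting) IntD1 analytic_at holomorphic_on_subset open_ball subset_iff)
    then have "\<not> is_pole h w" by (metis analytic_at_imp_no_pole)
    then show ?thesis by (simp add: sphere_valued_def)
  qed
  moreover have "h holomorphic_on ball z r" using e(2) by (rule holomorphic_on_subset) (use r in auto)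
  ultimately show ?thesis using that[of id r h] id_in_Mob r by blast
next
  case True
  let ?k = "\<lambda>w. inverse (h w)"
  note k = inverse_simple_zero[OF z True]
  obtain e where e: "e > 0" "?k holomorphic_on ball z e" using k(1) by (auto simp: analytic_on_def)
  have o: "open (ball z e \<inter> upper_half_plane)" by (intro open_Int open_ball open_halfspace_Im_gt)
  have "?k holomorphic_on (ball z e \<inter> upper_half_plane)" using e(2) by (rule holomorphic_on_subset) auto
  from has_complex_derivative_locally_injective[OF this _ o k(2)] z e(1)
  obtain r where r: "r > 0" "ball z r \<subseteq> ball z e \<inter> upper_half_plane" "inj_on ?k (ball z r)" by auto
  have "hv w = mob 0 1 1 0 (Some (?k w))" if w: "w \<in> ball z r" for w
  proof (cases "w = z")
    case True
    then show ?thesis using \<open>is_pole h z\<close> k(3) by (simp add: sphere_valued_def mob_def proj_def)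
  next
    case False
    have "?k w \<noteq> ?k z" using r w False by (metis centre_in_ball inj_onD)
    then have "h w \<noteq> 0" using k(3) by auto
    then have "\<not> is_pole h w" using is_pole_zero_at_nicely_mero[OF nice] w r(2) by blast
    then show ?thesis using \<open>h w \<noteq> 0\<close> by (simp add: sphere_valued_def mob_def proj_def divide_inverse)
  qed
  moreover have "mob 0 1 1 0 \<in> Mob" by (rule Mob_I) simp
  moreover have "?k holomorphic_on ball z r" using e(2) by (rule holomorphic_on_subset) (use r in auto)
  ultimately show ?thesis using that[of "mob 0 1 1 0" r ?k] r by blast
qed

lemma continuous_on_mob_hv:
  assumes "\<mu> \<in> Mob"
  shows "continuous_on upper_half_plane (\<lambda>z. stereo (\<mu> (hv z)))"
proof (intro continuous_at_imp_continuous_on ballI)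
  fix z assume "z \<in> upper_half_plane"
  then have "Im z > 0" by simp
  from local_chart[OF this] obtain \<nu> k r where c: "\<nu> \<in> Mob" "r > 0" "k holomorphic_on ball z r"
    "\<And>w. w \<in> ball z r \<Longrightarrow> hv w = \<nu> (Some (k w))" by metis
  have "continuous_on (ball z r) (\<lambda>w. stereo ((\<mu> \<circ> \<nu>) (Some (k w))))"
    by (rule continuous_on_compose2[OF continuous_chart[OF Mob_comp[OF assms c(1)]] holomorphic_on_imp_continuous_on[OF c(3)]]) simp
  then have "continuous_on (ball z r) (\<lambda>w. stereo (\<mu> (hv w)))"
    by (rule continuous_on_eq) (simp add: c(4))
  then show "isCont (\<lambda>z. stereo (\<mu> (hv z))) z"
    using c(2) continuous_on_eq_continuous_at[OF open_ball] centre_in_ball by blast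
qed

end

section \<open>The Moebius relation between \<open>h\<close> and its translates\<close>

lemma open_ball_avoiding:
  assumes "eventually P (at (z :: complex))"
  obtains c r where "r > 0" "\<And>w. w \<in> ball c r \<Longrightarrow> P w"
proof -
  obtain d where d: "d > 0" "\<And>w. w \<noteq> z \<Longrightarrow> dist w z < d \<Longrightarrow> P w" using assms by (auto simp: eventually_at)
  have "open (ball z d - {z})" by (simp add: open_delete)
  \<comment> \<open>A property that holds near z may fail at z itself, so the ball is centred at a
    neighbouring point.\<close>
  moreover have "z + of_real (d / 2) \<in> ball z d - {z}" using d(1) by (simp add: dist_norm)
  ultimately obtain r where "r > 0" "ball (z + of_real (d / 2)) r \<subseteq> ball z d - {z}"
    using open_contains_ball by metis
  moreover have "P w" if "w \<in> ball z d - {z}" for w using d(2)[of w] that by (simp add: dist_commute)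
  ultimately show ?thesis using that by blast
qed

lemma wronskian_constant:
  fixes f g :: "complex \<Rightarrow> complex"
  assumes "convex D"
    and "\<And>w. w \<in> D \<Longrightarrow> (f has_field_derivative f' w) (at w)"
    and "\<And>w. w \<in> D \<Longrightarrow> (g has_field_derivative g' w) (at w)"
    and "\<And>w. w \<in> D \<Longrightarrow> (f' has_field_derivative K w * f w) (at w)"
    and "\<And>w. w \<in> D \<Longrightarrow> (g' has_field_derivative K w * g w) (at w)"
  obtains C where "\<And>w. w \<in> D \<Longrightarrow> f w * g' w - g w * f' w = C"
proof -
  have "((\<lambda>w. f w * g' w - g w * f' w) has_field_derivative 0) (at w within D)" if "w \<in> D" for w
  proof -
    have "((\<lambda>w. f w * g' w - g w * f' w) has_field_derivative
        (f' w * g' w + K w * g w * f w) - (g' w * f' w + K w * f w * g w)) (at w)"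
      by (intro DERIV_diff DERIV_mult assms that)
    then show ?thesis by (simp add: algebra_simps has_field_derivative_at_within)
  qed
  from has_field_derivative_zero_constant[OF assms(1) this] show ?thesis using that by blast
qed

context schwarzian_solution
begin

definition regular_at :: "complex \<Rightarrow> bool" where
  "regular_at w \<longleftrightarrow> Im w > 0 \<and> h analytic_on {w} \<and> deriv h w \<noteq> 0 \<and> schwarzian h w = s * E4 w"

lemma eventually_regular:
  assumes "Im z > 0"
  shows "eventually regular_at (at z)"
proof -
  have "\<forall>\<^sub>F w in cosparse upper_half_plane. h analytic_on {w}"
    by (rule meromorphic_on_imp_analytic_cosparse[OF mero])
  then have "\<forall>\<^sub>F w in at z. h analytic_on {w}" using assms by (auto intro: eventually_cosparse_imp_eventually_at)
  moreover have "\<forall>\<^sub>F w in at z. Im w > 0"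
    using eventually_at_in_open'[OF open_halfspace_Im_gt, of z 0] assms by simp
  ultimately show ?thesis using eventually_schwarzian[OF assms]
    by eventually_elim (simp add: regular_at_def)
qed

text \<open>\<open>u = (c w + d) / sqrt (h' (\<gamma> w))\<close> solves the linear equation \<open>u'' = - (s / 2) E4 u\<close> because
  \<open>E4\<close> has weight 4.\<close>

lemma linear_solution:
  assumes \<gamma>: "\<gamma> \<in> carrier SL2Z" and D: "convex D" "open D" "D \<subseteq> upper_half_plane" "D \<noteq> {}"
    and reg: "\<And>w. w \<in> D \<Longrightarrow> regular_at (moebius \<gamma> w)"
  obtains u u' where "\<And>w. w \<in> D \<Longrightarrow> u w \<noteq> 0"
    "\<And>w. w \<in> D \<Longrightarrow> (u has_field_derivative u' w) (at w)"
    "\<And>w. w \<in> D \<Longrightarrow> (u' has_field_derivative (- (s / 2) * E4 w) * u w) (at w)"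
    "\<And>w. w \<in> D \<Longrightarrow> ((\<lambda>w. h (moebius \<gamma> w)) has_field_derivative 1 / (u w)\<^sup>2) (at w)"
proof -
  let ?J = "automorphy \<gamma>"
  define c where "c = complex_of_int (\<gamma> $ 2 $ 1)"
  define f0 where "f0 w = deriv h (moebius \<gamma> w)" for w
  define f1 where "f1 w = deriv (deriv h) (moebius \<gamma> w)" for w
  define f2 where "f2 w = deriv (deriv (deriv h)) (moebius \<gamma> w)" for w
  define R where "R w = f1 w / f0 w" for w
  have pos: "Im w > 0" if "w \<in> D" for w using that D by auto
  have J: "?J w \<noteq> 0" if "w \<in> D" for w using automorphy_nonzero[OF \<gamma> pos[OF that]] .
  have f0: "f0 w \<noteq> 0" if "w \<in> D" for w using reg[OF that] by (simp add: f0_def regular_at_def)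
  have chain: "((\<lambda>w. f (moebius \<gamma> w)) has_field_derivative deriv f (moebius \<gamma> w) / (?J w)\<^sup>2) (at w)"
    if "f analytic_on {moebius \<gamma> w}" "w \<in> D" for f w
  proof -
    have "(f has_field_derivative deriv f (moebius \<gamma> w)) (at (moebius \<gamma> w))"
      using that(1) by (simp add: analytic_on_imp_differentiable_at DERIV_deriv_iff_field_differentiable)
    from DERIV_chain2[OF this moebius_has_field_derivative[OF \<gamma> pos[OF that(2)]]] show ?thesis by simp
  qed
  have an: "h analytic_on {moebius \<gamma> w}" if "w \<in> D" for w using reg[OF that] by (simp add: regular_at_def)
  have dh: "((\<lambda>w. h (moebius \<gamma> w)) has_field_derivative f0 w / (?J w)\<^sup>2) (at w)" if "w \<in> D" for w
    unfolding f0_def using chain[OF an that] that by blast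
  have d0: "(f0 has_field_derivative f1 w / (?J w)\<^sup>2) (at w)" if "w \<in> D" for w
    unfolding f0_def f1_def using chain[OF analytic_deriv[OF an] that] that by blast
  have d1: "(f1 has_field_derivative f2 w / (?J w)\<^sup>2) (at w)" if "w \<in> D" for w
    unfolding f2_def f1_def using chain[OF analytic_deriv[OF analytic_deriv[OF an]] that] that by blast
  have dJ: "(?J has_field_derivative c) (at w)" for w
    unfolding automorphy_def c_def by (auto intro!: derivative_eq_intros)
  \<comment> \<open>Solved for the third derivative, the Schwarzian equation is a Riccati equation
    for h'' / h'; composition with \<gamma> adds the factor 1 / J^2.\<close>
  have dR: "(R has_field_derivative (s * E4 (moebius \<gamma> w) + (R w)\<^sup>2 / 2) / (?J w)\<^sup>2) (at w)" if w: "w \<in> D" for w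
  proof -
    have "(deriv ^^ 3) h = deriv (deriv (deriv h))" "(deriv ^^ 2) h = deriv (deriv h)" by (simp_all add: eval_nat_numeral)
    then have "f2 w / f0 w - 3 / 2 * (R w)\<^sup>2 = s * E4 (moebius \<gamma> w)"
      using reg[OF w] by (simp add: regular_at_def schwarzian_def R_def f0_def f1_def f2_def)
    then have e: "s * E4 (moebius \<gamma> w) + (R w)\<^sup>2 / 2 = f2 w / f0 w - (R w)\<^sup>2" by (simp add: field_simps)
    have "((\<lambda>w. f1 w / f0 w) has_field_derivative
       (f2 w / (?J w)\<^sup>2 * f0 w - f1 w * (f1 w / (?J w)\<^sup>2)) / (f0 w * f0 w)) (at w)"
      by (rule DERIV_divide[OF d1[OF w] d0[OF w] f0[OF w]])
    moreover have "(f2 w / (?J w)\<^sup>2 * f0 w - f1 w * (f1 w / (?J w)\<^sup>2)) / (f0 w * f0 w) =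
        (f2 w / f0 w - (R w)\<^sup>2) / (?J w)\<^sup>2"
      using J[OF w] f0[OF w] by (simp add: R_def field_simps power2_eq_square)
    ultimately have "((\<lambda>w. f1 w / f0 w) has_field_derivative (f2 w / f0 w - (R w)\<^sup>2) / (?J w)\<^sup>2) (at w)"
      by (simp only:)
    then show ?thesis unfolding e by (simp only: R_def[abs_def])
  qed
  \<comment> \<open>On a convex set the zero-free function \<open>f0\<close> has a logarithm, hence
    \<open>q\<close> is a holomorphic branch of 1 / sqrt f0.\<close>
  have "f0 holomorphic_on D" unfolding holomorphic_on_open[OF D(2)] using d0 by blast
  moreover obtain z0 where "z0 \<in> D" using D(4) by blast
  ultimately obtain L where L: "L holomorphic_on D" "\<And>w. w \<in> D \<Longrightarrow> exp (L w) = f0 w"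
    using holomorphic_logarithm_exists[OF D(1,2), of f0 z0] f0 by metis
  define q where "q w = exp (- L w / 2)" for w
  have dq: "(q has_field_derivative - R w / (2 * (?J w)\<^sup>2) * q w) (at w)" if w: "w \<in> D" for w
  proof -
    have dL: "(L has_field_derivative deriv L w) (at w)" using holomorphic_derivI[OF L(1) D(2) w] .
    then have "((\<lambda>w. exp (L w)) has_field_derivative exp (L w) * deriv L w) (at w)"
      by (auto intro!: derivative_eq_intros)
    then have "(f0 has_field_derivative exp (L w) * deriv L w) (at w)"
      by (rule has_field_derivative_transform_within_open[OF _ D(2) w]) (use L in auto)
    with d0[OF w] have "f0 w * deriv L w = f1 w / (?J w)\<^sup>2" using DERIV_unique L(2)[OF w] by metis
    then have "deriv L w = R w / (?J w)\<^sup>2" using f0[OF w] J[OF w] by (simp add: R_def field_simps)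
    moreover have "(q has_field_derivative - (deriv L w) / 2 * q w) (at w)"
      unfolding q_def[abs_def] using dL by (auto intro!: derivative_eq_intros)
    ultimately show ?thesis by (simp add: mult_ac)
  qed
  have q2: "(q w)\<^sup>2 = 1 / f0 w" if "w \<in> D" for w
  proof -
    have "(q w)\<^sup>2 = exp (- L w)" unfolding q_def exp_double[symmetric] by simp
    also have "\<dots> = 1 / f0 w" using L(2)[OF that] by (simp add: exp_minus divide_inverse)
    finally show ?thesis .
  qed
  define u where "u w = ?J w * q w" for w
  define u' where "u' w = c * q w - R w * q w / (2 * ?J w)" for w
  show ?thesis
  proof
    fix w assume w: "w \<in> D"
    note Jw = J[OF w]
    show "u w \<noteq> 0" using Jw by (simp add: u_def q_def)
    show "(u has_field_derivative u' w) (at w)"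
      unfolding u_def[abs_def]
      by (rule DERIV_cong[OF DERIV_mult[OF dJ dq[OF w]]])
         (use Jw in \<open>simp add: u'_def field_simps power2_eq_square\<close>)
    show "((\<lambda>w. h (moebius \<gamma> w)) has_field_derivative 1 / (u w)\<^sup>2) (at w)"
      by (rule DERIV_cong[OF dh[OF w]]) (use Jw f0[OF w] in \<open>simp add: u_def power_mult_distrib q2[OF w]\<close>)
    have "moebius \<gamma> w = (of_int (\<gamma> $ 1 $ 1) * w + of_int (\<gamma> $ 1 $ 2)) / ?J w"
      by (simp add: moebius_def automorphy_def)
    moreover have "\<gamma> $ 1 $ 1 * \<gamma> $ 2 $ 2 - \<gamma> $ 1 $ 2 * \<gamma> $ 2 $ 1 = 1" using \<gamma> by (simp add: SL2Z_def det_2)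
    ultimately have E: "E4 (moebius \<gamma> w) = ?J w ^ 4 * E4 w"
      using E4_modular[OF pos[OF w], of "\<gamma> $ 1 $ 1" "\<gamma> $ 2 $ 2" "\<gamma> $ 1 $ 2" "\<gamma> $ 2 $ 1" "moebius \<gamma> w"]
        Im_moebius_pos[OF \<gamma> pos[OF w]] Jw by (simp add: automorphy_def)
    have "(u' has_field_derivative
        c * (- R w / (2 * (?J w)\<^sup>2) * q w) -
        ((((s * E4 (moebius \<gamma> w) + (R w)\<^sup>2 / 2) / (?J w)\<^sup>2) * q w + (- R w / (2 * (?J w)\<^sup>2) * q w) * R w) * (2 * ?J w)
          - (R w * q w) * (2 * c)) / ((2 * ?J w) * (2 * ?J w))) (at w)"
      unfolding u'_def[abs_def]
      by (intro DERIV_diff DERIV_cmult DERIV_divide DERIV_mult dR dq w dJ) (use Jw in auto)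
    \<comment> \<open>The terms with \<open>c\<close> and those with R^2 cancel. What remains is -
      (s/2) E4(\<gamma> w) q / J^3; weight 4 turns J^(-3) into J, and J q is
      \<open>u\<close>.\<close>
    moreover have "c * (- R w / (2 * (?J w)\<^sup>2) * q w) -
        ((((s * E4 (moebius \<gamma> w) + (R w)\<^sup>2 / 2) / (?J w)\<^sup>2) * q w + (- R w / (2 * (?J w)\<^sup>2) * q w) * R w) * (2 * ?J w)
          - (R w * q w) * (2 * c)) / ((2 * ?J w) * (2 * ?J w)) = (- (s / 2) * E4 w) * u w"
      unfolding E u_def using Jw by (simp add: field_simps power2_eq_square power4_eq_xxxx)
    ultimately show "(u' has_field_derivative (- (s / 2) * E4 w) * u w) (at w)" by simp
  qed
qed

text \<open>If u is the solution belonging to \<open>h\<close>, then u and h u are a basis of the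
  solutions of the linear equation, with Wronskian 1. The same equation has a second such basis from
  h o \<gamma>. The coefficients of the change of basis are Wronskians, hence constants, and the
  quotient of the two basis elements transforms by a Moebius map.\<close>

lemma local_moebius_relation:
  assumes \<gamma>: "\<gamma> \<in> carrier SL2Z" and D: "convex D" "open D" "D \<subseteq> upper_half_plane" "D \<noteq> {}"
    and reg: "\<And>w. w \<in> D \<Longrightarrow> regular_at w" "\<And>w. w \<in> D \<Longrightarrow> regular_at (moebius \<gamma> w)"
  obtains a b c d where "a * d - b * c \<noteq> 0"
    "\<And>w. w \<in> D \<Longrightarrow> h (moebius \<gamma> w) * (c * h w + d) = a * h w + b"
proof -
  have id: "moebius (mat 1) w = w" for w by (simp add: mat_1_eq moebius_def)
  obtain u1 u1' where u1: "\<And>w. w \<in> D \<Longrightarrow> u1 w \<noteq> 0"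
    "\<And>w. w \<in> D \<Longrightarrow> (u1 has_field_derivative u1' w) (at w)"
    "\<And>w. w \<in> D \<Longrightarrow> (u1' has_field_derivative (- (s / 2) * E4 w) * u1 w) (at w)"
    "\<And>w. w \<in> D \<Longrightarrow> (h has_field_derivative 1 / (u1 w)\<^sup>2) (at w)"
    using linear_solution[OF one_in_SL2Z D] reg(1) unfolding id by blast
  define g where "g w = h (moebius \<gamma> w)" for w
  obtain u2 u2' where u2: "\<And>w. w \<in> D \<Longrightarrow> u2 w \<noteq> 0"
    "\<And>w. w \<in> D \<Longrightarrow> (u2 has_field_derivative u2' w) (at w)"
    "\<And>w. w \<in> D \<Longrightarrow> (u2' has_field_derivative (- (s / 2) * E4 w) * u2 w) (at w)"
    "\<And>w. w \<in> D \<Longrightarrow> (g has_field_derivative 1 / (u2 w)\<^sup>2) (at w)"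
    using linear_solution[OF \<gamma> D reg(2)] unfolding g_def[abs_def] by blast
  \<comment> \<open>Reduction of order: for a solution u of u'' = K u and f' = 1 / u^2, the product
    f u is a second solution. Its derivative is written out so that it can be differentiated
    again.\<close>
  have v: "((\<lambda>w. f w * u w) has_field_derivative (1 / u w + f w * u' w)) (at w) \<and>
      ((\<lambda>w. 1 / u w + f w * u' w) has_field_derivative K * (f w * u w)) (at w)"
    if "u w \<noteq> 0" "(u has_field_derivative u' w) (at w)" "(u' has_field_derivative K * u w) (at w)"
       "(f has_field_derivative 1 / (u w)\<^sup>2) (at w)" for f u u' K and w :: complex
  proof
    show "((\<lambda>w. f w * u w) has_field_derivative (1 / u w + f w * u' w)) (at w)"
      by (rule DERIV_cong[OF DERIV_mult[OF that(4,2)]]) (use that(1) in \<open>simp add: power2_eq_square\<close>)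
    have "((\<lambda>w. 1 / u w + f w * u' w) has_field_derivative
        (0 * u w - 1 * u' w) / (u w * u w) + (1 / (u w)\<^sup>2 * u' w + K * u w * f w)) (at w)"
      by (intro DERIV_add DERIV_divide DERIV_mult DERIV_const that)
    then show "((\<lambda>w. 1 / u w + f w * u' w) has_field_derivative K * (f w * u w)) (at w)"
      by (rule DERIV_cong) (use that(1) in \<open>simp add: power2_eq_square\<close>)
  qed
  define v1 where "v1 w = h w * u1 w" for w
  define v1' where "v1' w = 1 / u1 w + h w * u1' w" for w
  define v2 where "v2 w = g w * u2 w" for w
  define v2' where "v2' w = 1 / u2 w + g w * u2' w" for w
  have v1: "(v1 has_field_derivative v1' w) (at w)"
    "(v1' has_field_derivative (- (s / 2) * E4 w) * v1 w) (at w)" if "w \<in> D" for w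
    using v[of u1 w u1' "- (s / 2) * E4 w" h] u1 that unfolding v1_def[abs_def] v1'_def[abs_def] by blast+
  have v2: "(v2 has_field_derivative v2' w) (at w)"
    "(v2' has_field_derivative (- (s / 2) * E4 w) * v2 w) (at w)" if "w \<in> D" for w
    using v[of u2 w u2' "- (s / 2) * E4 w" g] u2 that unfolding v2_def[abs_def] v2'_def[abs_def] by blast+
  obtain C1 where C1: "\<And>w. w \<in> D \<Longrightarrow> u2 w * v1' w - v1 w * u2' w = C1"
    using wronskian_constant[OF D(1) u2(2) v1(1) u2(3) v1(2)] by blast
  obtain C2 where C2: "\<And>w. w \<in> D \<Longrightarrow> u1 w * u2' w - u2 w * u1' w = C2"
    using wronskian_constant[OF D(1) u1(2) u2(2) u1(3) u2(3)] by blast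
  obtain C3 where C3: "\<And>w. w \<in> D \<Longrightarrow> v2 w * v1' w - v1 w * v2' w = C3"
    using wronskian_constant[OF D(1) v2(1) v1(1) v2(2) v1(2)] by blast
  obtain C4 where C4: "\<And>w. w \<in> D \<Longrightarrow> u1 w * v2' w - v2 w * u1' w = C4"
    using wronskian_constant[OF D(1) u1(2) v2(1) u1(3) v2(2)] by blast
  have W1: "u1 w * v1' w - v1 w * u1' w = 1" if "w \<in> D" for w
    using u1(1)[OF that] by (simp add: v1_def v1'_def field_simps)
  have W2: "u2 w * v2' w - v2 w * u2' w = 1" if "w \<in> D" for w
    using u2(1)[OF that] by (simp add: v2_def v2'_def field_simps)
  obtain w0 where w0: "w0 \<in> D" using D(4) by blast
  \<comment> \<open>Pluecker's relation: the determinant of the change of basis is the product of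
    the Wronskians of the two bases, and both are 1.\<close>
  have "C4 * C1 - C3 * C2 =
      (u1 w0 * v1' w0 - v1 w0 * u1' w0) * (u2 w0 * v2' w0 - v2 w0 * u2' w0)"
    unfolding C1[OF w0, symmetric] C2[OF w0, symmetric] C3[OF w0, symmetric] C4[OF w0, symmetric]
    by (simp add: algebra_simps)
  then have det: "C4 * C1 - C3 * C2 \<noteq> 0" using W1[OF w0] W2[OF w0] by simp
  have "h (moebius \<gamma> w) * (C2 * h w + C1) = C4 * h w + C3" if w: "w \<in> D" for w
  proof -
    have "u2 w * (u1 w * v1' w - v1 w * u1' w) = C1 * u1 w + C2 * v1 w"
      unfolding C1[OF w, symmetric] C2[OF w, symmetric] by (simp add: algebra_simps)
    then have a: "u2 w = u1 w * (C2 * h w + C1)" unfolding W1[OF w] by (simp add: v1_def algebra_simps)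
    have "v2 w * (u1 w * v1' w - v1 w * u1' w) = C3 * u1 w + C4 * v1 w"
      unfolding C3[OF w, symmetric] C4[OF w, symmetric] by (simp add: algebra_simps)
    then have "g w * u2 w = u1 w * (C4 * h w + C3)" unfolding W1[OF w] by (simp add: v1_def v2_def algebra_simps)
    then have "u1 w * (g w * (C2 * h w + C1)) = u1 w * (C4 * h w + C3)" unfolding a by (simp add: algebra_simps)
    then show ?thesis using u1(1)[OF w] by (simp add: g_def)
  qed
  with det show ?thesis using that by blast
qed

lemma filterlim_moebius:
  assumes "\<gamma> \<in> carrier SL2Z" "Im z > 0"
  shows "filterlim (moebius \<gamma>) (at (moebius \<gamma> z)) (at z)"
  unfolding filterlim_at
proof
  show "(moebius \<gamma> \<longlongrightarrow> moebius \<gamma> z) (at z)"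
    using DERIV_isCont[OF moebius_has_field_derivative[OF assms]] by (simp add: isCont_def)
  have "\<forall>\<^sub>F w in at z. w \<in> upper_half_plane - {z}"
    using eventually_at_in_open[of upper_half_plane z] assms(2) by (simp add: open_halfspace_Im_gt)
  then show "\<forall>\<^sub>F w in at z. moebius \<gamma> w \<in> UNIV \<and> moebius \<gamma> w \<noteq> moebius \<gamma> z"
    by eventually_elim (use moebius_adj(1)[OF assms(1)] assms(2) in \<open>metis DiffE UNIV_I insertCI mem_Collect_eq\<close>)
qed

text \<open>The local relation spreads by the identity theorem over the half-plane without the poles
  of \<open>h\<close> and of h o \<gamma>. At those poles it follows by continuity of maps into the
  sphere.\<close>

theorem moebius_equivariant:
  assumes \<gamma>: "\<gamma> \<in> carrier SL2Z"
  obtains \<mu> where "\<mu> \<in> Mob" "\<And>z. Im z > 0 \<Longrightarrow> hv (moebius \<gamma> z) = \<mu> (hv z)"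
proof -
  have ev: "\<forall>\<^sub>F w in at z. regular_at w \<and> regular_at (moebius \<gamma> w)" if "Im z > 0" for z
    using eventually_regular[OF that]
      eventually_compose_filterlim[OF eventually_regular[OF Im_moebius_pos[OF \<gamma> that]] filterlim_moebius[OF \<gamma> that]]
    by eventually_elim simp
  have "0 < Im \<i>" by simp
  from open_ball_avoiding[OF ev[OF this]]
  obtain z0 r where r: "r > 0" "\<And>w. w \<in> ball z0 r \<Longrightarrow> regular_at w \<and> regular_at (moebius \<gamma> w)"
    by blast
  let ?D = "ball z0 r"
  have DH: "?D \<subseteq> upper_half_plane" using r(2) by (auto simp: regular_at_def)
  obtain a b c d where det: "a * d - b * c \<noteq> 0"
    and rel: "\<And>w. w \<in> ?D \<Longrightarrow> h (moebius \<gamma> w) * (c * h w + d) = a * h w + b"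
    using local_moebius_relation[OF \<gamma> _ _ DH] r by (metis centre_in_ball convex_ball empty_iff open_ball)
  define \<mu> where "\<mu> = mob a b c d"
  have \<mu>: "\<mu> \<in> Mob" unfolding \<mu>_def by (rule Mob_I[OF det])
  define Pl where "Pl = {z \<in> upper_half_plane. is_pole h z}"
  \<comment> \<open>Poles are countable, and a connected open set in the plane stays connected when
    countably many points are removed; so the identity theorem applies on \<open>N\<close>.\<close>
  define N where "N = upper_half_plane - (Pl \<union> {z \<in> upper_half_plane. is_pole h (moebius \<gamma> z)})"
  have oH: "open upper_half_plane" by (rule open_halfspace_Im_gt)
  have cP: "countable Pl"
  proof -
    have "{z. is_pole h z} sparse_in upper_half_plane"
      using meromorphic_on_imp_not_pole_cosparse[OF mero] by (simp add: eventually_cosparse)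
    from sparse_imp_countable[OF oH this] show ?thesis by (simp add: Pl_def Collect_conj_eq)
  qed
  have "{z \<in> upper_half_plane. is_pole h (moebius \<gamma> z)} \<subseteq> moebius (adj \<gamma>) ` Pl"
    using moebius_adj[OF \<gamma>] Im_moebius_pos[OF \<gamma>] unfolding Pl_def by (auto intro!: image_eqI[of _ _ "moebius \<gamma> _"])
  then have "countable {z \<in> upper_half_plane. is_pole h (moebius \<gamma> z)}"
    by (rule countable_subset) (rule countable_image[OF cP])
  then have "connected N" unfolding N_def using cP oH
    by (intro connected_open_diff_countable convex_connected convex_halfspace_Im_gt) auto
  have evN: "\<forall>\<^sub>F w in at z. w \<in> N" if "Im z > 0" for z
    using ev[OF that]
  proof eventually_elim
    case (elim w)
    then show ?case
      using analytic_at_imp_no_pole[of h w] analytic_at_imp_no_pole[of h "moebius \<gamma> w"]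
      by (simp add: N_def Pl_def regular_at_def)
  qed
  have reg_h: "h analytic_on {w}" "h analytic_on {moebius \<gamma> w}" if "w \<in> N" for w
    using that analytic Im_moebius_pos[OF \<gamma>] by (auto simp: N_def Pl_def)
  have oN: "open N"
  proof (subst open_subopen, intro ballI)
    fix z assume z: "z \<in> N"
    then have "Im z > 0" by (simp add: N_def)
    then have "\<forall>\<^sub>F w in nhds z. w \<in> N"
      unfolding eventually_nhds_conv_at using evN z by blast
    then show "\<exists>T. open T \<and> z \<in> T \<and> T \<subseteq> N" unfolding eventually_nhds by blast
  qed
  have DN: "?D \<subseteq> N"
  proof
    fix w assume "w \<in> ?D"
    from r(2)[OF this] show "w \<in> N"
      using analytic_at_imp_no_pole[of h w] analytic_at_imp_no_pole[of h "moebius \<gamma> w"]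
      by (simp add: N_def Pl_def regular_at_def)
  qed
  have "(\<lambda>w. h (moebius \<gamma> w) * (c * h w + d) - (a * h w + b)) holomorphic_on N"
  proof -
    have "h analytic_on N" using reg_h(1) analytic_on_analytic_at[of h N] by blast
    then have "h holomorphic_on N" by (rule analytic_imp_holomorphic)
    moreover have "(\<lambda>w. h (moebius \<gamma> w)) holomorphic_on N"
      unfolding holomorphic_on_def
    proof
      fix w assume w: "w \<in> N"
      have "(h has_field_derivative deriv h (moebius \<gamma> w)) (at (moebius \<gamma> w))"
        using reg_h(2)[OF w] by (simp add: analytic_on_imp_differentiable_at DERIV_deriv_iff_field_differentiable)
      moreover have "Im w > 0" using w by (simp add: N_def)
      ultimately have "((\<lambda>w. h (moebius \<gamma> w)) has_field_derivative deriv h (moebius \<gamma> w) * (1 / (automorphy \<gamma> w)\<^sup>2)) (at w)"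
        using DERIV_chain2 moebius_has_field_derivative[OF \<gamma>] by blast
      then show "(\<lambda>w. h (moebius \<gamma> w)) field_differentiable (at w within N)"
        using field_differentiable_at_within field_differentiable_def by blast
    qed
    ultimately show ?thesis by (intro holomorphic_intros)
  qed
  moreover have "h (moebius \<gamma> w) * (c * h w + d) - (a * h w + b) = 0" if "w \<in> ?D" for w using rel[OF that] by simp
  ultimately have zero: "h (moebius \<gamma> w) * (c * h w + d) - (a * h w + b) = 0" if "w \<in> N" for w
    using analytic_continuation_open[of ?D N "\<lambda>w. h (moebius \<gamma> w) * (c * h w + d) - (a * h w + b)" "\<lambda>_. 0" w]
      oN \<open>connected N\<close> DN r(1) that by auto
  have eqN: "hv (moebius \<gamma> w) = \<mu> (hv w)" if w: "w \<in> N" for w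
  proof -
    \<comment> \<open>If c h + d vanished, the relation would force a h + b to vanish too, which an
      invertible matrix forbids for the vector (h w, 1).\<close>
    have "a * h w + b * 1 \<noteq> 0 \<or> c * h w + d * 1 \<noteq> 0" by (rule mob_vector_nonzero[OF det]) simp
    then have "c * h w + d \<noteq> 0" using zero[OF w] by auto
    then have "\<mu> (Some (h w)) = Some (h (moebius \<gamma> w))"
      using zero[OF w] by (simp add: \<mu>_def mob_def proj_def field_simps)
    then show ?thesis using w by (simp add: sphere_valued_def N_def Pl_def)
  qed
  have "hv (moebius \<gamma> z) = \<mu> (hv z)" if z: "Im z > 0" for z
  proof -
    have iC: "isCont (\<lambda>z. stereo (\<nu> (hv z))) w" if "\<nu> \<in> Mob" "Im w > 0" for \<nu> w
      using continuous_on_mob_hv[OF that(1)] continuous_on_eq_continuous_at[OF oH] that(2) by blast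
    have t1: "((\<lambda>z. stereo (\<mu> (hv z))) \<longlongrightarrow> stereo (\<mu> (hv z))) (at z)"
      using iC[OF \<mu> z] by (simp add: isCont_def)
    have t2: "((\<lambda>z. stereo (id (hv (moebius \<gamma> z)))) \<longlongrightarrow> stereo (id (hv (moebius \<gamma> z)))) (at z)"
    proof -
      have "isCont (moebius \<gamma>) z" by (rule DERIV_isCont[OF moebius_has_field_derivative[OF \<gamma> z]])
      from isCont_o2[OF this iC[OF id_in_Mob Im_moebius_pos[OF \<gamma> z]]] show ?thesis by (simp add: isCont_def)
    qed
    have t3: "\<forall>\<^sub>F w in at z. stereo (id (hv (moebius \<gamma> w))) = stereo (\<mu> (hv w))"
      using evN[OF z] by eventually_elim (simp add: eqN)
    have "stereo (id (hv (moebius \<gamma> z))) = stereo (\<mu> (hv z))"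
      by (rule tendsto_unique[OF at_neq_bot Lim_transform_eventually[OF t2 t3] t1])
    then have "hv (moebius \<gamma> z) = \<mu> (hv z)" using injD[OF inj_stereo] by fastforce
    then show ?thesis .
  qed
  with \<mu> show ?thesis using that by blast
qed

end

section \<open>The induced map to the sphere\<close>

context schwarzian_solution
begin

text \<open>At its poles \<open>h\<close> takes the value 0, so the clause on poles together with
  the clause on values says exactly that the values in the sphere are equal.\<close>

lemma invariance_group_iff:
  "\<gamma> \<in> invariance_group h \<longleftrightarrow> \<gamma> \<in> carrier SL2Z \<and> (\<forall>z. Im z > 0 \<longrightarrow> hv (moebius \<gamma> z) = hv z)"
proof -
  have eq: "(is_pole h w \<longleftrightarrow> is_pole h z) \<and> h w = h z \<longleftrightarrow> hv w = hv z" if "Im z > 0" "Im w > 0" for z w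
    using is_pole_zero_at_nicely_mero[OF nice, of z] is_pole_zero_at_nicely_mero[OF nice, of w] that
    by (auto simp: sphere_valued_def)
  show ?thesis
  proof (cases "\<gamma> \<in> carrier SL2Z")
    case True
    then show ?thesis unfolding invariance_group_def by (simp add: eq[OF _ Im_moebius_pos[OF True]])
  qed (simp add: invariance_group_def)
qed

lemma modular_group_invariance_group: "modular_group (invariance_group h)"
proof
  show "invariance_group h \<subseteq> carrier SL2Z" using invariance_group_iff by blast
  show "mat 1 \<in> invariance_group h"
    unfolding invariance_group_iff using one_in_SL2Z by (simp add: mat_1_eq moebius_def)
  show "\<gamma> ** \<delta> \<in> invariance_group h" if "\<gamma> \<in> invariance_group h" "\<delta> \<in> invariance_group h" for \<gamma> \<delta>
    using that unfolding invariance_group_iff by (simp add: mult_in_SL2Z moebius_mult Im_moebius_pos)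
  show "adj \<gamma> \<in> invariance_group h" if "\<gamma> \<in> invariance_group h" for \<gamma>
  proof -
    have \<gamma>: "\<gamma> \<in> carrier SL2Z" "\<And>z. Im z > 0 \<Longrightarrow> hv (moebius \<gamma> z) = hv z"
      using that unfolding invariance_group_iff by auto
    have "hv (moebius (adj \<gamma>) z) = hv z" if "Im z > 0" for z
      using \<gamma>(2)[OF Im_moebius_pos[OF adj_SL2Z(1)[OF \<gamma>(1)] that]] moebius_adj(2)[OF \<gamma>(1) that] by simp
    then show ?thesis unfolding invariance_group_iff using adj_SL2Z(1)[OF \<gamma>(1)] by blast
  qed
qed

end

locale genus_zero_setting = schwarzian_solution +
  fixes \<Gamma> :: "(int^2^2) set"
  assumes \<Gamma>_def: "\<Gamma> = invariance_group h"
    and simple_zero: "simple_zero_at_infinity (level \<Gamma>) h"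
    and finite_index: "finite (rcosets\<^bsub>SL2Z\<^esub> \<Gamma>)"
begin

sublocale modular_group \<Gamma>
  unfolding \<Gamma>_def by (rule modular_group_invariance_group)

lemma \<Gamma>_iff: "\<gamma> \<in> \<Gamma> \<longleftrightarrow> \<gamma> \<in> carrier SL2Z \<and> (\<forall>z. Im z > 0 \<longrightarrow> hv (moebius \<gamma> z) = hv z)"
  unfolding \<Gamma>_def by (rule invariance_group_iff)

text \<open>Passing \<gamma> through \<open>h\<close> produces a Moebius map outside, after which
  \<delta> acts directly on the argument of \<open>h\<close> and disappears. Normality moves the
  translations by the level from infinity to every other cusp.\<close>

lemma \<Gamma>_normal:
  assumes "\<gamma> \<in> carrier SL2Z" "\<delta> \<in> \<Gamma>"
  shows "\<gamma> ** \<delta> ** adj \<gamma> \<in> \<Gamma>"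
proof -
  have \<delta>: "\<delta> \<in> carrier SL2Z" "\<And>z. Im z > 0 \<Longrightarrow> hv (moebius \<delta> z) = hv z" using assms(2) \<Gamma>_iff by auto
  note a = adj_SL2Z(1)[OF assms(1)]
  have in_SL: "\<gamma> ** \<delta> ** adj \<gamma> \<in> carrier SL2Z" by (intro mult_in_SL2Z assms(1) \<delta>(1) a)
  obtain \<mu> where \<mu>: "\<mu> \<in> Mob" "\<And>z. Im z > 0 \<Longrightarrow> hv (moebius \<gamma> z) = \<mu> (hv z)"
    using moebius_equivariant[OF assms(1)] by blast
  have "hv (moebius (\<gamma> ** \<delta> ** adj \<gamma>) z) = hv z" if z: "Im z > 0" for z
  proof -
    let ?w = "moebius (adj \<gamma>) z"
    have w: "Im ?w > 0" by (rule Im_moebius_pos[OF a z])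
    have "moebius (\<gamma> ** \<delta> ** adj \<gamma>) z = moebius \<gamma> (moebius \<delta> ?w)"
      unfolding moebius_mult[OF mult_in_SL2Z[OF assms(1) \<delta>(1)] a z] by (rule moebius_mult[OF assms(1) \<delta>(1) w])
    then have "hv (moebius (\<gamma> ** \<delta> ** adj \<gamma>) z) = \<mu> (hv (moebius \<delta> ?w))"
      using \<mu>(2)[OF Im_moebius_pos[OF \<delta>(1) w]] by simp
    also have "\<dots> = \<mu> (hv ?w)" using \<delta>(2)[OF w] by simp
    also have "\<dots> = hv (moebius \<gamma> ?w)" using \<mu>(2)[OF w] by simp
    also have "\<dots> = hv z" using moebius_adj(2)[OF assms(1) z] by simp
    finally show ?thesis .
  qed
  then show ?thesis using \<Gamma>_iff in_SL by blast
qed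

lemma coset_representatives:
  obtains R where "finite R" "R \<subseteq> carrier SL2Z" "\<And>\<gamma>. \<gamma> \<in> carrier SL2Z \<Longrightarrow> \<exists>\<delta>\<in>\<Gamma>. \<exists>r\<in>R. \<gamma> = \<delta> ** r"
proof -
  have "\<forall>C\<in>rcosets\<^bsub>SL2Z\<^esub> \<Gamma>. \<exists>a. a \<in> carrier SL2Z \<and> C = \<Gamma> #>\<^bsub>SL2Z\<^esub> a"
    by (auto simp: RCOSETS_def)
  from bchoice[OF this] obtain rep where
    rep: "\<forall>C\<in>rcosets\<^bsub>SL2Z\<^esub> \<Gamma>. rep C \<in> carrier SL2Z \<and> C = \<Gamma> #>\<^bsub>SL2Z\<^esub> rep C" ..
  have "\<exists>\<delta>\<in>\<Gamma>. \<exists>r\<in>rep ` (rcosets\<^bsub>SL2Z\<^esub> \<Gamma>). \<gamma> = \<delta> ** r" if \<gamma>: "\<gamma> \<in> carrier SL2Z" for \<gamma>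
  proof -
    let ?C = "\<Gamma> #>\<^bsub>SL2Z\<^esub> \<gamma>"
    have C: "?C \<in> rcosets\<^bsub>SL2Z\<^esub> \<Gamma>" using \<gamma> by (auto simp: RCOSETS_def)
    have "\<gamma> \<in> ?C" using one_in unfolding r_coset_def by (auto simp: SL2Z_def intro!: bexI[of _ "mat 1"])
    then have "\<gamma> \<in> \<Gamma> #>\<^bsub>SL2Z\<^esub> rep ?C" using rep C by blast
    then obtain \<delta> where "\<delta> \<in> \<Gamma>" "\<gamma> = \<delta> ** rep ?C" by (auto simp: r_coset_def SL2Z_def)
    then show ?thesis using C by blast
  qed
  moreover have "rep ` (rcosets\<^bsub>SL2Z\<^esub> \<Gamma>) \<subseteq> carrier SL2Z" using rep by blast
  ultimately show ?thesis using that[of "rep ` (rcosets\<^bsub>SL2Z\<^esub> \<Gamma>)"] finite_index by blast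
qed

section \<open>The level and the local parameter at infinity\<close>

definition m :: nat where "m = level \<Gamma>"

lemma translation_in_SL2Z: "mat2 1 k 0 1 \<in> carrier SL2Z"
  by (simp add: mat2_in_SL2Z)

text \<open>Pigeonhole: two translations lie in the same one of the finitely many cosets, so their
  quotient is a translation in \<Gamma>. This guarantees that the minimum in \<open>level\<close> is
  attained.\<close>

lemma level: "m > 0" "mat2 1 (int m) 0 1 \<in> \<Gamma>"
proof -
  obtain R where R: "finite R" "R \<subseteq> carrier SL2Z" "\<And>\<gamma>. \<gamma> \<in> carrier SL2Z \<Longrightarrow> \<exists>\<delta>\<in>\<Gamma>. \<exists>r\<in>R. \<gamma> = \<delta> ** r"
    using coset_representatives by blast
  have "\<forall>n::nat. \<exists>p. fst p \<in> \<Gamma> \<and> snd p \<in> R \<and> mat2 1 (int n) 0 1 = fst p ** snd p"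
    using R(3)[OF translation_in_SL2Z] by force
  from choice[OF this] obtain f where
    f: "\<And>n::nat. fst (f n) \<in> \<Gamma> \<and> snd (f n) \<in> R \<and> mat2 1 (int n) 0 1 = fst (f n) ** snd (f n)" by blast
  have "\<not> inj (\<lambda>n. snd (f n))"
  proof
    assume "inj (\<lambda>n. snd (f n))"
    moreover have "finite (range (\<lambda>n. snd (f n)))" using f R(1) by (auto intro: finite_subset[of _ R])
    ultimately show False using finite_imageD infinite_UNIV_nat by blast
  qed
  then obtain i j where ij: "snd (f i) = snd (f j)" "i < j"
    unfolding inj_def by (metis linorder_neqE_nat)
  have "mat2 1 (int j) 0 1 ** adj (mat2 1 (int i) 0 1) \<in> \<Gamma>"
  proof -
    note T = translation_in_SL2Z[of "int i"]
    have "fst (f i) \<in> carrier SL2Z" using f subset_SL2Z by blast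
    have "adj (fst (f i)) ** mat2 1 (int i) 0 1 = adj (fst (f i)) ** (fst (f i) ** snd (f i))"
      using f[of i] by simp
    also have "\<dots> = adj (fst (f i)) ** fst (f i) ** snd (f i)" by (rule matrix_mul_assoc)
    also have "\<dots> = snd (f j)" using adj_SL2Z(2)[OF \<open>fst (f i) \<in> carrier SL2Z\<close>] ij(1) by simp
    finally have "mat2 1 (int j) 0 1 = fst (f j) ** (adj (fst (f i)) ** mat2 1 (int i) 0 1)"
      using f[of j] by simp
    then have "mat2 1 (int j) 0 1 ** adj (mat2 1 (int i) 0 1) =
        fst (f j) ** adj (fst (f i)) ** (mat2 1 (int i) 0 1 ** adj (mat2 1 (int i) 0 1))"
      by (simp add: matrix_mul_assoc)
    then have "mat2 1 (int j) 0 1 ** adj (mat2 1 (int i) 0 1) = fst (f j) ** adj (fst (f i))"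
      using adj_SL2Z(3)[OF T] by simp
    then show ?thesis using mult_in adj_in f by simp
  qed
  moreover have "mat2 1 (int j) 0 1 ** adj (mat2 1 (int i) 0 1) = mat2 1 (int (j - i)) 0 1"
    using ij(2) by (simp add: adj_def mat2_mult of_nat_diff)
  ultimately have "0 < j - i \<and> vector [vector [1, int (j - i)], vector [0, 1]] \<in> \<Gamma>"
    using ij(2) by (simp add: mat2_def)
  from LeastI[of "\<lambda>m. m > 0 \<and> vector [vector [1, int m], vector [0, 1]] \<in> \<Gamma>", OF this]
  show "m > 0" "mat2 1 (int m) 0 1 \<in> \<Gamma>" unfolding m_def level_def mat2_def by auto
qed

lemma translation_in_\<Gamma>: "mat2 1 (int m * k) 0 1 \<in> \<Gamma>"
proof -
  have n: "mat2 1 (int m * int n) 0 1 \<in> \<Gamma>" for n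
  proof (induction n)
    case 0
    then show ?case using one_in by (simp add: mat_1_eq)
  next
    case (Suc n)
    from mult_in[OF Suc level(2)] show ?case by (simp add: mat2_mult algebra_simps)
  qed
  show ?thesis
  proof (cases k rule: int_cases2)
    case (nonneg n)
    then show ?thesis using n by simp
  next
    case (nonpos n)
    then show ?thesis using adj_in[OF n[of n]] by (simp add: adj_def)
  qed
qed

definition q :: "complex \<Rightarrow> complex" where
  "q z = exp (2 * of_real pi * \<i> * z / of_nat m)"

lemma norm_q: "norm (q z) = exp (- (2 * pi / m) * Im z)"
  by (simp add: q_def)

lemma norm_q_less:
  assumes "e > 0"
  obtains M where "M > 0" "\<And>z. Im z > M \<Longrightarrow> norm (q z) < e"
proof
  define M where "M = max 1 (- ln e * m / (2 * pi))"
  show "M > 0" by (simp add: M_def)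
  fix z assume "Im z > M"
  then have "- ln e * m / (2 * pi) < Im z" by (simp add: M_def)
  then have "- (2 * pi / m) * Im z < ln e" using level(1) by (simp add: field_simps)
  then have "exp (- (2 * pi / m) * Im z) < exp (ln e)" by (simp only: exp_less_cancel_iff)
  then show "norm (q z) < e" using assms by (simp add: norm_q)
qed

lemma q_surj:
  assumes "w \<noteq> 0" "norm w < exp (- (2 * pi / m) * M)"
  obtains z where "Im z > M" "q z = w"
proof -
  define z where "z = of_nat m * Ln w / (2 * of_real pi * \<i>)"
  have q: "q z = w" using level(1) assms(1) by (simp add: q_def z_def)
  then have "exp (- (2 * pi / m) * Im z) < exp (- (2 * pi / m) * M)" using assms(2) norm_q by metis
  then have "- (2 * pi / m) * Im z < - (2 * pi / m) * M" by (simp only: exp_less_cancel_iff)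
  then have "M < Im z" using level(1) by (simp add: field_simps)
  with q show ?thesis using that by blast
qed

lemma q_eq_iff:
  assumes "q z = q w"
  obtains k :: int where "z = w + of_int (int m * k)"
proof -
  obtain k :: int where "2 * of_real pi * \<i> * z / of_nat m = 2 * of_real pi * \<i> * w / of_nat m + of_int (2 * k) * of_real pi * \<i>"
    using assms unfolding q_def exp_eq by (auto simp: mult_ac)
  then have "2 * of_real pi * \<i> * z = 2 * of_real pi * \<i> * (w + of_int (int m * k))"
    using level(1) by (simp add: field_simps)
  then have "z = w + of_int (int m * k)" by (subst (asm) mult_left_cancel) auto
  then show ?thesis using that by blast
qed

text \<open>F'(0) is nonzero, so F is injective on a small disc. The equation h = F o q is only one
  of values, with dummies allowed; that there are no poles follows because \<open>h\<close> agrees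
  with a holomorphic function on an open half-plane.\<close>

lemma expansion_at_infinity:
  obtains F r M where "r > 0" "F holomorphic_on ball 0 r" "inj_on F (ball 0 r)" "F 0 = 0" "M > 0"
    "\<And>z. Im z > M \<Longrightarrow> norm (q z) < r" "\<And>z. Im z > M \<Longrightarrow> hv z = Some (F (q z))"
proof -
  from simple_zero obtain F M0 where F: "F analytic_on {0}" "F 0 = 0" "deriv F 0 \<noteq> 0"
    and F': "\<forall>z\<in>upper_half_plane. Im z > M0 \<longrightarrow> h z = F (exp (2 * of_real pi * \<i> * z / of_nat (level \<Gamma>)))"
    unfolding simple_zero_at_infinity_def by blast
  have F4: "h z = F (q z)" if "Im z > 0" "Im z > M0" for z
    using F' that by (simp add: q_def m_def)
  obtain e where e: "e > 0" "F holomorphic_on ball 0 e" using F(1) by (auto simp: analytic_on_def)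
  have "(0::complex) \<in> ball 0 e" using e(1) by simp
  then obtain r where r: "r > 0" "ball (0::complex) r \<subseteq> ball 0 e" "inj_on F (ball 0 r)"
    by (rule has_complex_derivative_locally_injective[OF e(2) _ open_ball F(3)])
  obtain M1 where M1: "M1 > 0" "\<And>z. Im z > M1 \<Longrightarrow> norm (q z) < r" using norm_q_less[OF r(1)] by blast
  define M where "M = max M0 M1"
  have Fh: "F holomorphic_on ball 0 r" using e(2) r(2) by (rule holomorphic_on_subset)
  have o: "open {z. Im z > M}" by (rule open_halfspace_Im_gt)
  have heq: "h z = F (q z)" "norm (q z) < r" if "Im z > M" for z using that F4 M1 by (auto simp: M_def)
  have "(F \<circ> q) holomorphic_on {z. Im z > M}"
  proof (rule holomorphic_on_compose_gen[OF _ Fh])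
    show "q holomorphic_on {z. Im z > M}" unfolding q_def by (intro holomorphic_intros) (use level(1) in auto)
    show "q ` {z. Im z > M} \<subseteq> ball 0 r" using heq(2) by auto
  qed
  then have "h holomorphic_on {z. Im z > M}" by (rule holomorphic_transform) (simp add: heq)
  then have "h analytic_on {z. Im z > M}" using analytic_on_open[OF o] by blast
  then have "\<not> is_pole h z" if "Im z > M" for z
    using that analytic_on_analytic_at[of h "{z. Im z > M}"] analytic_at_imp_no_pole[of h z] by blast
  then have "hv z = Some (F (q z))" if "Im z > M" for z using that heq by (simp add: sphere_valued_def)
  moreover have "M > 0" using M1 by (simp add: M_def less_max_iff_disj)
  ultimately show ?thesis using that[of r F M] r Fh F(2) heq(2) by blast
qed

section \<open>Extension of \<open>h\<close> to the cusps\<close>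

definition compatible :: "int^2^2 \<Rightarrow> (complex option \<Rightarrow> complex option) \<Rightarrow> bool" where
  "compatible \<gamma> \<mu> \<longleftrightarrow> \<gamma> \<in> carrier SL2Z \<and> \<mu> \<in> Mob \<and> (\<forall>z. Im z > 0 \<longrightarrow> hv (moebius \<gamma> z) = \<mu> (hv z))"

lemma compatible_exists: "\<gamma> \<in> carrier SL2Z \<Longrightarrow> \<exists>\<mu>. compatible \<gamma> \<mu>"
  using moebius_equivariant unfolding compatible_def by metis

lemma compatible_mult: "compatible \<gamma> \<mu> \<Longrightarrow> compatible \<delta> \<nu> \<Longrightarrow> compatible (\<gamma> ** \<delta>) (\<mu> \<circ> \<nu>)"
  unfolding compatible_def by (simp add: mult_in_SL2Z Mob_comp moebius_mult Im_moebius_pos)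

lemma compatible_\<Gamma>: "\<gamma> \<in> \<Gamma> \<Longrightarrow> compatible \<gamma> id"
  unfolding compatible_def \<Gamma>_iff using id_in_Mob by simp

text \<open>Along every vertical line the parameter \<open>q\<close> tends to 0 and \<open>h\<close>
  to its zero. The offset k is needed because a matrix that fixes infinity acts as an integer
  translation.\<close>

lemma tendsto_at_cusp:
  assumes "\<mu> \<in> Mob"
  shows "((\<lambda>y. stereo (\<mu> (hv (\<i> * of_real y + of_int k)))) \<longlongrightarrow> stereo (\<mu> (Some 0))) at_top"
proof -
  obtain F r M where F: "r > 0" "F holomorphic_on ball 0 r" "F 0 = 0" "M > 0"
    "\<And>z. Im z > M \<Longrightarrow> hv z = Some (F (q z))" using expansion_at_infinity by metis
  have "((\<lambda>y. q (\<i> * of_real y + of_int k)) \<longlongrightarrow> 0) at_top"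
  proof (rule tendstoI)
    fix e :: real assume "e > 0"
    then obtain M' where M': "M' > 0" "\<And>z. Im z > M' \<Longrightarrow> norm (q z) < e" using norm_q_less by blast
    show "\<forall>\<^sub>F y in at_top. dist (q (\<i> * of_real y + of_int k)) 0 < e"
      by (rule eventually_mono[OF eventually_gt_at_top[of M']]) (simp add: M'(2))
  qed
  moreover have "isCont (\<lambda>w. stereo (\<mu> (Some (F w)))) 0"
  proof -
    have "isCont F 0" using holomorphic_on_imp_continuous_on[OF F(2)] continuous_on_eq_continuous_at[OF open_ball, of 0 r F] F(1) by simp
    moreover have "isCont (\<lambda>z. stereo (\<mu> (Some z))) (F 0)"
      using continuous_chart[OF assms] continuous_on_eq_continuous_at[OF open_UNIV] by blast
    ultimately show ?thesis by (rule isCont_o2)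
  qed
  ultimately have "((\<lambda>y. stereo (\<mu> (Some (F (q (\<i> * of_real y + of_int k)))))) \<longlongrightarrow> stereo (\<mu> (Some (F 0)))) at_top"
    by (rule isCont_tendsto_compose[rotated])
  then have "((\<lambda>y. stereo (\<mu> (Some (F (q (\<i> * of_real y + of_int k)))))) \<longlongrightarrow> stereo (\<mu> (Some 0))) at_top"
    unfolding F(3) .
  moreover have "\<forall>\<^sub>F y in at_top. stereo (\<mu> (Some (F (q (\<i> * of_real y + of_int k))))) =
      stereo (\<mu> (hv (\<i> * of_real y + of_int k)))"
    using eventually_gt_at_top[of M] by eventually_elim (simp add: F(5))
  ultimately show ?thesis by (rule Lim_transform_eventually)
qed

text \<open>Two matrices with the same cusp differ by a translation, so \<nu> (h z) = \<mu> (h (z +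
  k)). Both sides converge as z rises to infinity, to the two values in question.\<close>

lemma cusp_value_unique:
  assumes "compatible \<gamma> \<mu>" "compatible \<delta> \<nu>" "moebius_ext \<gamma> None = moebius_ext \<delta> None"
  shows "\<mu> (Some 0) = \<nu> (Some 0)"
proof -
  have \<gamma>: "\<gamma> \<in> carrier SL2Z" "\<mu> \<in> Mob" and \<delta>: "\<delta> \<in> carrier SL2Z" "\<nu> \<in> Mob"
    using assms by (auto simp: compatible_def)
  let ?\<epsilon> = "adj \<gamma> ** \<delta>"
  have \<epsilon>: "?\<epsilon> \<in> carrier SL2Z" by (intro mult_in_SL2Z adj_SL2Z(1) \<gamma> \<delta>)
  have "moebius_ext ?\<epsilon> None = None"
    using moebius_ext_mult[OF \<delta>(1)] assms(3) moebius_ext_adj(1)[OF \<gamma>(1)] by metis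
  then obtain k :: int where k: "\<And>z. moebius ?\<epsilon> z = z + of_int k" using stabilizer_infinity[OF \<epsilon>] by metis
  have "\<gamma> ** ?\<epsilon> = \<delta>" using adj_SL2Z(3)[OF \<gamma>(1)] by (simp add: matrix_mul_assoc)
  then have \<delta>z: "moebius \<delta> z = moebius \<gamma> (z + of_int k)" if "Im z > 0" for z
    using moebius_mult[OF \<gamma>(1) \<epsilon> that] k by simp
  have eq: "\<nu> (hv z) = \<mu> (hv (z + of_int k))" if z: "Im z > 0" for z
  proof -
    have "Im (z + of_int k) > 0" using z by simp
    then have "\<mu> (hv (z + of_int k)) = hv (moebius \<gamma> (z + of_int k))"
      using assms(1) unfolding compatible_def by metis
    also have "\<dots> = \<nu> (hv z)" using assms(2) z \<delta>z[OF z] unfolding compatible_def by metis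
    finally show ?thesis by simp
  qed
  have "((\<lambda>y. stereo (\<nu> (hv (\<i> * of_real y + of_int 0)))) \<longlongrightarrow> stereo (\<nu> (Some 0))) at_top"
    by (rule tendsto_at_cusp[OF \<delta>(2)])
  moreover have "\<forall>\<^sub>F y in at_top. stereo (\<nu> (hv (\<i> * of_real y + of_int 0))) =
      stereo (\<mu> (hv (\<i> * of_real y + of_int k)))"
    using eventually_gt_at_top[of 0] by eventually_elim (simp add: eq)
  ultimately have "((\<lambda>y. stereo (\<mu> (hv (\<i> * of_real y + of_int k)))) \<longlongrightarrow> stereo (\<nu> (Some 0))) at_top"
    by (rule Lim_transform_eventually)
  with tendsto_at_cusp[OF \<gamma>(2), of k] have "stereo (\<mu> (Some 0)) = stereo (\<nu> (Some 0))"
    using tendsto_unique[OF trivial_limit_at_top_linorder] by blast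
  then show ?thesis by (rule injD[OF inj_stereo])
qed

text \<open>At the cusps \<open>H\<close> takes the values that equivariance forces from the zero of \<open>h\<close> at \<open>\<infinity>\<close>.\<close>

definition H :: "complex option \<Rightarrow> complex option" where
  "H x = (if x \<in> Some ` upper_half_plane then hv (the x)
     else (SOME v. \<exists>\<gamma> \<mu>. compatible \<gamma> \<mu> \<and> moebius_ext \<gamma> None = x \<and> v = \<mu> (Some 0)))"

lemma H_Some: "Im z > 0 \<Longrightarrow> H (Some z) = hv z"
  by (simp add: H_def)

lemma H_cusp:
  assumes "compatible \<gamma> \<mu>"
  shows "H (moebius_ext \<gamma> None) = \<mu> (Some 0)"
proof -
  have "moebius_ext \<gamma> None \<notin> Some ` upper_half_plane" using Some_notin_moebius_ext_None[of _ \<gamma>] by auto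
  then have "H (moebius_ext \<gamma> None) =
      (SOME v. \<exists>\<gamma>' \<mu>. compatible \<gamma>' \<mu> \<and> moebius_ext \<gamma>' None = moebius_ext \<gamma> None \<and> v = \<mu> (Some 0))"
    by (simp add: H_def)
  also have "\<dots> = \<mu> (Some 0)"
    by (rule some_equality) (use assms cusp_value_unique in blast)+
  finally show ?thesis .
qed

lemma H_equivariant:
  assumes "compatible \<gamma> \<mu>" "x \<in> extended_half_plane_points"
  shows "H (moebius_ext \<gamma> x) = \<mu> (H x)"
  using assms(2)
proof (cases rule: extended_half_plane_points_cases)
  case (1 z)
  have "\<gamma> \<in> carrier SL2Z" using assms by (simp add: compatible_def)
  then show ?thesis using assms(1) 1 Im_moebius_pos
    by (simp add: moebius_ext_Some H_Some compatible_def)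
next
  case (2 \<delta>)
  then obtain \<nu> where \<nu>: "compatible \<delta> \<nu>" using compatible_exists by blast
  have "H (moebius_ext \<gamma> x) = H (moebius_ext (\<gamma> ** \<delta>) None)" using 2 by (simp add: moebius_ext_mult)
  also have "\<dots> = (\<mu> \<circ> \<nu>) (Some 0)" by (rule H_cusp[OF compatible_mult[OF assms(1) \<nu>]])
  also have "\<dots> = \<mu> (H x)" using H_cusp[OF \<nu>] 2 by simp
  finally show ?thesis .
qed

lemma H_\<Gamma>: "\<gamma> \<in> \<Gamma> \<Longrightarrow> x \<in> extended_half_plane_points \<Longrightarrow> H (moebius_ext \<gamma> x) = H x"
  using H_equivariant[OF compatible_\<Gamma>] by simp

lemma H_None: "H None = Some 0"
  using H_cusp[OF compatible_\<Gamma>[OF one_in]] by (simp add: moebius_ext_one)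

text \<open>Near a cusp \<gamma> \<infinity> the values are \<mu> (F (q z)) with z high up, which is
  continuous in q and takes at q = 0 the value assigned to the cusp.\<close>

lemma continuous_map_H: "continuous_map extended_half_plane (top_of_set (sphere 0 1)) (\<lambda>x. stereo (H x))"
  unfolding continuous_map_in_subtopology
proof (intro conjI)
  show "(\<lambda>x. stereo (H x)) \<in> topspace extended_half_plane \<rightarrow> sphere 0 1"
    using stereo_in_sphere by blast
  show "continuous_map extended_half_plane euclidean (\<lambda>x. stereo (H x))"
    unfolding continuous_map_def
  proof (intro conjI allI impI)
    fix V :: "(complex \<times> real) set" assume "openin euclidean V"
    then have V: "open V" by simp
    let ?W = "{x \<in> topspace extended_half_plane. stereo (H x) \<in> V}"
    show "openin extended_half_plane ?W"
      unfolding openin_extended_half_plane_iff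
    proof (intro conjI ballI impI)
      show "?W \<subseteq> extended_half_plane_points" by (auto simp: topspace_extended_half_plane)
      have "{z \<in> upper_half_plane. Some z \<in> ?W} = {z \<in> upper_half_plane. stereo (id (hv z)) \<in> V}"
        by (auto simp: topspace_extended_half_plane extended_half_plane_points_def H_Some)
      moreover have "open {z \<in> upper_half_plane. stereo (id (hv z)) \<in> V}"
        using continuous_open_preimage[OF continuous_on_mob_hv[OF id_in_Mob] open_halfspace_Im_gt V]
        by (simp add: vimage_def Int_def)
      ultimately show "open {z \<in> upper_half_plane. Some z \<in> ?W}" by simp
      fix \<gamma> assume \<gamma>: "\<gamma> \<in> carrier SL2Z" "moebius_ext \<gamma> None \<in> ?W"
      obtain \<mu> where \<mu>: "compatible \<gamma> \<mu>" using compatible_exists[OF \<gamma>(1)] by blast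
      then have \<mu>M: "\<mu> \<in> Mob" by (simp add: compatible_def)
      obtain F r M where F: "r > 0" "F holomorphic_on ball 0 r" "inj_on F (ball 0 r)" "F 0 = 0" "M > 0"
        "\<And>z. Im z > M \<Longrightarrow> norm (q z) < r" "\<And>z. Im z > M \<Longrightarrow> hv z = Some (F (q z))"
        by (rule expansion_at_infinity) (rule that; assumption)
      have cF: "continuous_on (ball 0 r) (\<lambda>w. stereo (\<mu> (Some (F w))))"
        by (rule continuous_on_compose2[OF continuous_chart[OF \<mu>M] holomorphic_on_imp_continuous_on[OF F(2)]]) simp
      have "open (ball 0 r \<inter> (\<lambda>w. stereo (\<mu> (Some (F w)))) -` V)"
        by (rule continuous_open_preimage[OF cF open_ball V])
      moreover have "0 \<in> ball 0 r \<inter> (\<lambda>w. stereo (\<mu> (Some (F w)))) -` V"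
        using \<gamma>(2) H_cusp[OF \<mu>] F(1,4) by simp
      ultimately obtain e where e: "e > 0" "ball 0 e \<subseteq> ball 0 r \<inter> (\<lambda>w. stereo (\<mu> (Some (F w)))) -` V"
        using open_contains_ball by blast
      obtain M' where M': "M' > 0" "\<And>z. Im z > M' \<Longrightarrow> norm (q z) < e" using norm_q_less[OF e(1)] by blast
      have "moebius_ext \<gamma> (Some z) \<in> ?W" if z: "Im z > max M M'" for z
      proof -
        have zM: "Im z > M" "Im z > M'" "Im z > 0" using z F(5) by auto
        have zp: "Some z \<in> extended_half_plane_points" using zM by (simp add: extended_half_plane_points_def)
        have "H (moebius_ext \<gamma> (Some z)) = \<mu> (Some (F (q z)))"
          using H_equivariant[OF \<mu> zp] H_Some[OF zM(3)] F(7)[OF zM(1)] by simp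
        moreover have "q z \<in> ball 0 e" using M'(2)[OF zM(2)] by simp
        ultimately show ?thesis
          using e(2) moebius_ext_in_points[OF \<gamma>(1) zp] by (auto simp: topspace_extended_half_plane)
      qed
      moreover have "max M M' > 0" using M'(1) by (simp add: less_max_iff_disj)
      ultimately show "\<exists>M>0. \<forall>z. Im z > M \<longrightarrow> moebius_ext \<gamma> (Some z) \<in> ?W" by blast
    qed
  qed simp
qed

text \<open>At interior points and at cusps alike \<open>H\<close> is an injective holomorphic
  function followed by a Moebius map, in the variable z or in the parameter q; both factors preserve
  openness.\<close>

lemma H_local_image:
  assumes U: "openin extended_half_plane U" and x: "x \<in> U"
  obtains W where "openin (top_of_set (sphere 0 1)) W" "stereo (H x) \<in> W" "W \<subseteq> (\<lambda>x. stereo (H x)) ` U"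
proof -
  note U' = U[unfolded openin_extended_half_plane_iff]
  have "x \<in> extended_half_plane_points" using U' x by blast
  then show ?thesis
  proof (cases rule: extended_half_plane_points_cases)
    case (1 z)
    obtain \<mu> k r where c: "\<mu> \<in> Mob" "r > 0" "ball z r \<subseteq> upper_half_plane" "k holomorphic_on ball z r"
      "inj_on k (ball z r)" "\<And>w. w \<in> ball z r \<Longrightarrow> hv w = \<mu> (Some (k w))"
      by (rule local_chart[OF 1(1)]) (rule that; assumption)
    have o: "open (ball z r \<inter> {z \<in> upper_half_plane. Some z \<in> U})" (is "open ?B") using U' by blast
    have "open (k ` ?B)"
    proof (rule open_mapping_thm3[OF _ o])
      show "k holomorphic_on ?B" using c(4) by (rule holomorphic_on_subset) auto
      show "inj_on k ?B" using c(5) by (rule inj_on_subset) auto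
    qed
    note W = open_chart[OF c(1) this]
    have "z \<in> ?B" using 1 x c(2) by simp
    then have z: "stereo (H x) \<in> (\<lambda>z. stereo (\<mu> (Some z))) ` (k ` ?B)"
      using c(6)[of z] H_Some[OF 1(1)] 1(2) by auto
    have "(\<lambda>z. stereo (\<mu> (Some z))) ` (k ` ?B) \<subseteq> (\<lambda>x. stereo (H x)) ` U"
    proof
      fix y assume "y \<in> (\<lambda>z. stereo (\<mu> (Some z))) ` (k ` ?B)"
      then obtain w where y: "y = stereo (\<mu> (Some (k w)))" and w: "w \<in> ball z r" "Im w > 0" "Some w \<in> U"
        by blast
      have "stereo (\<mu> (Some (k w))) = stereo (H (Some w))" using c(6)[OF w(1)] H_Some[OF w(2)] by simp
      then show "y \<in> (\<lambda>x. stereo (H x)) ` U" using w(3) y by blast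
    qed
    with W z show ?thesis by (rule that)
  next
    case (2 \<gamma>)
    obtain \<mu> where \<mu>: "compatible \<gamma> \<mu>" using compatible_exists[OF 2(1)] by blast
    then have \<mu>M: "\<mu> \<in> Mob" by (simp add: compatible_def)
    obtain F r M where F: "r > 0" "F holomorphic_on ball 0 r" "inj_on F (ball 0 r)" "F 0 = 0" "M > 0"
      "\<And>z. Im z > M \<Longrightarrow> norm (q z) < r" "\<And>z. Im z > M \<Longrightarrow> hv z = Some (F (q z))"
      by (rule expansion_at_infinity) (rule that; assumption)
    obtain M1 where M1: "M1 > 0" "\<And>z. Im z > M1 \<Longrightarrow> moebius_ext \<gamma> (Some z) \<in> U" using U' 2 x by blast
    define M2 where "M2 = max M M1"
    \<comment> \<open>The second bound makes every nonzero \<open>w\<close> of the disc equal to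
      \<open>q z\<close> with z above \<open>M2\<close>; the centre of the disc is supplied by the
      cusp itself.\<close>
    define e where "e = min r (exp (- (2 * pi / real m) * M2))"
    have e: "e > 0" using F(1) by (simp add: e_def)
    have "open (F ` ball 0 e)"
    proof (rule open_mapping_thm3[OF _ open_ball])
      show "F holomorphic_on ball 0 e" using F(2) by (rule holomorphic_on_subset) (auto simp: e_def)
      show "inj_on F (ball 0 e)" using F(3) by (rule inj_on_subset) (auto simp: e_def)
    qed
    note W = open_chart[OF \<mu>M this]
      have "stereo (H x) = stereo (\<mu> (Some (F 0)))" using H_cusp[OF \<mu>] 2(2) F(4) by simp
      moreover have "(0::complex) \<in> ball 0 e" using e by simp
      ultimately have x0: "stereo (H x) \<in> (\<lambda>z. stereo (\<mu> (Some z))) ` F ` ball 0 e" by blast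
      have "(\<lambda>z. stereo (\<mu> (Some z))) ` F ` ball 0 e \<subseteq> (\<lambda>x. stereo (H x)) ` U"
      proof
        fix y assume "y \<in> (\<lambda>z. stereo (\<mu> (Some z))) ` F ` ball 0 e"
        then obtain w :: complex where y: "y = stereo (\<mu> (Some (F w)))" and w: "w \<in> ball 0 e" by blast
        show "y \<in> (\<lambda>x. stereo (H x)) ` U"
        proof (cases "w = 0")
          case True
          then have "stereo (\<mu> (Some (F w))) = stereo (H x)" using H_cusp[OF \<mu>] 2(2) F(4) by simp
          then show ?thesis using x y by blast
        next
          case False
          have "norm w < exp (- (2 * pi / real m) * M2)" using w by (simp add: e_def)
          from q_surj[OF False this] obtain z where z: "Im z > M2" "q z = w" by blast
          then have zM: "Im z > M" "Im z > M1" "Im z > 0" using F(5) by (auto simp: M2_def)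
          have zp: "Some z \<in> extended_half_plane_points" using zM by (simp add: extended_half_plane_points_def)
          have "H (moebius_ext \<gamma> (Some z)) = \<mu> (Some (F w))"
            using H_equivariant[OF \<mu> zp] H_Some[OF zM(3)] F(7)[OF zM(1)] z(2) by simp
          then have "stereo (\<mu> (Some (F w))) = stereo (H (moebius_ext \<gamma> (Some z)))" by simp
          then show ?thesis using M1(2)[OF zM(2)] y by blast
        qed
      qed
    with W x0 show ?thesis by (rule that)
  qed
qed

lemma open_map_H: "open_map extended_half_plane (top_of_set (sphere 0 1)) (\<lambda>x. stereo (H x))"
  unfolding open_map_def
proof (intro allI impI)
  fix U assume U: "openin extended_half_plane U"
  show "openin (top_of_set (sphere 0 1)) ((\<lambda>x. stereo (H x)) ` U)"
  proof (subst openin_subopen, intro ballI)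
    fix y assume "y \<in> (\<lambda>x. stereo (H x)) ` U"
    then obtain x where x: "x \<in> U" "y = stereo (H x)" by blast
    from H_local_image[OF U x(1)] obtain W where
      "openin (top_of_set (sphere 0 1)) W" "stereo (H x) \<in> W" "W \<subseteq> (\<lambda>x. stereo (H x)) ` U" by metis
    then show "\<exists>T. openin (top_of_set (sphere 0 1)) T \<and> y \<in> T \<and> T \<subseteq> (\<lambda>x. stereo (H x)) ` U"
      using x(2) by blast
  qed
qed

text \<open>At an interior point \<open>H\<close> is injective even before passing to orbits, so
  elliptic points cause no ramification. Near a cusp equal values have equal parameters q, and then
  the points differ by a conjugate of a translation by a multiple of the level.\<close>

lemma H_locally_injective_mod_\<Gamma>:
  assumes "x \<in> extended_half_plane_points"
  obtains U where "openin extended_half_plane U" "x \<in> U" "\<And>u v. u \<in> U \<Longrightarrow> v \<in> U \<Longrightarrow> H u = H v \<Longrightarrow> p u = p v"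
  using assms
proof (cases rule: extended_half_plane_points_cases)
  case (1 z)
  obtain \<mu> k r where c: "\<mu> \<in> Mob" "r > 0" "ball z r \<subseteq> upper_half_plane" "k holomorphic_on ball z r"
    "inj_on k (ball z r)" "\<And>w. w \<in> ball z r \<Longrightarrow> hv w = \<mu> (Some (k w))"
    by (rule local_chart[OF 1(1)]) (rule that; assumption)
  show ?thesis
  proof (rule that)
    show "openin extended_half_plane (Some ` ball z r)" by (rule openin_Some_image[OF open_ball c(3)])
    show "x \<in> Some ` ball z r" using 1(2) c(2) by simp
    fix u v assume uv: "u \<in> Some ` ball z r" "v \<in> Some ` ball z r" "H u = H v"
    then obtain a b where ab: "u = Some a" "a \<in> ball z r" "v = Some b" "b \<in> ball z r" by blast
    have "Im a > 0" "Im b > 0" using ab c(3) by blast+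
    then have "\<mu> (Some (k a)) = \<mu> (Some (k b))" using uv(3) ab c(6) H_Some by simp
    then have "k a = k b" using injD[OF Mob_inj[OF c(1)]] by blast
    then have "a = b" using c(5) ab by (auto dest: inj_onD)
    then show "p u = p v" using ab by simp
  qed
next
  case (2 \<gamma>)
  obtain \<mu> where \<mu>: "compatible \<gamma> \<mu>" using compatible_exists[OF 2(1)] by blast
  then have \<mu>M: "\<mu> \<in> Mob" by (simp add: compatible_def)
  obtain F r M where F: "r > 0" "F holomorphic_on ball 0 r" "inj_on F (ball 0 r)" "F 0 = 0" "M > 0"
    "\<And>z. Im z > M \<Longrightarrow> norm (q z) < r" "\<And>z. Im z > M \<Longrightarrow> hv z = Some (F (q z))"
    by (rule expansion_at_infinity) (rule that; assumption)
  have op: "openin extended_half_plane (cusp_nbhd M)" using openin_cusp_nbhd F(5) by simp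
  have HN: "H (Some z) = Some (F (q z)) \<and> F (q z) \<noteq> 0" if "Im z > M" for z
  proof
    have "Im z > 0" using that F(5) by linarith
    then show "H (Some z) = Some (F (q z))" using F(7)[OF that] H_Some by simp
    have "q z \<noteq> 0" by (simp add: q_def)
    then show "F (q z) \<noteq> 0" using F(3,4,1) F(6)[OF that] by (metis centre_in_ball dist_0_norm inj_onD mem_ball)
  qed
  show ?thesis
  proof (rule that)
    show "openin extended_half_plane (moebius_ext \<gamma> ` cusp_nbhd M)" by (rule openin_moebius_ext_image[OF 2(1) op])
    show "x \<in> moebius_ext \<gamma> ` cusp_nbhd M" using 2(2) by (simp add: cusp_nbhd_def)
    fix u v assume uv: "u \<in> moebius_ext \<gamma> ` cusp_nbhd M" "v \<in> moebius_ext \<gamma> ` cusp_nbhd M" "H u = H v"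
    then obtain a b where ab: "u = moebius_ext \<gamma> a" "a \<in> cusp_nbhd M" "v = moebius_ext \<gamma> b" "b \<in> cusp_nbhd M" by blast
    have "a \<in> extended_half_plane_points" "b \<in> extended_half_plane_points"
      using ab openin_subset[OF op] by (auto simp: topspace_extended_half_plane)
    then have "\<mu> (H a) = \<mu> (H b)" using uv(3) ab H_equivariant[OF \<mu>] by simp
    then have Hab: "H a = H b" using injD[OF Mob_inj[OF \<mu>M]] by blast
    show "p u = p v"
    proof (cases a)
      case None
      have "b = None"
      proof (rule ccontr)
        assume "b \<noteq> None"
        then obtain z where "b = Some z" "Im z > M" using ab(4) by (auto simp: cusp_nbhd_def)
        then show False using HN[of z] Hab None H_None by simp
      qed
      then show ?thesis using None ab by simp
    next
      case (Some z)
      then have z: "Im z > M" using ab(2) by (auto simp: cusp_nbhd_def)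
      have "b \<noteq> None"
      proof
        assume "b = None"
        then have "H (Some z) = Some 0" using Hab Some H_None by simp
        then show False using HN[OF z] by simp
      qed
      then obtain w where w: "b = Some w" "Im w > M" using ab(4) by (auto simp: cusp_nbhd_def)
      have "F (q z) = F (q w)" using HN[OF z] HN[OF w(2)] Hab Some w(1) by simp
      then have "q z = q w" using F(3) F(6)[OF z] F(6)[OF w(2)] by (auto dest!: inj_onD)
      then obtain k :: int where k: "z = w + of_int (int m * k)" by (rule q_eq_iff)
      define T where "T = mat2 1 (int m * k) 0 1"
      have T: "T \<in> \<Gamma>" "T \<in> carrier SL2Z" unfolding T_def by (rule translation_in_\<Gamma>, rule translation_in_SL2Z)
      have wpos: "Im w > 0" using w(2) F(5) by linarith
      have "moebius_ext T b = a" unfolding w(1) moebius_ext_Some[OF T(2) wpos] Some k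
        by (simp add: T_def moebius_def)
      then have "u = moebius_ext (\<gamma> ** T) b" using ab(1) moebius_ext_mult[OF T(2)] by simp
      \<comment> \<open>The translation lies in \<Gamma> at infinity; at the cusp \<gamma>
        \<infinity> its conjugate by \<gamma> is needed, and normality provides it.\<close>
      also have "\<gamma> ** T = \<gamma> ** T ** adj \<gamma> ** \<gamma>"
        using adj_SL2Z(2)[OF 2(1)] by (simp flip: matrix_mul_assoc)
      also have "moebius_ext (\<gamma> ** T ** adj \<gamma> ** \<gamma>) b = moebius_ext (\<gamma> ** T ** adj \<gamma>) v"
        unfolding ab(3) by (rule moebius_ext_mult[OF 2(1)])
      finally show ?thesis using orbit_moebius_ext[OF \<Gamma>_normal[OF 2(1) T(1)]] by simp
    qed
  qed
qed

section \<open>Descent to the modular curve\<close>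

definition G :: "complex option set \<Rightarrow> complex \<times> real" where
  "G X = stereo (H (SOME x. x \<in> X))"

lemma G_orbit:
  assumes "x \<in> extended_half_plane_points"
  shows "G (p x) = stereo (H x)"
proof -
  have "(SOME y. y \<in> p x) \<in> p x" using in_orbit by (rule someI)
  then obtain \<gamma> where "\<gamma> \<in> \<Gamma>" "(SOME y. y \<in> p x) = moebius_ext \<gamma> x" by (auto simp: modular_orbit_def)
  then show ?thesis unfolding G_def using H_\<Gamma>[OF _ assms] by simp
qed

lemma continuous_map_G: "continuous_map (modular_curve \<Gamma>) (top_of_set (sphere 0 1)) G"
proof -
  have "continuous_map extended_half_plane (top_of_set (sphere 0 1)) (G \<circ> p)"
    using continuous_map_H by (rule continuous_map_eq) (simp add: G_orbit topspace_extended_half_plane)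
  then show ?thesis using continuous_compose_quotient_map[OF quotient_map_modular_orbit] by blast
qed

lemma open_map_G: "open_map (modular_curve \<Gamma>) (top_of_set (sphere 0 1)) G"
  unfolding open_map_def
proof (intro allI impI)
  fix V assume V: "openin (modular_curve \<Gamma>) V"
  let ?U = "{x \<in> topspace extended_half_plane. p x \<in> V}"
  have "openin extended_half_plane ?U" by (rule openin_continuous_map_preimage[OF continuous_map_orbit V])
  then have "openin (top_of_set (sphere 0 1)) ((\<lambda>x. stereo (H x)) ` ?U)"
    using open_map_H unfolding open_map_def by blast
  moreover have "(\<lambda>x. stereo (H x)) ` ?U = G ` V"
  proof (intro equalityI subsetI)
    fix y assume "y \<in> (\<lambda>x. stereo (H x)) ` ?U"
    then show "y \<in> G ` V" using G_orbit by (auto simp: topspace_extended_half_plane image_iff) metis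
  next
    fix y assume "y \<in> G ` V"
    then obtain X where X: "X \<in> V" "y = G X" by blast
    then have "X \<in> p ` extended_half_plane_points" using openin_subset[OF V] topspace_modular_curve by blast
    then obtain x where "x \<in> extended_half_plane_points" "X = p x" by blast
    then show "y \<in> (\<lambda>x. stereo (H x)) ` ?U" using X G_orbit[of x] by (auto simp: topspace_extended_half_plane)
  qed
  ultimately show "openin (top_of_set (sphere 0 1)) (G ` V)" by simp
qed

sublocale unramified_map "modular_curve \<Gamma>" "sphere 0 1 :: (complex \<times> real) set" G
proof
  obtain R where "finite R" "R \<subseteq> carrier SL2Z" "\<And>\<gamma>. \<gamma> \<in> carrier SL2Z \<Longrightarrow> \<exists>\<delta>\<in>\<Gamma>. \<exists>r\<in>R. \<gamma> = \<delta> ** r"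
    using coset_representatives by blast
  then show "compact_space (modular_curve \<Gamma>)" by (rule compact_modular_curve)
  fix X assume "X \<in> topspace (modular_curve \<Gamma>)"
  then obtain x where x: "x \<in> extended_half_plane_points" "X = p x" unfolding topspace_modular_curve by blast
  obtain U where U: "openin extended_half_plane U" "x \<in> U" "\<And>u v. u \<in> U \<Longrightarrow> v \<in> U \<Longrightarrow> H u = H v \<Longrightarrow> p u = p v"
    using H_locally_injective_mod_\<Gamma>[OF x(1)] by blast
  have Us: "u \<in> extended_half_plane_points" if "u \<in> U" for u
    using openin_subset[OF U(1)] that topspace_extended_half_plane by blast
  have "inj_on G (p ` U)"
  proof (rule inj_onI)
    fix Y Z assume "Y \<in> p ` U" "Z \<in> p ` U" "G Y = G Z"
    then obtain u v where uv: "u \<in> U" "v \<in> U" "Y = p u" "Z = p v" by blast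
    then have "stereo (H u) = stereo (H v)" using \<open>G Y = G Z\<close> G_orbit Us by simp
    then have "H u = H v" by (rule injD[OF inj_stereo])
    then show "Y = Z" unfolding uv(3,4) by (rule U(3)[OF uv(1,2)])
  qed
  moreover have "openin (modular_curve \<Gamma>) (p ` U)" using open_map_orbit U(1) unfolding open_map_def by blast
  ultimately show "\<exists>U. openin (modular_curve \<Gamma>) U \<and> X \<in> U \<and> inj_on G U" using x U(2) by blast
qed (fact Hausdorff_modular_curve continuous_map_G open_map_G)+

text \<open>Lifting gives injectivity. The image is open, and compact hence closed, so it is the
  whole connected sphere; a continuous bijection from a compact space to a Hausdorff space is a
  homeomorphism.\<close>

theorem genus_zero: "has_genus (modular_curve \<Gamma>) 0"
proof (rule has_genus_0_if_homeomorphic_sphere)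
  have "simply_connected (sphere 0 1 :: (complex \<times> real) set)"
    by (rule simply_connected_sphere) (simp add: DIM_complex)
  from injective_if_simply_connected[OF path_connected_modular_curve this]
  have inj: "inj_on G (topspace (modular_curve \<Gamma>))" .
  have "openin (top_of_set (sphere 0 1)) (G ` topspace (modular_curve \<Gamma>))"
    using open_map_G unfolding open_map_def by blast
  moreover have "closedin (top_of_set (sphere 0 1)) (G ` topspace (modular_curve \<Gamma>))"
  proof (rule compactin_imp_closedin)
    show "compactin (top_of_set (sphere 0 1)) (G ` topspace (modular_curve \<Gamma>))"
      using comp continuous_map_G image_compactin unfolding compact_space_def by blast
  qed (auto simp: Hausdorff_space_subtopology)
  moreover have "connected (sphere 0 1 :: (complex \<times> real) set)"
    by (rule connected_sphere) (simp add: DIM_complex)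
  moreover have "G ` topspace (modular_curve \<Gamma>) \<noteq> {}"
    unfolding topspace_modular_curve by (auto simp: extended_half_plane_points_def)
  ultimately have surj: "G ` topspace (modular_curve \<Gamma>) = sphere 0 1"
    unfolding connected_clopen by blast
  have "homeomorphic_map (modular_curve \<Gamma>) (top_of_set (sphere 0 1)) G"
    by (rule continuous_imp_homeomorphic_map[OF continuous_map_G comp _ _ inj])
       (auto simp: surj Hausdorff_space_subtopology)
  then show "modular_curve \<Gamma> homeomorphic_space top_of_set (sphere 0 1 :: (complex \<times> real) set)"
    by (rule homeomorphic_map_imp_homeomorphic_space)
qed

end

theorem theorem6p2:
  fixes s :: complex and h :: "complex \<Rightarrow> complex" and \<Gamma> :: "(int^2^2) set"
  assumes "solves_schwarzian_E4 s h"
    and "\<Gamma> = invariance_group h"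
    and "simple_zero_at_infinity (level \<Gamma>) h"
    and "finite (rcosets\<^bsub>SL2Z\<^esub> \<Gamma>)"
  shows "has_genus (modular_curve \<Gamma>) 0"
proof -
  interpret genus_zero_setting s h \<Gamma>
    using assms by unfold_locales
  show ?thesis by (rule genus_zero)
qed

end
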